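(* Let $c\ge 1$ and $k\ge 3$ be fixed integers and let $\{\Lambda_{\boldsymbol w}\}_{\boldsymbol w\in\mathcal C_k^c}$ be a fixed family of real numbers, not all zero. With $A(n)$, $g$ and $\Psi$ as defined in the context, suppose that all critical points $\boldsymbol z\in\Psi$ of $g$ are non-degenerate, i.e. $\det(\operatorname{Hess} g(\boldsymbol z))\neq 0$. Then $$A(n)\sim \frac{1}{2\pi}(\ell-1)!\sum_{\boldsymbol z\in\Psi}\frac{(-g(\boldsymbol z))^{-\ell}}{\sqrt{(-1)^{c-1}\det(\operatorname{Hess} g(\boldsymbol z))}}\qquad\text{for large integers } \ell=n\left(\tfrac{k}{2}-1\right),$$ that is, as $n\to\infty$ through those positive integers $n$ for which $\ell=n(\tfrac k2-1)$ is an integer.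
   Context: Multi-index notation: for $\boldsymbol w=(w_1,\dots,w_c)\in\mathbb Z_{\ge0}^c$, $|\boldsymbol w|=w_1+\dots+w_c$, $\boldsymbol w!=w_1!\cdots w_c!$, $\boldsymbol x^{\boldsymbol w}=x_1^{w_1}\cdots x_c^{w_c}$. $\mathcal C_k^c=\{\boldsymbol w\in\mathbb Z_{\ge0}^c: |\boldsymbol w|=k\}$. $A(n)\sim B(n)$ means $\lim A(n)/B(n)=1$. Graphs. Let $H_1,\dots,H_c$ be disjoint finite sets (half-edge labels, one set per color). An edge-colored $(H_1,\dots,H_c)$-half-edge labeled graph is a tuple $\Gamma=(V,E_1,\dots,E_c)$ where $V$ (the set of vertices) is a set partition of $H_1\sqcup\dots\sqcup H_c$ and, for each $i$, $E_i$ is a set partition of $H_i$ into blocks of size two (the edges of color $i$). Multiple edges and self-loops are allowed. The multidegree of $v\in V$ is $\deg(v)=(|v\cap H_1|,\dots,|v\cap H_c|)$. An isomorphism between two such graphs $\Gamma=(V,E_1,\dots,E_c)$ and $\Gamma'=(V',E_1',\dots,E_c')$ is a tuple of bijections $H_i\to H_i'$ ($i=1,\dots,c$) carrying the partitions $V,E_1,\dots,E_c$ to $V',E_1',\dots,E_c'$. $\operatorname{Aut}(\Gamma)$ is the group of isomorphisms of $\Gamma$ to itself; for an isomorphism class $G=[\Gamma]$, $\operatorname{Aut}(G):=\operatorname{Aut}(\Gamma)$ and $V_G$ is its vertex set. The graph is $k$-regular if $|\deg(v)|=k$ for every vertex $v$. $\mathcal G_k^c(n)$ is the set of isomorphism classes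 of $k$-regular edge-colored half-edge labeled graphs (with $c$ colors) with $n$ vertices. The weighted count is $$A(n)=\sum_{G\in\mathcal G_k^c(n)}\frac{1}{|\operatorname{Aut}(G)|}\prod_{v\in V_G}\Lambda_{\deg(v)}.$$ Polynomial and critical points. Let $g(x_1,\dots,x_c)=-\sum_{i=1}^c\frac{x_i^2}{2}+\sum_{\boldsymbol w\in\mathcal C_k^c}\Lambda_{\boldsymbol w}\frac{\boldsymbol x^{\boldsymbol w}}{\boldsymbol w!}$. Let $S^{c-1}\subset\mathbb R^c$ be the real unit sphere and $$\operatorname{crit}^*(g)=\Big\{\boldsymbol z\in\mathbb C^c: \tfrac{\partial g}{\partial x_1}(\boldsymbol z)=\dots=\tfrac{\partial g}{\partial x_c}(\boldsymbol z)=0 \text{ and } \boldsymbol z=\tau\boldsymbol x \text{ for some }\tau\in\mathbb C\setminus\{0\},\ \boldsymbol x\in S^{c-1}\Big\}.$$ $\Psi$ is the set of those $\boldsymbol z=\tau\boldsymbol x\in\operatorname{crit}^*(g)$ for which $|\tau|$ is minimal. $\operatorname{Hess} g$ is the symmetric $c\times c$ matrix of second partial derivatives of $g$. Square roots are principal square roots.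
   Formalization: The limit A(n)/B(n) → 1 is taken along admissible n where the right-hand side B(n) is non-zero, since for even k and odd n its terms can cancel to 0; on all admissible n it is shown that A(n)−B(n) is o of the formula with each term of the sum replaced by its absolute value. *)

theory Defs
  imports "HOL-Analysis.Analysis" "HOL-Library.Landau_Symbols"
begin

text \<open>
  The colors are the elements of a finite type \<open>'c\<close>, so \<open>c = CARD('c) \<ge> 1\<close>.
  Multi-indices are functions \<open>'c \<Rightarrow> nat\<close>.
\<close>

definition msize :: "('c::finite \<Rightarrow> nat) \<Rightarrow> nat"
  where "msize w = (\<Sum>i\<in>UNIV. w i)"

definition mfact :: "('c::finite \<Rightarrow> nat) \<Rightarrow> nat"
  where "mfact w = (\<Prod>i\<in>UNIV. fact (w i))"

definition mpower :: "complex^'c \<Rightarrow> ('c::finite \<Rightarrow> nat) \<Rightarrow> complex"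
  where "mpower x w = (\<Prod>i\<in>UNIV. (x $ i) ^ w i)"

definition multi_indices :: "nat \<Rightarrow> ('c::finite \<Rightarrow> nat) set"
  where "multi_indices k = {w. msize w = k}"


section \<open>Edge-colored half-edge labeled graphs\<close>

record ('c, 'h) hgraph =
  halves :: "'c \<Rightarrow> 'h set"
  verts :: "'h set set"
  edges :: "'c \<Rightarrow> 'h set set"

definition is_hgraph :: "('c::finite, 'h) hgraph \<Rightarrow> bool"
  where "is_hgraph \<Gamma> \<longleftrightarrow>
    (\<forall>i. finite (halves \<Gamma> i)) \<and>
    (\<forall>i j. i \<noteq> j \<longrightarrow> halves \<Gamma> i \<inter> halves \<Gamma> j = {}) \<and>
    partition_on (\<Union>i. halves \<Gamma> i) (verts \<Gamma>) \<and>
    (\<forall>i. partition_on (halves \<Gamma> i) (edges \<Gamma> i) \<and> (\<forall>e\<in>edges \<Gamma> i. card e = 2))"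

definition multideg :: "('c::finite, 'h) hgraph \<Rightarrow> 'h set \<Rightarrow> 'c \<Rightarrow> nat"
  where "multideg \<Gamma> v = (\<lambda>i. card (v \<inter> halves \<Gamma> i))"

definition regular :: "nat \<Rightarrow> ('c::finite, 'h) hgraph \<Rightarrow> bool"
  where "regular k \<Gamma> \<longleftrightarrow> (\<forall>v\<in>verts \<Gamma>. msize (multideg \<Gamma> v) = k)"

text \<open>
  The component \<open>\<phi> i\<close> of an isomorphism is extensional, that is, fixed to \<open>undefined\<close> outside of
  \<open>halves \<Gamma> i\<close>, so that isomorphisms correspond to tuples of bijections one-to-one and \<open>Aut\<close> has
  the right cardinality.
\<close>

definition isos :: "('c::finite, 'h) hgraph \<Rightarrow> ('c, 'g) hgraph \<Rightarrow> ('c \<Rightarrow> 'h \<Rightarrow> 'g) set"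
  where "isos \<Gamma> \<Gamma>' = {\<phi>.
    (\<forall>i. \<phi> i \<in> extensional (halves \<Gamma> i) \<and> bij_betw (\<phi> i) (halves \<Gamma> i) (halves \<Gamma>' i)) \<and>
    (\<lambda>v. \<Union>i. \<phi> i ` (v \<inter> halves \<Gamma> i)) ` verts \<Gamma> = verts \<Gamma>' \<and>
    (\<forall>i. (\<lambda>e. \<phi> i ` e) ` edges \<Gamma> i = edges \<Gamma>' i)}"

definition Aut :: "('c::finite, 'h) hgraph \<Rightarrow> ('c \<Rightarrow> 'h \<Rightarrow> 'h) set"
  where "Aut \<Gamma> = isos \<Gamma> \<Gamma>"

text \<open>
  Half-edge labels are natural numbers: every graph with finite label sets is isomorphic to one
  with such labels, so nothing is lost by taking isomorphism classes of these only.
\<close>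

definition iso_rel :: "(('c::finite, nat) hgraph \<times> ('c, nat) hgraph) set"
  where "iso_rel = {(\<Gamma>, \<Gamma>'). is_hgraph \<Gamma> \<and> is_hgraph \<Gamma>' \<and> isos \<Gamma> \<Gamma>' \<noteq> {}}"

definition iso_classes :: "nat \<Rightarrow> nat \<Rightarrow> ('c::finite, nat) hgraph set set"
  where "iso_classes k n =
    {\<Gamma>. is_hgraph \<Gamma> \<and> regular k \<Gamma> \<and> card (verts \<Gamma>) = n} // iso_rel"

definition graph_weight :: "(('c::finite \<Rightarrow> nat) \<Rightarrow> real) \<Rightarrow> ('c, 'h) hgraph \<Rightarrow> real"
  where "graph_weight \<Lambda> \<Gamma> = 1 / real (card (Aut \<Gamma>)) * (\<Prod>v\<in>verts \<Gamma>. \<Lambda> (multideg \<Gamma> v))"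

definition graph_sum :: "nat \<Rightarrow> (('c::finite \<Rightarrow> nat) \<Rightarrow> real) \<Rightarrow> nat \<Rightarrow> real"
  where "graph_sum k \<Lambda> n = (\<Sum>G\<in>iso_classes k n. graph_weight \<Lambda> (SOME \<Gamma>. \<Gamma> \<in> G))"


section \<open>The polynomial and its critical points\<close>

definition action_poly :: "nat \<Rightarrow> (('c::finite \<Rightarrow> nat) \<Rightarrow> real) \<Rightarrow> complex^'c \<Rightarrow> complex"
  where "action_poly k \<Lambda> x =
    - (\<Sum>i\<in>UNIV. (x $ i)\<^sup>2 / 2) +
    (\<Sum>w\<in>multi_indices k. of_real (\<Lambda> w) * (mpower x w / of_nat (mfact w)))"

definition partial :: "'c::finite \<Rightarrow> (complex^'c \<Rightarrow> complex) \<Rightarrow> complex^'c \<Rightarrow> complex"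
  where "partial i f z = deriv (\<lambda>t. f (\<chi> j. if j = i then t else z $ j)) (z $ i)"

definition Hess :: "(complex^'c \<Rightarrow> complex) \<Rightarrow> complex^'c \<Rightarrow> complex^'c^'c::finite"
  where "Hess f z = (\<chi> i j. partial i (partial j f) z)"

definition cscale :: "complex \<Rightarrow> real^'c \<Rightarrow> complex^'c::finite"
  where "cscale \<tau> x = (\<chi> i. \<tau> * of_real (x $ i))"

text \<open>
  The pairs \<open>(\<tau>, x)\<close> for which \<open>\<tau>x\<close> is a point of \<open>crit\<^sup>*(f)\<close>.
\<close>

definition crit_pairs :: "(complex^'c \<Rightarrow> complex) \<Rightarrow> (complex \<times> (real^'c::finite)) set"
  where "crit_pairs f =
    {(\<tau>, x). \<tau> \<noteq> 0 \<and> x \<in> sphere 0 1 \<and> (\<forall>i. partial i f (cscale \<tau> x) = 0)}"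

definition Psi :: "(complex^'c \<Rightarrow> complex) \<Rightarrow> (complex^'c::finite) set"
  where "Psi f = {cscale \<tau> x | \<tau> x.
    (\<tau>, x) \<in> crit_pairs f \<and> (\<forall>(\<tau>', x')\<in>crit_pairs f. norm \<tau> \<le> norm \<tau>')}"


section \<open>The asymptotic formula\<close>

definition admissible :: "nat \<Rightarrow> nat set"
  where "admissible k = {n. 0 < n \<and> real n * (real k / 2 - 1) \<in> \<int>}"

definition ell :: "nat \<Rightarrow> nat \<Rightarrow> nat"
  where "ell k n = nat \<lfloor>real n * (real k / 2 - 1)\<rfloor>"

definition crit_term :: "(complex^'c \<Rightarrow> complex) \<Rightarrow> nat \<Rightarrow> complex^'c::finite \<Rightarrow> complex"
  where "crit_term f l z =
    (- f z) powi (- int l) / csqrt ((-1) ^ (CARD('c) - 1) * det (Hess f z))"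

definition crit_sum :: "nat \<Rightarrow> (('c::finite \<Rightarrow> nat) \<Rightarrow> real) \<Rightarrow> nat \<Rightarrow> complex"
  where "crit_sum k \<Lambda> n =
    1 / (2 * of_real pi) * fact (ell k n - 1) *
    (\<Sum>z\<in>Psi (action_poly k \<Lambda>). crit_term (action_poly k \<Lambda>) (ell k n) z)"

text \<open>
  For even \<open>k\<close> and odd \<open>n\<close> the terms of \<open>crit_sum\<close> can cancel to exactly \<open>0\<close>, and the quotient
  \<open>A(n)/B(n)\<close> defining \<open>A(n) \<sim> B(n)\<close> is then undefined, whether or not \<open>A(n) = 0\<close>. For \<open>c = 2\<close> and
  \<open>k = 8\<close>, if the homogeneous part of \<open>g\<close> is
  \<open>(x\<^sup>2 - y\<^sup>2)(x\<^sup>2 + y\<^sup>2)\<^sup>3 + x\<^sup>4y\<^sup>4\<close>, then \<open>B(n) = 0 < A(n)\<close> for all odd \<open>n\<close>.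
  The limit of quotients is therefore taken along the filter \<open>quotient_at_top\<close> of those \<open>n\<close> where the
  denominator is non-zero. On all admissible \<open>n\<close>, the cancelling ones included, the difference
  \<open>A(n) - B(n)\<close> is compared with \<open>crit_scale\<close>, the formula \<open>B(n)\<close> with each term of the sum
  replaced by its absolute value.
\<close>

definition admissible_at_top :: "nat \<Rightarrow> nat filter"
  where "admissible_at_top k = inf at_top (principal (admissible k))"

definition quotient_at_top :: "nat \<Rightarrow> (nat \<Rightarrow> complex) \<Rightarrow> nat filter"
  where "quotient_at_top k B = inf at_top (principal {n \<in> admissible k. B n \<noteq> 0})"

definition crit_scale :: "nat \<Rightarrow> (('c::finite \<Rightarrow> nat) \<Rightarrow> real) \<Rightarrow> nat \<Rightarrow> complex"
  where "crit_scale k \<Lambda> n =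
    1 / (2 * of_real pi) * fact (ell k n - 1) *
    of_real (\<Sum>z\<in>Psi (action_poly k \<Lambda>). norm (crit_term (action_poly k \<Lambda>) (ell k n) z))"

end

theory Submission
  imports Defs "HOL-Probability.Probability" "HOL-Real_Asymp.Real_Asymp"
begin

text \<open>
  Write \<open>V(x) = (\<Sum>w. \<Lambda>\<^sub>w x\<^sup>w / w!)\<close>. Counting labeled graphs, and using that the number of perfect
  matchings of \<open>h\<close> half-edges is the \<open>h\<close>-th moment of a standard normal variable, gives
  \<open>n! A(n) = E[V(Z)\<^sup>n]\<close> for a standard Gaussian vector \<open>Z\<close>. The substitution \<open>x = \<surd>n y\<close> turns the
  expectation into the integral of \<open>\<phi>\<^sup>n\<close> with \<open>\<phi>(y) = V(y) exp (-|y|\<^sup>2/2)\<close>, to which Laplace's method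
  applies: \<open>|\<phi>|\<close> is maximal exactly at \<open>y = \<surd>k x\<close>, where \<open>x\<close> runs through the unit vectors
  maximizing \<open>|V|\<close>. These \<open>x\<close> correspond to the critical points \<open>z = \<tau>x\<close> in \<open>\<Psi>\<close> through
  \<open>\<tau>\<^bsup>k-2\<^esup> = 1 / (k V(x))\<close>. There \<open>-\<phi>''/\<phi> = -H + k x x\<^sup>T\<close> with \<open>H = Hess g(z)\<close> and
  \<open>H x = (k-2) x\<close>, which relates the two determinants. Stirling's formula converts the prefactors
  into each other.
\<close>

section \<open>Counting functions, partitions and pairings\<close>

text \<open>The integral sees only the real maximizers x, whereas \<open>\<Psi>\<close> consists of
  complex points. All k - 2 roots \<open>\<tau>\<close> over one x contribute the same term: the
  Hessian depends on \<open>\<tau>\<close> only through the real number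
  \<open>\<tau> ^ (k - 2)\<close>, and 2 l = n (k - 2) does the same for the power of -g. As each
  point is reached from two pairs, a sum over \<open>\<Psi>\<close> is (k - 2) / 2 times a sum over
  x. The matrices -H and -H + k x x^T agree orthogonally to x, but along x they have the eigenvalues
  -(k - 2) and 2. So their determinants differ by the factor -2 / (k - 2), whose sign is the origin
  of (-1)^(c - 1) in the formula. The radicand is therefore positive and the principal root is an
  ordinary real one. The obstacle is cancellation: for odd n the terms carry the sign of V(x) and
  may add up to 0. Errors are therefore kept as differences, measured against the sum of absolute
  values, and a quotient is formed only at the very end, where the signed sum, which depends on n
  only through its parity, does not vanish.\<close>

lemma card_bij_extensional:
  assumes "finite A" "finite B" "card A = card B"
  shows "card {f \<in> extensional A. bij_betw f A B} = fact (card A)"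
proof -
  have "{f \<in> extensional A. bij_betw f A B} = {f \<in> A \<rightarrow>\<^sub>E B. inj_on f A}"
  proof (intro equalityI subsetI)
    fix f assume "f \<in> {f \<in> A \<rightarrow>\<^sub>E B. inj_on f A}"
    then have f: "f \<in> A \<rightarrow>\<^sub>E B" "inj_on f A" by auto
    then have "f ` A \<subseteq> B" by auto
    moreover have "card (f ` A) = card B" using f assms by (simp add: card_image)
    ultimately have "f ` A = B" using assms by (simp add: card_subset_eq)
    then show "f \<in> {f \<in> extensional A. bij_betw f A B}"
      using f by (auto simp: bij_betw_def PiE_def)
  qed (auto simp: bij_betw_def PiE_def)
  moreover have "card {f \<in> A \<rightarrow>\<^sub>E B. inj_on f A} = prod ((-) (card B)) {0..<card A}"
    using assms by (subst card_inj_on_subset_funcset) auto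
  moreover have "\<dots> = fact (card A)"
    using assms by (simp add: fact_prod_rev)
  ultimately show ?thesis by simp
qed

text \<open>This is the multinomial coefficient, with the factorials multiplied over so that
  everything stays in the naturals. The recursion removes \<open>x\<close>: its value
  \<open>j\<close> must have positive demand, and the rest of the function meets the demands lowered
  by one at \<open>j\<close>.\<close>

lemma card_funcs_fibers:
  fixes a :: "nat \<Rightarrow> nat" and A :: "'a set"
  assumes "finite A" "(\<Sum>j<n. a j) = card A"
  shows "card {f \<in> A \<rightarrow>\<^sub>E {..<n}. \<forall>j<n. card {x \<in> A. f x = j} = a j} * (\<Prod>j<n. fact (a j)) = fact (card A)"
  using assms
proof (induction A arbitrary: a rule: finite_induct)
  case empty
  then have "\<forall>j<n. a j = 0" by (metis card.empty finite_lessThan lessThan_iff sum_eq_0_iff)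
  then show ?case by simp
next
  case (insert x A)
  define S where "S = (\<lambda>(B :: 'a set) (a :: nat \<Rightarrow> nat). {f \<in> B \<rightarrow>\<^sub>E {..<n}. \<forall>j<n. card {x \<in> B. f x = j} =
      a j})"
  define J where "J = {j. j < n \<and> a j > 0}"
  have fin: "finite (S B a)" if "finite B" for B a
    unfolding S_def using that by (intro finite_subset[OF _ finite_PiE[of B "\<lambda>_. {..<n}"]]) auto
  have card_fib: "card {y \<in> insert x A. (f(x := i)) y = j} = card {y \<in> A. f y =
      j} + (if j = i then 1 else 0)"
    for f :: "'a \<Rightarrow> nat" and i j
  proof -
    have "{y \<in> insert x A. (f(x := i)) y = j} = {y \<in> A. f y = j} \<union> (if j = i then {x} else {})"
      using insert.hyps by auto
    then show ?thesis using insert.hyps by auto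
  qed
  have Seq: "S (insert x A) a = (\<Union>j\<in>J. (\<lambda>f. f(x := j)) ` S A (a(j := a j - 1)))" (is "?L = ?R")
  proof (intro equalityI subsetI)
    fix f assume f: "f \<in> ?L"
    define g where "g = f(x := undefined)"
    have fg: "f = g(x := f x)" by (simp add: g_def)
    have fx: "f x < n" using f by (auto simp: S_def PiE_def Pi_def)
    have cf: "card {y \<in> A. g y = j} + (if j = f x then 1 else 0) = a j" if "j < n" for j
      using card_fib[of g "f x" j] f that unfolding fg[symmetric] by (auto simp: S_def)
    have "a (f x) > 0" using cf[OF fx] by auto
    moreover have "g \<in> S A (a(f x := a (f x) - 1))"
    proof -
      have "g \<in> A \<rightarrow>\<^sub>E {..<n}"
        using f insert.hyps by (auto simp: S_def PiE_def Pi_def extensional_def g_def)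
      moreover have "card {y \<in> A. g y = j} = (a(f x := a (f x) - 1)) j" if "j < n" for j
        using cf[OF that] by (auto split: if_splits)
      ultimately show ?thesis unfolding S_def by blast
    qed
    ultimately show "f \<in> ?R" using fg fx unfolding J_def by blast
  next
    fix f assume "f \<in> ?R"
    then obtain j g where j: "j < n" "a j > 0" and g: "g \<in> S A (a(j := a j - 1))" and f: "f = g(x := j)"
      by (auto simp: J_def)
    have "f \<in> insert x A \<rightarrow>\<^sub>E {..<n}" using g j f by (auto simp: S_def PiE_def Pi_def extensional_def)
    moreover have "card {y \<in> insert x A. f y = i} = a i" if "i < n" for i
      unfolding f card_fib using g j that by (auto simp: S_def)
    ultimately show "f \<in> ?L" by (auto simp: S_def)
  qed
  have "card (S (insert x A) a) = (\<Sum>j\<in>J. card ((\<lambda>f. f(x := j)) ` S A (a(j := a j - 1))))"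
    unfolding Seq
  proof (rule card_UN_disjoint)
    show "finite J" by (simp add: J_def)
    show "\<forall>i\<in>J. finite ((\<lambda>f. f(x := i)) ` S A (a(i := a i - 1)))" using fin insert.hyps by auto
    show "\<forall>i\<in>J. \<forall>j\<in>J. i \<noteq> j \<longrightarrow>
        (\<lambda>f. f(x := i)) ` S A (a(i := a i - 1)) \<inter> (\<lambda>f. f(x := j)) ` S A (a(j := a j - 1)) = {}"
      by (auto dest: fun_cong[where x = x])
  qed
  also have "\<dots> = (\<Sum>j\<in>J. card (S A (a(j := a j - 1))))"
  proof (rule sum.cong[OF refl], rule card_image, rule inj_onI)
    fix j f g assume "f \<in> S A (a(j := a j - 1))" "g \<in> S A (a(j := a j - 1))" and eq: "f(x := j) =
        g(x := j)"
    then have "f x = undefined" "g x = undefined" using insert.hyps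
        by (auto simp: S_def PiE_def extensional_def)
    then show "f = g" using eq by (metis fun_upd_triv fun_upd_upd)
  qed
  finally have cS: "card (S (insert x A) a) = (\<Sum>j\<in>J. card (S A (a(j := a j - 1))))" .
  \<comment> \<open>The factor \<open>a j\<close> is split off from \<open>fact (a j)\<close>.
    Summed over \<open>j\<close>, these factors give the size of \<open>insert x A\<close>, which
    completes its factorial.\<close>
  have one: "card (S A (a(j := a j - 1))) * (\<Prod>i<n. fact (a i)) = a j * fact (card A)" if j: "j \<in> J" for j
  proof -
    have jn: "j < n" "a j > 0" using j by (auto simp: J_def)
    let ?b = "a(j := a j - 1)"
    have "(\<Sum>i<n. ?b i) + 1 = (\<Sum>i<n. a i)"
      using jn by (simp add: sum.remove[of "{..<n}" j])
    then have "(\<Sum>i<n. ?b i) = card A" using insert.prems insert.hyps by simp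
    then have IH: "card (S A ?b) * (\<Prod>i<n. fact (?b i)) = fact (card A)"
      unfolding S_def by (rule insert.IH)
    have "(\<Prod>i<n. fact (a i)) = a j * (\<Prod>i<n. fact (?b i) :: nat)"
      using jn by (simp add: prod.remove[of "{..<n}" j] fact_reduce)
    then show ?thesis using IH by (simp add: algebra_simps)
  qed
  have "card (S (insert x A) a) * (\<Prod>i<n. fact (a i)) = (\<Sum>j\<in>J. a j * fact (card A))"
    unfolding cS sum_distrib_right by (rule sum.cong[OF refl one])
  also have "\<dots> = (\<Sum>j<n. a j * fact (card A))"
    by (rule sum.mono_neutral_left) (auto simp: J_def)
  also have "\<dots> = fact (card (insert x A))"
    using insert.prems insert.hyps by (simp add: sum_distrib_right[symmetric])
  finally show ?case by (simp add: S_def)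
qed

lemma card_funcs_fibers_eq_0:
  fixes a :: "nat \<Rightarrow> nat"
  assumes "finite A" "(\<Sum>j<n. a j) \<noteq> card A"
  shows "{f \<in> A \<rightarrow>\<^sub>E {..<n}. \<forall>j<n. card {x \<in> A. f x = j} = a j} = {}"
proof (rule ccontr)
  assume "\<not> ?thesis"
  then obtain f where f: "f \<in> A \<rightarrow>\<^sub>E {..<n}" "\<forall>j<n. card {x \<in> A. f x = j} = a j" by auto
  have "(\<Sum>j<n. a j) = (\<Sum>j<n. card {x \<in> A. f x = j})" using f by simp
  also have "\<dots> = card (\<Union>j<n. {x \<in> A. f x = j})"
    by (intro card_UN_disjoint[symmetric]) (use assms in auto)
  also have "(\<Union>j<n. {x \<in> A. f x = j}) = A" using f by auto
  finally show False using assms by simp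
qed

text \<open>The blocks of a partition can be numbered in \<open>fact n\<close> ways, and a partition
  with numbered blocks is the same as a surjection, the blocks being its fibers. Pairs of a
  partition and a numbering mediate between the two sums.\<close>

lemma sum_partitions_eq_sum_surjections:
  fixes w :: "'a set \<Rightarrow> real"
  assumes "finite A"
  shows "fact n * (\<Sum>V | partition_on A V \<and> card V = n. \<Prod>v\<in>V. w v) =
         (\<Sum>f | f \<in> A \<rightarrow>\<^sub>E {..<n} \<and> f ` A = {..<n}. \<Prod>j<n. w {x \<in> A. f x = j})"
proof -
  define P where "P = {V. partition_on A V \<and> card V = n}"
  define fib where "fib = (\<lambda>(f :: 'a \<Rightarrow> nat) j. {x \<in> A. f x = j})"
  define toB where "toB = (\<lambda>f. (fib f ` {..<n}, \<lambda>j\<in>{..<n}. fib f j))"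
  define fromB where "fromB = (\<lambda>(V :: 'a set set, b). (\<lambda>x\<in>A. THE j. j < n \<and> x \<in> b j))"
  define B where "B = Sigma P (\<lambda>V. {b \<in> extensional {..<n}. bij_betw b {..<n} V})"
  define F where "F = {f. f \<in> A \<rightarrow>\<^sub>E {..<n} \<and> f ` A = {..<n}}"
  have finP: "finite P" unfolding P_def
    by (rule finite_subset[OF _ finitely_many_partition_on[OF assms]]) auto
  have finV: "finite V" if "V \<in> P" for V
    using that finite_elements[OF assms] by (auto simp: P_def)
  have finb: "finite {b \<in> extensional {..<n}. bij_betw b {..<n} V}" if "V \<in> P" for V
    by (rule finite_subset[OF _ finite_PiE[of "{..<n}"
        "\<lambda>_. V"]]) (use finV[OF that] in \<open>auto simp: bij_betw_def PiE_def\<close>)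
  have "(\<Sum>f\<in>F. \<Prod>j<n. w {x \<in> A. f x = j}) = (\<Sum>(V, b)\<in>B. \<Prod>j<n. w (b j))"
  proof (rule sum.reindex_bij_witness[where i = fromB and j = toB])
    fix f assume f: "f \<in> F"
    then have fA: "f ` A = {..<n}" by (auto simp: F_def)
    have inj: "inj_on (fib f) {..<n}"
    proof (rule inj_onI)
      fix i j assume ij: "i \<in> {..<n}" "j \<in> {..<n}" "fib f i = fib f j"
      then obtain x where "x \<in> A" "f x = i" unfolding fA[symmetric] by auto
      then have "x \<in> fib f j" using ij by (auto simp: fib_def)
      then show "i = j" using \<open>f x = i\<close> by (auto simp: fib_def)
    qed
    have ne: "fib f j \<noteq> {}" if "j < n" for j
    proof -
      have "j \<in> f ` A" using that fA by simp
      then show ?thesis by (auto simp: fib_def)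
    qed
    have "partition_on A (fib f ` {..<n})"
    proof (rule partition_onI)
      show "\<Union> (fib f ` {..<n}) = A" using fA by (auto simp: fib_def)
      show "{} \<notin> fib f ` {..<n}" using ne by auto
    qed (auto simp: fib_def disjnt_def)
    moreover have "card (fib f ` {..<n}) = n" using inj by (simp add: card_image)
    ultimately show "toB f \<in> B"
      using inj by (auto simp: B_def P_def bij_betw_def inj_on_def toB_def)
    show "fromB (toB f) = f"
    proof
      fix x
      show "fromB (toB f) x = f x"
      proof (cases "x \<in> A")
        case True
        then have "f x < n" using f by (auto simp: F_def)
        then show ?thesis using True unfolding fromB_def toB_def
          by (auto simp: fib_def intro!: the_equality)
      next
        case False
        then show ?thesis using f by (auto simp: F_def PiE_def extensional_def fromB_def toB_def)
      qed
    qed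
    show "(case toB f of (V, b) \<Rightarrow> \<Prod>j<n. w (b j)) = (\<Prod>j<n. w {x \<in> A. f x = j})"
      by (simp add: toB_def fib_def)
  next
    fix p assume "p \<in> B"
    then obtain V b where p: "p = (V, b)" and V: "partition_on A V" "card V = n"
      and b: "b \<in> extensional {..<n}" "bij_betw b {..<n} V" by (auto simp: B_def P_def)
    let ?f = "fromB p"
    have ex: "\<exists>!j. j < n \<and> x \<in> b j" if "x \<in> A" for x
    proof -
      have "x \<in> \<Union>V" using V(1) that by (simp add: partition_on_def)
      then obtain v where v: "v \<in> V" "x \<in> v" by auto
      obtain j where j: "j < n" "b j = v" using b v by (auto simp: bij_betw_def)
      show ?thesis
      proof (rule ex1I[of _ j])
        fix i assume i: "i < n \<and> x \<in> b i"
        then have "b i \<in> V" using b by (auto simp: bij_betw_def)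
        then have "b i = b j" using i j v V unfolding partition_on_def disjoint_def by blast
        then show "i = j" using i j b by (auto simp: bij_betw_def inj_on_def)
      qed (use j v in auto)
    qed
    have fA: "?f x < n \<and> x \<in> b (?f x)" if "x \<in> A" for x
      using theI'[OF ex[OF that]] that by (simp add: fromB_def p)
    have fib: "fib ?f j = b j" if "j < n" for j
    proof -
      have "b j \<in> V" using b that by (auto simp: bij_betw_def)
      then have bA: "b j \<subseteq> A" using V by (auto simp: partition_on_def)
      show ?thesis
      proof (intro equalityI subsetI)
        fix x assume "x \<in> fib ?f j"
        then show "x \<in> b j" using fA[of x] by (auto simp: fib_def)
      next
        fix x assume x: "x \<in> b j"
        then have "x \<in> A" using bA by auto
        then show "x \<in> fib ?f j" using ex[of x] fA[of x] x that by (auto simp: fib_def)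
      qed
    qed
    have "?f ` A = {..<n}"
    proof (intro equalityI subsetI)
      fix j assume "j \<in> ?f ` A"
      then show "j \<in> {..<n}" using fA by auto
    next
      fix j assume "j \<in> {..<n}"
      then have "b j \<in> V" "j < n" using b by (auto simp: bij_betw_def)
      then have "b j \<noteq> {}" using V by (auto simp: partition_on_def)
      then show "j \<in> ?f ` A" using fib[OF \<open>j < n\<close>] by (auto simp: fib_def)
    qed
    then show "?f \<in> F" by (auto simp: p F_def PiE_def fromB_def)
    have "fib ?f ` {..<n} = V" using fib b by (auto simp: bij_betw_def)
    moreover have "(\<lambda>j\<in>{..<n}. fib ?f j) = b"
      using fib b by (auto simp: extensional_def fun_eq_iff)
    ultimately show "toB ?f = p" unfolding toB_def p by simp
  qed
  also have "\<dots> = (\<Sum>V\<in>P. \<Sum>b\<in>{b \<in> extensional {..<n}. bij_betw b {..<n} V}. \<Prod>j<n. w (b j))"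
    unfolding B_def using finP finb by (subst sum.Sigma) auto
  also have "\<dots> = (\<Sum>V\<in>P. fact n * (\<Prod>v\<in>V. w v))"
  proof (rule sum.cong[OF refl])
    fix V assume V: "V \<in> P"
    have "(\<Sum>b\<in>{b \<in> extensional {..<n}. bij_betw b {..<n} V}. \<Prod>j<n. w (b j)) =
          (\<Sum>b\<in>{b \<in> extensional {..<n}. bij_betw b {..<n} V}. \<Prod>v\<in>V. w v)"
      by (rule sum.cong[OF refl]) (auto intro: prod.reindex_bij_betw)
    also have "\<dots> = fact n * (\<Prod>v\<in>V. w v)"
      using card_bij_extensional[of "{..<n}" V] V finV[OF V] by (simp add: P_def)
    finally show "(\<Sum>b\<in>{b \<in> extensional {..<n}. bij_betw b {..<n} V}. \<Prod>j<n. w (b j)) =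
        fact n * (\<Prod>v\<in>V. w v)" .
  qed
  finally show ?thesis by (simp add: P_def F_def sum_distrib_left)
qed

definition pairings :: "'a set \<Rightarrow> 'a set set set"
  where "pairings A = {E. partition_on A E \<and> (\<forall>e\<in>E. card e = 2)}"

lemma pairings_empty_if_odd:
  assumes "finite A" "odd (card A)" shows "pairings A = {}"
proof (rule ccontr)
  assume "pairings A \<noteq> {}"
  then obtain E where E: "partition_on A E" "\<forall>e\<in>E. card e = 2" by (auto simp: pairings_def)
  have "card A = (\<Sum>e\<in>E. card e)"
    using E by (intro product_partition) (auto intro: card_ge_0_finite)
  then show False using E assms by simp
qed

text \<open>With the \<open>m\<close> pairs numbered, this counts functions all of whose fibers have
  size two, a multinomial coefficient; forgetting the numbers divides by \<open>fact m\<close>. The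
  weight \<open>w\<close> is the indicator of size two, so the weighted sum over partitions becomes
  the number of pairings.\<close>

lemma card_pairings:
  assumes "finite A" "card A = 2 * m"
  shows "real (card (pairings A)) = fact (2 * m) / (2 ^ m * fact m)"
proof -
  define w :: "'a set \<Rightarrow> real" where "w = (\<lambda>v. if card v = 2 then 1 else 0)"
  define PV where "PV = {V. partition_on A V \<and> card V = m}"
  have finPV: "finite PV" unfolding PV_def
    by (rule finite_subset[OF _ finitely_many_partition_on[OF assms(1)]]) auto
  have "(\<Prod>v\<in>V. w v) = (if V \<in> pairings A then 1 else 0)" if "V \<in> PV" for V
  proof -
    have "finite V" using that finite_elements[OF assms(1)] by (auto simp: PV_def)
    then show ?thesis using that
      by (auto simp: w_def pairings_def PV_def)
  qed
  then have "(\<Sum>V\<in>PV. \<Prod>v\<in>V. w v) = (\<Sum>V\<in>PV. if V \<in> pairings A then 1 else 0)"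
    by (intro sum.cong) auto
  also have "\<dots> = real (card (PV \<inter> pairings A))"
    using finPV by (simp add: sum.If_cases)
  also have "PV \<inter> pairings A = pairings A"
  proof -
    have "card E = m" if E: "E \<in> pairings A" for E
    proof -
      have "card A = (\<Sum>e\<in>E. card e)"
        using E by (intro product_partition) (auto intro: card_ge_0_finite simp: pairings_def)
      then show ?thesis using E assms by (simp add: pairings_def)
    qed
    then show ?thesis by (auto simp: PV_def pairings_def)
  qed
  finally have 1: "(\<Sum>V\<in>PV. \<Prod>v\<in>V. w v) = real (card (pairings A))" .
  let ?F = "{f. f \<in> A \<rightarrow>\<^sub>E {..<m} \<and> f ` A = {..<m}}"
  let ?G = "{f \<in> A \<rightarrow>\<^sub>E {..<m}. \<forall>j<m. card {x \<in> A. f x = j} = 2}"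
  have finF: "finite ?F" by (rule finite_subset[OF _ finite_PiE[of A "\<lambda>_. {..<m}"]]) (use assms in auto)
  have "(\<Sum>f\<in>?F. \<Prod>j<m. w {x \<in> A. f x = j}) = (\<Sum>f\<in>?F. if f \<in> ?G then 1 else 0)"
    by (intro sum.cong refl) (auto simp: w_def prod_zero_iff)
  also have "\<dots> = real (card (?F \<inter> ?G))"
    using finF by (subst sum.If_cases) (auto intro!: arg_cong[where f = card])
  also have "?F \<inter> ?G = ?G"
  proof -
    have "f ` A = {..<m}" if "f \<in> ?G" for f
    proof (intro equalityI subsetI)
      fix j assume "j \<in> {..<m}"
      then have "card {x \<in> A. f x = j} = 2" using that by auto
      then have "{x \<in> A. f x = j} \<noteq> {}" by (metis card.empty zero_neq_numeral)
      then show "j \<in> f ` A" by auto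
    qed (use that in auto)
    then show ?thesis by auto
  qed
  finally have 2: "(\<Sum>f\<in>?F. \<Prod>j<m. w {x \<in> A. f x = j}) = real (card ?G)" .
  have "card ?G * 2 ^ m = fact (2 * m)"
    using card_funcs_fibers[of A "\<lambda>_. 2" m] assms by (simp add: numeral_2_eq_2)
  then have "real (card ?G * 2 ^ m) = real (fact (2 * m))" by simp
  then have "real (card ?G) * 2 ^ m = fact (2 * m)"
    unfolding of_nat_mult of_nat_power of_nat_fact of_nat_numeral .
  moreover have "real (card ?G) = fact m * real (card (pairings A))"
    using sum_partitions_eq_sum_surjections[OF assms(1), of m w] 1 2 by (simp add: PV_def)
  ultimately have "real (card (pairings A)) * (2 ^ m * fact m) = fact (2 * m)"
    by (simp add: mult_ac)
  then show ?thesis by (simp add: eq_divide_eq)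
qed

section \<open>From isomorphism classes to labeled graphs\<close>

definition vmap :: "('c \<Rightarrow> 'h \<Rightarrow> 'g) \<Rightarrow> ('c \<Rightarrow> 'h set) \<Rightarrow> 'h set \<Rightarrow> 'g set"
  where "vmap \<phi> H v = (\<Union>i. \<phi> i ` (v \<inter> H i))"

definition label_bijs :: "('c \<Rightarrow> 'h set) \<Rightarrow> ('c \<Rightarrow> 'g set) \<Rightarrow> ('c \<Rightarrow> 'h \<Rightarrow> 'g) set"
  where "label_bijs H H' = {\<phi>. \<forall>i. \<phi> i \<in> extensional (H i) \<and> bij_betw (\<phi> i) (H i) (H' i)}"

definition comp_labels :: "('c \<Rightarrow> 'h set) \<Rightarrow> ('c \<Rightarrow> 'g \<Rightarrow> 'k) \<Rightarrow> ('c \<Rightarrow> 'h \<Rightarrow> 'g) \<Rightarrow> 'c \<Rightarrow> 'h \<Rightarrow> 'k"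
  where "comp_labels H \<psi> \<phi> i = compose (H i) (\<psi> i) (\<phi> i)"

definition inv_labels :: "('c \<Rightarrow> 'h set) \<Rightarrow> ('c \<Rightarrow> 'g set) \<Rightarrow> ('c \<Rightarrow> 'h \<Rightarrow> 'g) \<Rightarrow> 'c \<Rightarrow> 'g \<Rightarrow> 'h"
  where "inv_labels H H' \<phi> i = (\<lambda>x\<in>H' i. inv_into (H i) (\<phi> i) x)"

lemma isos_iff:
  "\<phi> \<in> isos \<Gamma> \<Gamma>' \<longleftrightarrow> \<phi> \<in> label_bijs (halves \<Gamma>) (halves \<Gamma>') \<and>
     vmap \<phi> (halves \<Gamma>) ` verts \<Gamma> = verts \<Gamma>' \<and> (\<forall>i. (`) (\<phi> i) ` edges \<Gamma> i = edges \<Gamma>' i)"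
  unfolding isos_def label_bijs_def vmap_def by auto

lemma label_bijs_bij: "\<phi> \<in> label_bijs H H' \<Longrightarrow> bij_betw (\<phi> i) (H i) (H' i)"
  and label_bijs_ext: "\<phi> \<in> label_bijs H H' \<Longrightarrow> \<phi> i \<in> extensional (H i)"
  and label_bijs_image: "\<phi> \<in> label_bijs H H' \<Longrightarrow> \<phi> i ` H i = H' i"
  and label_bijs_inj: "\<phi> \<in> label_bijs H H' \<Longrightarrow> inj_on (\<phi> i) (H i)"
  and label_bijs_in: "\<phi> \<in> label_bijs H H' \<Longrightarrow> x \<in> H i \<Longrightarrow> \<phi> i x \<in> H' i"
  by (auto simp: label_bijs_def bij_betw_def)

lemma comp_labels_in: "\<phi> \<in> label_bijs H H' \<Longrightarrow> \<psi> \<in> label_bijs H' H'' \<Longrightarrow>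
    comp_labels H \<psi> \<phi> \<in> label_bijs H H''"
  unfolding label_bijs_def comp_labels_def by (auto intro: bij_betw_compose)

lemma inv_labels_in:
  assumes "\<phi> \<in> label_bijs H H'" shows "inv_labels H H' \<phi> \<in> label_bijs H' H"
proof -
  have "bij_betw (inv_labels H H' \<phi> i) (H' i) (H i)" for i
    using bij_betw_inv_into[OF label_bijs_bij[OF assms, of i]]
    by (subst bij_betw_cong[of _ _ "inv_into (H i) (\<phi> i)"]) (auto simp: inv_labels_def)
  then show ?thesis by (auto simp: label_bijs_def inv_labels_def)
qed

lemma inv_labels_left: "\<phi> \<in> label_bijs H H' \<Longrightarrow> x \<in> H i \<Longrightarrow> inv_labels H H' \<phi> i (\<phi> i x) = x"
  using label_bijs_in[of \<phi> H H' x i] label_bijs_inj[of \<phi> H H' i] by (simp add: inv_labels_def)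

lemma inv_labels_right: "\<phi> \<in> label_bijs H H' \<Longrightarrow> x \<in> H' i \<Longrightarrow> \<phi> i (inv_labels H H' \<phi> i x) = x"
  using label_bijs_image[of \<phi> H H' i] by (simp add: inv_labels_def f_inv_into_f)

lemma card_label_bijs:
  fixes H :: "'c::finite \<Rightarrow> 'h set" and H' :: "'c \<Rightarrow> 'g set"
  assumes "\<And>i. finite (H i)" "\<And>i. finite (H' i)" "\<And>i. card (H i) = card (H' i)"
  shows "finite (label_bijs H H')" "card (label_bijs H H') = (\<Prod>i\<in>UNIV. fact (card (H i)))"
proof -
  have eq: "label_bijs H H' = Pi\<^sub>E UNIV (\<lambda>i. {f \<in> extensional (H i). bij_betw f (H i) (H' i)})"
    by (auto simp: label_bijs_def PiE_UNIV_domain)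
  have "finite {f \<in> extensional (H i). bij_betw f (H i) (H' i)}" for i
    by (rule finite_subset[OF _ finite_PiE[of "H i" "\<lambda>_. H' i"]])
       (use assms in \<open>auto simp: bij_betw_def PiE_def\<close>)
  then show "finite (label_bijs H H')" unfolding eq by (intro finite_PiE) auto
  show "card (label_bijs H H') = (\<Prod>i\<in>UNIV. fact (card (H i)))"
    unfolding eq using assms by (subst card_PiE) (auto simp: card_bij_extensional)
qed

definition disjoint_labels :: "('c \<Rightarrow> 'h set) \<Rightarrow> bool"
  where "disjoint_labels H \<longleftrightarrow> (\<forall>i j. i \<noteq> j \<longrightarrow> H i \<inter> H j = {})"

text \<open>Since the target labels are disjoint, the color of an image determines the component
  that produced it. This makes the map on vertices compatible with composition and with
  multidegrees.\<close>

lemma vmap_Int: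
  assumes "\<phi> \<in> label_bijs H H'" "disjoint_labels H'"
  shows "vmap \<phi> H v \<inter> H' i = \<phi> i ` (v \<inter> H i)"
proof (intro equalityI subsetI)
  fix y assume y: "y \<in> vmap \<phi> H v \<inter> H' i"
  then obtain j x where x: "x \<in> v" "x \<in> H j" "y = \<phi> j x" by (auto simp: vmap_def)
  then have "y \<in> H' j" using label_bijs_in[OF assms(1)] by auto
  then have "j = i" using y assms(2) by (auto simp: disjoint_labels_def)
  then show "y \<in> \<phi> i ` (v \<inter> H i)" using x by auto
qed (use label_bijs_in[OF assms(1)] in \<open>auto simp: vmap_def\<close>)

lemma vmap_comp:
  assumes "\<phi> \<in> label_bijs H H'" "disjoint_labels H'"
  shows "vmap \<psi> H' (vmap \<phi> H v) = vmap (comp_labels H \<psi> \<phi>) H v"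
proof -
  have "\<psi> i ` \<phi> i ` (v \<inter> H i) = comp_labels H \<psi> \<phi> i ` (v \<inter> H i)" for i
    unfolding image_image by (rule image_cong) (auto simp: comp_labels_def compose_def)
  then show ?thesis
    unfolding vmap_def[of \<psi>] vmap_Int[OF assms] by (simp add: vmap_def)
qed

lemma vmap_id:
  assumes "v \<subseteq> (\<Union>i. H i)" "\<And>i x. x \<in> H i \<Longrightarrow> \<phi> i x = x"
  shows "vmap \<phi> H v = v"
proof -
  have "\<phi> i ` (v \<inter> H i) = v \<inter> H i" for i using assms(2) by force
  then show ?thesis using assms(1) by (auto simp: vmap_def)
qed

lemma vmap_inv:
  assumes "\<phi> \<in> label_bijs H H'" "disjoint_labels H'" "v \<subseteq> (\<Union>i. H i)"
  shows "vmap (inv_labels H H' \<phi>) H' (vmap \<phi> H v) = v"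
  unfolding vmap_comp[OF assms(1,2)]
  by (rule vmap_id[OF assms(3)]) (auto simp: comp_labels_def compose_def inv_labels_left[OF assms(1)])

lemma is_hgraphD:
  assumes "is_hgraph \<Gamma>"
  shows "finite (halves \<Gamma> i)" "disjoint_labels (halves \<Gamma>)" "partition_on (\<Union>i. halves \<Gamma> i) (verts \<Gamma>)"
    "edges \<Gamma> i \<in> pairings (halves \<Gamma> i)" "v \<in> verts \<Gamma> \<Longrightarrow> v \<subseteq> (\<Union>i. halves \<Gamma> i)"
    "e \<in> edges \<Gamma> i \<Longrightarrow> e \<subseteq> halves \<Gamma> i"
proof -
  show "e \<in> edges \<Gamma> i \<Longrightarrow> e \<subseteq> halves \<Gamma> i"
    using assms unfolding is_hgraph_def partition_on_def by blast
qed (use assms in \<open>auto simp: is_hgraph_def disjoint_labels_def pairings_def partition_on_def\<close>)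

lemma comp_isos:
  assumes "is_hgraph \<Gamma>" "is_hgraph \<Gamma>'" "\<phi> \<in> isos \<Gamma> \<Gamma>'" "\<psi> \<in> isos \<Gamma>' \<Gamma>''"
  shows "comp_labels (halves \<Gamma>) \<psi> \<phi> \<in> isos \<Gamma> \<Gamma>''"
proof -
  let ?c = "comp_labels (halves \<Gamma>) \<psi> \<phi>"
  have \<phi>: "\<phi> \<in> label_bijs (halves \<Gamma>) (halves \<Gamma>')" "vmap \<phi> (halves \<Gamma>) ` verts \<Gamma> = verts \<Gamma>'"
    "\<And>i. (`) (\<phi> i) ` edges \<Gamma> i = edges \<Gamma>' i"
    and \<psi>: "\<psi> \<in> label_bijs (halves \<Gamma>') (halves \<Gamma>'')" "vmap \<psi> (halves \<Gamma>') ` verts \<Gamma>' = verts \<Gamma>''"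
    "\<And>i. (`) (\<psi> i) ` edges \<Gamma>' i = edges \<Gamma>'' i"
    using assms(3,4) by (auto simp: isos_iff)
  have "vmap ?c (halves \<Gamma>) ` verts \<Gamma> = verts \<Gamma>''"
    unfolding \<psi>(2)[symmetric] \<phi>(2)[symmetric] image_image vmap_comp[OF \<phi>(1) is_hgraphD(2)[OF assms(2)]]
        ..
  moreover have "(`) (?c i) ` edges \<Gamma> i = edges \<Gamma>'' i" for i
    unfolding \<psi>(3)[symmetric] \<phi>(3)[symmetric] image_image
  proof (rule image_cong[OF refl])
    fix e assume "e \<in> edges \<Gamma> i"
    then have "e \<subseteq> halves \<Gamma> i" using is_hgraphD(6)[OF assms(1)] by auto
    then show "?c i ` e = (\<lambda>x. \<psi> i (\<phi> i x)) ` e"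
      by (intro image_cong) (auto simp: comp_labels_def compose_def)
  qed
  ultimately show ?thesis using comp_labels_in[OF \<phi>(1) \<psi>(1)] by (simp add: isos_iff)
qed

lemma inv_isos:
  assumes "is_hgraph \<Gamma>" "is_hgraph \<Gamma>'" "\<phi> \<in> isos \<Gamma> \<Gamma>'"
  shows "inv_labels (halves \<Gamma>) (halves \<Gamma>') \<phi> \<in> isos \<Gamma>' \<Gamma>"
proof -
  let ?c = "inv_labels (halves \<Gamma>) (halves \<Gamma>') \<phi>"
  have \<phi>: "\<phi> \<in> label_bijs (halves \<Gamma>) (halves \<Gamma>')" "vmap \<phi> (halves \<Gamma>) ` verts \<Gamma> = verts \<Gamma>'"
    "\<And>i. (`) (\<phi> i) ` edges \<Gamma> i = edges \<Gamma>' i"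
    using assms(3) by (auto simp: isos_iff)
  have "vmap ?c (halves \<Gamma>') (vmap \<phi> (halves \<Gamma>) v) = v" if "v \<in> verts \<Gamma>" for v
    using vmap_inv[OF \<phi>(1) is_hgraphD(2)[OF assms(2)] is_hgraphD(5)[OF assms(1) that]] .
  then have "vmap ?c (halves \<Gamma>') ` verts \<Gamma>' = verts \<Gamma>"
    unfolding \<phi>(2)[symmetric] image_image by simp
  moreover have "(`) (?c i) ` edges \<Gamma>' i = edges \<Gamma> i" for i
  proof -
    have "(\<lambda>x. ?c i (\<phi> i x)) ` e = e" if "e \<in> edges \<Gamma> i" for e
      using is_hgraphD(6)[OF assms(1) that] inv_labels_left[OF \<phi>(1), of _ i] by force
    then show ?thesis unfolding \<phi>(3)[symmetric] image_image by simp
  qed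
  ultimately show ?thesis using inv_labels_in[OF \<phi>(1)] by (simp add: isos_iff)
qed

lemma id_isos:
  assumes "is_hgraph \<Gamma>"
  shows "(\<lambda>i. \<lambda>x\<in>halves \<Gamma> i. x) \<in> isos \<Gamma> \<Gamma>"
proof -
  have "vmap (\<lambda>i. \<lambda>x\<in>halves \<Gamma> i. x) (halves \<Gamma>) v = v" if "v \<in> verts \<Gamma>" for v
    by (rule vmap_id[OF is_hgraphD(5)[OF assms that]]) simp
  moreover have "(\<lambda>x\<in>halves \<Gamma> i. x) ` e = e" if "e \<in> edges \<Gamma> i" for e i
    using is_hgraphD(6)[OF assms that] by (auto simp: restrict_def)
  ultimately show ?thesis
    by (auto simp: isos_iff label_bijs_def bij_betw_def inj_on_def)
qed

text \<open>Composition with the fixed isomorphism \<open>\<phi>\<close> carries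
  \<open>Aut \<Gamma>\<close> to \<open>isos \<Gamma> \<Gamma>'\<close>, and composition with its
  inverse goes back.\<close>

lemma card_isos:
  assumes "is_hgraph \<Gamma>" "is_hgraph \<Gamma>'" "\<phi> \<in> isos \<Gamma> \<Gamma>'"
  shows "card (isos \<Gamma> \<Gamma>') = card (Aut \<Gamma>)"
proof -
  let ?c = "comp_labels (halves \<Gamma>)"
  let ?i = "inv_labels (halves \<Gamma>) (halves \<Gamma>') \<phi>"
  have \<phi>: "\<phi> \<in> label_bijs (halves \<Gamma>) (halves \<Gamma>')" using assms by (simp add: isos_iff)
  have "bij_betw (?c \<phi>) (Aut \<Gamma>) (isos \<Gamma> \<Gamma>')"
  proof (rule bij_betw_byWitness[where f' = "?c ?i"])
    show "\<forall>\<alpha>\<in>Aut \<Gamma>. ?c ?i (?c \<phi> \<alpha>) = \<alpha>"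
    proof (intro ballI ext)
      fix \<alpha> i x assume "\<alpha> \<in> Aut \<Gamma>"
      then have "\<alpha> \<in> label_bijs (halves \<Gamma>) (halves \<Gamma>)" by (simp add: Aut_def isos_iff)
      then show "?c ?i (?c \<phi> \<alpha>) i x = \<alpha> i x"
        using label_bijs_in[of \<alpha> _ _ x i] label_bijs_ext[of \<alpha> _ _ i] inv_labels_left[OF \<phi>]
        by (cases "x \<in> halves \<Gamma> i") (auto simp: comp_labels_def compose_def extensional_def)
    qed
    show "\<forall>\<psi>\<in>isos \<Gamma> \<Gamma>'. ?c \<phi> (?c ?i \<psi>) = \<psi>"
    proof (intro ballI ext)
      fix \<psi> i x assume "\<psi> \<in> isos \<Gamma> \<Gamma>'"
      then have "\<psi> \<in> label_bijs (halves \<Gamma>) (halves \<Gamma>')" by (simp add: isos_iff)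
      then show "?c \<phi> (?c ?i \<psi>) i x = \<psi> i x"
        using label_bijs_in[of \<psi> _ _ x i] label_bijs_ext[of \<psi> _ _ i] inv_labels_right[OF \<phi>]
        by (cases "x \<in> halves \<Gamma> i") (auto simp: comp_labels_def compose_def extensional_def)
    qed
    show "?c \<phi> ` Aut \<Gamma> \<subseteq> isos \<Gamma> \<Gamma>'"
      using comp_isos[OF assms(1) assms(1) _ assms(3)] by (auto simp: Aut_def)
    show "?c ?i ` isos \<Gamma> \<Gamma>' \<subseteq> Aut \<Gamma>"
      using comp_isos[OF assms(1) assms(2) _ inv_isos[OF assms]] by (auto simp: Aut_def)
  qed
  then show ?thesis by (rule bij_betw_same_card[symmetric])
qed

lemma bij_betw_verts:
  assumes "is_hgraph \<Gamma>" "is_hgraph \<Gamma>'" "\<phi> \<in> isos \<Gamma> \<Gamma>'"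
  shows "bij_betw (vmap \<phi> (halves \<Gamma>)) (verts \<Gamma>) (verts \<Gamma>')"
proof -
  have \<phi>: "\<phi> \<in> label_bijs (halves \<Gamma>) (halves \<Gamma>')" using assms by (simp add: isos_iff)
  have "inj_on (vmap \<phi> (halves \<Gamma>)) (verts \<Gamma>)"
    by (rule inj_on_inverseI) (rule vmap_inv[OF \<phi> is_hgraphD(2)[OF assms(2)] is_hgraphD(5)[OF assms(1)]])
  then show ?thesis using assms by (simp add: bij_betw_def isos_iff)
qed

lemma multideg_vmap:
  assumes "is_hgraph \<Gamma>" "is_hgraph \<Gamma>'" "\<phi> \<in> isos \<Gamma> \<Gamma>'"
  shows "multideg \<Gamma>' (vmap \<phi> (halves \<Gamma>) v) = multideg \<Gamma> v"
proof
  fix i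
  have \<phi>: "\<phi> \<in> label_bijs (halves \<Gamma>) (halves \<Gamma>')" using assms by (simp add: isos_iff)
  have "inj_on (\<phi> i) (v \<inter> halves \<Gamma> i)" using label_bijs_inj[OF \<phi>] by (rule inj_on_subset) auto
  then show "multideg \<Gamma>' (vmap \<phi> (halves \<Gamma>) v) i = multideg \<Gamma> v i"
    unfolding multideg_def vmap_Int[OF \<phi> is_hgraphD(2)[OF assms(2)]] by (rule card_image)
qed

text \<open>Counts and vertex weights are transported by the bijections of labels and vertices, so
  they may be evaluated on any member of an isomorphism class.\<close>

lemma isos_invariants:
  assumes "is_hgraph \<Gamma>" "is_hgraph \<Gamma>'" "isos \<Gamma> \<Gamma>' \<noteq> {}"
  shows "card (verts \<Gamma>') = card (verts \<Gamma>)" "regular k \<Gamma>' = regular k \<Gamma>"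
    "(\<Prod>v\<in>verts \<Gamma>'. \<Lambda> (multideg \<Gamma>' v)) = (\<Prod>v\<in>verts \<Gamma>. \<Lambda> (multideg \<Gamma> v))"
    "card (halves \<Gamma>' i) = card (halves \<Gamma> i)"
proof -
  obtain \<phi> where \<phi>: "\<phi> \<in> isos \<Gamma> \<Gamma>'" using assms by auto
  note b = bij_betw_verts[OF assms(1,2) \<phi>] and d = multideg_vmap[OF assms(1,2) \<phi>]
  show "card (verts \<Gamma>') = card (verts \<Gamma>)" using bij_betw_same_card[OF b] ..
  have "verts \<Gamma>' = vmap \<phi> (halves \<Gamma>) ` verts \<Gamma>" using \<phi> by (simp add: isos_iff)
  then show "regular k \<Gamma>' = regular k \<Gamma>" by (simp add: regular_def d)
  show "(\<Prod>v\<in>verts \<Gamma>'. \<Lambda> (multideg \<Gamma>' v)) = (\<Prod>v\<in>verts \<Gamma>. \<Lambda> (multideg \<Gamma> v))"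
    by (subst prod.reindex_bij_betw[OF b, symmetric]) (simp add: d)
  show "card (halves \<Gamma>' i) = card (halves \<Gamma> i)"
    using \<phi> label_bijs_bij[of \<phi> "halves \<Gamma>" "halves \<Gamma>'" i] bij_betw_same_card
        by (fastforce simp: isos_iff)
qed

section \<open>Transport of structure and standard label sets\<close>

definition push :: "('c::finite \<Rightarrow> 'h \<Rightarrow> 'g) \<Rightarrow> ('c \<Rightarrow> 'g set) \<Rightarrow> ('c, 'h) hgraph \<Rightarrow> ('c, 'g) hgraph"
  where "push \<phi> H' \<Gamma> = \<lparr>halves = H', verts = vmap \<phi> (halves \<Gamma>) ` verts \<Gamma>, edges =
      (\<lambda>i. (`) (\<phi> i) ` edges \<Gamma> i)\<rparr>"

lemma partition_on_bij_image:
  assumes "partition_on A P" "bij_betw f A B"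
  shows "partition_on B ((`) f ` P)"
proof -
  have "(`) f ` P - {{}} = (`) f ` P" using assms(1) by (auto simp: partition_on_def)
  then show ?thesis
    using partition_on_inj_image[OF assms(1), of f] assms(2) by (auto simp: bij_betw_def)
qed

lemma push_is_hgraph:
  fixes \<Gamma> :: "('c::finite, 'h) hgraph" and H' :: "'c \<Rightarrow> 'g set"
  assumes "is_hgraph \<Gamma>" "\<phi> \<in> label_bijs (halves \<Gamma>) H'" "disjoint_labels H'"
  shows "is_hgraph (push \<phi> H' \<Gamma>)" "\<phi> \<in> isos \<Gamma> (push \<phi> H' \<Gamma>)"
proof -
  let ?H = "halves \<Gamma>"
  \<comment> \<open>The label sets are disjoint, so the components of \<open>\<phi>\<close> glue to
    a single bijection; partitions are then carried along by plain images.\<close>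
  define g where "g x = \<phi> (THE i. x \<in> ?H i) x" for x
  have g: "g x = \<phi> i x" if "x \<in> ?H i" for x i
  proof -
    have "(THE i. x \<in> ?H i) = i"
      using is_hgraphD(2)[OF assms(1)] that by (intro the_equality) (auto simp: disjoint_labels_def)
    then show ?thesis by (simp add: g_def)
  qed
  have vg: "vmap \<phi> ?H v = g ` v" if "v \<in> verts \<Gamma>" for v
  proof -
    have "\<phi> i ` (v \<inter> ?H i) = g ` (v \<inter> ?H i)" for i using g by (intro image_cong) auto
    then have "vmap \<phi> ?H v = g ` (\<Union>i. v \<inter> ?H i)" by (simp only: vmap_def image_UN)
    also have "(\<Union>i. v \<inter> ?H i) = v" using is_hgraphD(5)[OF assms(1) that] by auto
    finally show ?thesis .
  qed
  have bij: "bij_betw g (\<Union>i. ?H i) (\<Union>i. H' i)"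
  proof (rule bij_betw_imageI)
    show "inj_on g (\<Union>i. ?H i)"
    proof (rule inj_onI)
      fix x y assume "x \<in> (\<Union>i. ?H i)" "y \<in> (\<Union>i. ?H i)" and eq: "g x = g y"
      then obtain i j where ij: "x \<in> ?H i" "y \<in> ?H j" by auto
      then have "g x \<in> H' i" "g y \<in> H' j" using g label_bijs_in[OF assms(2)] by auto
      then have "i = j" using eq assms(3) by (auto simp: disjoint_labels_def)
      then show "x = y" using ij eq g label_bijs_inj[OF assms(2), of i] by (auto simp: inj_on_def)
    qed
    have "g ` ?H i = H' i" for i
      using g label_bijs_image[OF assms(2), of i] by (auto simp: image_def)
    then show "g ` (\<Union>i. ?H i) = (\<Union>i. H' i)" by (simp add: image_UN)
  qed
  have "finite (H' i)" for i
    using label_bijs_image[OF assms(2), of i] is_hgraphD(1)[OF assms(1), of i] by (metis finite_imageI)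
  moreover have "partition_on (\<Union>i. H' i) (vmap \<phi> ?H ` verts \<Gamma>)"
    using partition_on_bij_image[OF is_hgraphD(3)[OF assms(1)] bij] vg by (simp cong: image_cong)
  moreover have "partition_on (H' i) ((`) (\<phi> i) ` edges \<Gamma> i)" for i
    using partition_on_bij_image[OF _ label_bijs_bij[OF assms(2), of i]] is_hgraphD(4)[OF assms(1), of i]
    by (simp add: pairings_def)
  moreover have "card (\<phi> i ` e) = 2" if "e \<in> edges \<Gamma> i" for e i
    using is_hgraphD(4)[OF assms(1), of i] is_hgraphD(6)[OF assms(1) that] that
      inj_on_subset[OF label_bijs_inj[OF assms(2), of i]] by (subst card_image) (auto simp: pairings_def)
  ultimately show "is_hgraph (push \<phi> H' \<Gamma>)"
    using assms(3) by (auto simp: is_hgraph_def push_def disjoint_labels_def)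
  show "\<phi> \<in> isos \<Gamma> (push \<phi> H' \<Gamma>)" using assms(2) by (simp add: isos_iff push_def)
qed

text \<open>The definition of an isomorphism leaves no freedom: the map and the target labels
  determine the target graph. Hence the isomorphisms from one graph to different graphs on the same
  labels are disjoint sets.\<close>

lemma push_unique:
  assumes "\<phi> \<in> isos \<Gamma> \<Gamma>'" shows "\<Gamma>' = push \<phi> (halves \<Gamma>') \<Gamma>"
  using assms by (cases \<Gamma>') (auto simp: isos_iff push_def fun_eq_iff)

definition color_index :: "'c::finite \<Rightarrow> nat"
  where "color_index = (SOME f. inj f)"

text \<open>Pairing a position with the index of its color keeps the label sets of different colors
  disjoint although all of them are sets of naturals. Any graph can be transported to these
  labels.\<close>

definition std_labels :: "('c::finite \<Rightarrow> nat) \<Rightarrow> 'c \<Rightarrow> nat set"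
  where "std_labels h i = (\<lambda>m. prod_encode (color_index i, m)) ` {..<h i}"

lemma inj_color_index: "inj (color_index :: 'c::finite \<Rightarrow> nat)"
proof -
  have "\<exists>f :: 'c \<Rightarrow> nat. inj f" using finite_imp_inj_to_nat_seg[OF finite[of UNIV]] by metis
  then show ?thesis unfolding color_index_def by (rule someI_ex)
qed

lemma std_labels: "finite (std_labels h i)" "card (std_labels h i) =
    h i" "disjoint_labels (std_labels h)"
proof -
  show "finite (std_labels h i)" by (simp add: std_labels_def)
  show "card (std_labels h i) = h i"
    unfolding std_labels_def by (subst card_image) (auto simp: inj_on_def)
  have "i = j" if "x \<in> std_labels h i" "x \<in> std_labels h j" for i j x
    using that injD[OF inj_color_index, of i j] unfolding std_labels_def by auto
  then show "disjoint_labels (std_labels h)"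
    unfolding disjoint_labels_def by blast
qed

definition std_graphs :: "nat \<Rightarrow> nat \<Rightarrow> ('c::finite \<Rightarrow> nat) \<Rightarrow> ('c, nat) hgraph set"
  where "std_graphs k n h = {\<Gamma>. halves \<Gamma> = std_labels h \<and> is_hgraph \<Gamma> \<and> regular k \<Gamma> \<and> card (verts \<Gamma>) =
      n}"

lemma card_eq_sum_labels:
  fixes H :: "'c::finite \<Rightarrow> 'h set"
  assumes "disjoint_labels H" "finite v" "v \<subseteq> (\<Union>i. H i)"
  shows "card v = (\<Sum>i\<in>UNIV. card (v \<inter> H i))"
proof -
  have "card (\<Union>i\<in>UNIV. v \<inter> H i) = (\<Sum>i\<in>UNIV. card (v \<inter> H i))"
    by (rule card_UN_disjoint) (use assms in \<open>auto simp: disjoint_labels_def\<close>)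
  moreover have "(\<Union>i\<in>UNIV. v \<inter> H i) = v" using assms(3) by auto
  ultimately show ?thesis by simp
qed

text \<open>Half-edges are counted once by color and once by vertex. As a consequence only the
  finitely many label counts in \<open>multi_indices (k * n)\<close> occur.\<close>

lemma regular_msize:
  assumes "is_hgraph \<Gamma>" "regular k \<Gamma>"
  shows "msize (\<lambda>i. card (halves \<Gamma> i)) = k * card (verts \<Gamma>)"
proof -
  let ?U = "\<Union>i. halves \<Gamma> i"
  have fin: "finite ?U" using is_hgraphD(1)[OF assms(1)] by auto
  have "msize (\<lambda>i. card (halves \<Gamma> i)) = card ?U"
    using card_eq_sum_labels[OF is_hgraphD(2)[OF assms(1)] fin]
    by (simp add: msize_def Int_absorb2 Int_commute UN_upper inf.absorb2)
  also have "\<dots> = (\<Sum>v\<in>verts \<Gamma>. card v)"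
    using is_hgraphD(3)[OF assms(1)] finite_subset[OF is_hgraphD(5)[OF assms(1)] fin]
    by (rule product_partition)
  also have "\<dots> = (\<Sum>v\<in>verts \<Gamma>. k)"
  proof (rule sum.cong[OF refl])
    fix v assume v: "v \<in> verts \<Gamma>"
    have "card v = msize (multideg \<Gamma> v)"
      using card_eq_sum_labels[OF is_hgraphD(2)[OF assms(1)] finite_subset[OF is_hgraphD(5)[OF assms(1)
          v] fin] is_hgraphD(5)[OF assms(1) v]]
      by (simp add: msize_def multideg_def)
    then show "card v = k" using assms(2) v by (simp add: regular_def)
  qed
  finally show ?thesis by simp
qed

lemma finite_multi_indices: "finite (multi_indices k :: ('c::finite \<Rightarrow> nat) set)"
proof (rule finite_subset)
  show "multi_indices k \<subseteq> Pi\<^sub>E (UNIV :: 'c set) (\<lambda>_. {..k})"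
    by (auto simp: multi_indices_def msize_def PiE_UNIV_domain intro: member_le_sum)
  show "finite (Pi\<^sub>E (UNIV :: 'c set) (\<lambda>_. {..k}))" by (intro finite_PiE) auto
qed

section \<open>Graphs on the standard labels\<close>

definition vertex_partitions :: "nat \<Rightarrow> nat \<Rightarrow> ('c::finite \<Rightarrow> 'h set) \<Rightarrow> 'h set set set"
  where "vertex_partitions k n H = {V. partition_on (\<Union>i. H i) V \<and> card V = n \<and>
      (\<forall>v\<in>V. msize (\<lambda>i. card (v \<inter> H i)) = k)}"

text \<open>Once the labels are fixed, the vertex partition and the pairings of the colors are
  independent choices. This independence makes the weighted count a product of a number of matchings
  and a sum over vertex partitions.\<close>

lemma std_graphs_eq:
  "std_graphs k n h = (\<lambda>(V, E). \<lparr>halves = std_labels h, verts = V, edges = E\<rparr>) `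
     (vertex_partitions k n (std_labels h) \<times> Pi\<^sub>E UNIV (\<lambda>i. pairings (std_labels h i)))"
proof (intro equalityI subsetI)
  fix \<Gamma> assume \<Gamma>: "\<Gamma> \<in> std_graphs k n h"
  then have "\<Gamma> = (\<lambda>(V, E). \<lparr>halves = std_labels h, verts = V, edges = E\<rparr>) (verts \<Gamma>, edges \<Gamma>)"
    by (simp add: std_graphs_def)
  moreover have "(verts \<Gamma>, edges \<Gamma>) \<in> vertex_partitions k n (std_labels h) \<times> Pi\<^sub>E UNIV (\<lambda>i.
      pairings (std_labels h i))"
    using \<Gamma> by (auto simp: std_graphs_def vertex_partitions_def is_hgraph_def pairings_def
        PiE_UNIV_domain regular_def multideg_def)
  ultimately show "\<Gamma> \<in> (\<lambda>(V, E). \<lparr>halves = std_labels h, verts = V, edges = E\<rparr>) `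
     (vertex_partitions k n (std_labels h) \<times> Pi\<^sub>E UNIV (\<lambda>i. pairings (std_labels h i)))" by
         (rule image_eqI)
next
  fix \<Gamma> assume "\<Gamma> \<in> (\<lambda>(V, E). \<lparr>halves = std_labels h, verts = V, edges = E\<rparr>) `
     (vertex_partitions k n (std_labels h) \<times> Pi\<^sub>E UNIV (\<lambda>i. pairings (std_labels h i)))"
  then obtain V E where "\<Gamma> = \<lparr>halves = std_labels h, verts = V, edges = E\<rparr>"
    "V \<in> vertex_partitions k n (std_labels h)" "\<And>i. E i \<in> pairings (std_labels h i)" by auto
  moreover have "\<forall>i j. i \<noteq> j \<longrightarrow> std_labels h i \<inter> std_labels h j = {}"
    using std_labels(3)[of h] unfolding disjoint_labels_def .
  ultimately show "\<Gamma> \<in> std_graphs k n h"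
    using std_labels(1)[of h]
    by (simp add: std_graphs_def vertex_partitions_def is_hgraph_def pairings_def regular_def
        multideg_def)
qed

lemma finite_pairings: "finite A \<Longrightarrow> finite (pairings A)"
  by (rule finite_subset[OF _ finitely_many_partition_on]) (auto simp: pairings_def)

lemma finite_vertex_partitions: "(\<And>i. finite (H i)) \<Longrightarrow> finite (vertex_partitions k n H)"
  by (rule finite_subset[OF _ finitely_many_partition_on[of "\<Union>i. H i"]])
      (auto simp: vertex_partitions_def)

lemma finite_std_graphs: "finite (std_graphs k n h)"
  unfolding std_graphs_eq
  by (intro finite_imageI finite_cartesian_product finite_vertex_partitions finite_PiE finite_pairings)
      (auto simp: std_labels)

lemma sum_std_graphs:
  "(\<Sum>\<Gamma>\<in>std_graphs k n h. \<Prod>v\<in>verts \<Gamma>. \<Lambda> (multideg \<Gamma> v)) =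
   real (\<Prod>i\<in>UNIV. card (pairings (std_labels h i))) *
   (\<Sum>V\<in>vertex_partitions k n (std_labels h). \<Prod>v\<in>V. \<Lambda> (\<lambda>i. card (v \<inter> std_labels h i)))"
proof -
  let ?P = "Pi\<^sub>E UNIV (\<lambda>i. pairings (std_labels h i))"
  have "inj_on (\<lambda>(V, E). \<lparr>halves = std_labels h, verts = V, edges =
      E\<rparr>) (vertex_partitions k n (std_labels h) \<times> ?P)"
    by (auto simp: inj_on_def)
  then have "(\<Sum>\<Gamma>\<in>std_graphs k n h. \<Prod>v\<in>verts \<Gamma>. \<Lambda> (multideg \<Gamma> v)) =
    (\<Sum>(V, E)\<in>vertex_partitions k n (std_labels h) \<times> ?P. \<Prod>v\<in>V. \<Lambda> (\<lambda>i. card (v \<inter> std_labels h i)))"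
    unfolding std_graphs_eq by (subst sum.reindex) (auto simp: multideg_def intro!: sum.cong)
  also have "\<dots> = (\<Sum>V\<in>vertex_partitions k n (std_labels h). \<Sum>E\<in>?P. \<Prod>v\<in>V.
      \<Lambda> (\<lambda>i. card (v \<inter> std_labels h i)))"
    by (rule sum.cartesian_product[symmetric])
  also have "\<dots> = real (card ?P) *
      (\<Sum>V\<in>vertex_partitions k n (std_labels h). \<Prod>v\<in>V. \<Lambda> (\<lambda>i. card (v \<inter> std_labels h i)))"
    by (simp add: sum_distrib_left)
  also have "card ?P = (\<Prod>i\<in>UNIV. card (pairings (std_labels h i)))"
    by (subst card_PiE) auto
  finally show ?thesis .
qed

section \<open>Orbit counting in the isomorphism classes\<close>

lemma equiv_iso_rel: "equiv {\<Gamma> :: ('c::finite, nat) hgraph. is_hgraph \<Gamma>} iso_rel"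
proof (rule equivI)
  show "iso_rel \<subseteq> {\<Gamma> :: ('c, nat) hgraph. is_hgraph \<Gamma>} \<times> {\<Gamma>. is_hgraph \<Gamma>}" by (auto simp: iso_rel_def)
  show "refl_on {\<Gamma> :: ('c, nat) hgraph. is_hgraph \<Gamma>} iso_rel"
    using id_isos by (auto simp: iso_rel_def refl_on_def)
  show "sym (iso_rel :: (('c, nat) hgraph \<times> _) set)"
    unfolding sym_def iso_rel_def using inv_isos by blast
  show "trans (iso_rel :: (('c, nat) hgraph \<times> _) set)"
    unfolding trans_def iso_rel_def using comp_isos by blast
qed

definition iso_class :: "('c::finite, nat) hgraph \<Rightarrow> ('c, nat) hgraph set"
  where "iso_class \<Gamma> = iso_rel `` {\<Gamma>}"

text \<open>
  The tuples of bijections from the labels of \<open>\<Gamma>\<close> to the standard labels map onto the standard members of the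
  class of \<open>\<Gamma>\<close>; each fiber is a torsor under \<open>Aut \<Gamma>\<close>.
\<close>

lemma card_orbit:
  fixes \<Gamma> :: "('c::finite, nat) hgraph"
  assumes "is_hgraph \<Gamma>" "regular k \<Gamma>" "card (verts \<Gamma>) = n"
    and h: "h = (\<lambda>i. card (halves \<Gamma> i))"
  shows "card (std_graphs k n h \<inter> iso_class \<Gamma>) * card (Aut \<Gamma>) = (\<Prod>i\<in>UNIV. fact (h i))"
    "std_graphs k n h \<inter> iso_class \<Gamma> \<noteq> {}"
proof -
  let ?B = "label_bijs (halves \<Gamma>) (std_labels h)"
  let ?O = "std_graphs k n h \<inter> iso_class \<Gamma>"
  have ch: "card (halves \<Gamma> i) = h i" for i by (simp add: h)
  have B: "finite ?B" "card ?B = (\<Prod>i\<in>UNIV. fact (h i))"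
    using card_label_bijs[of "halves \<Gamma>" "std_labels h", OF is_hgraphD(1)[OF assms(1)] std_labels(1)]
    by (simp_all add: ch std_labels(2))
  have push: "push \<phi> (std_labels h) \<Gamma> \<in> ?O \<and> \<phi> \<in> isos \<Gamma> (push \<phi> (std_labels h) \<Gamma>)" if "\<phi> \<in> ?B" for \<phi>
  proof -
    note p = push_is_hgraph[OF assms(1) that std_labels(3)]
    then have "isos \<Gamma> (push \<phi> (std_labels h) \<Gamma>) \<noteq> {}" by auto
    note inv = isos_invariants[OF assms(1) p(1) this]
    show ?thesis
      using p inv assms by (auto simp: std_graphs_def iso_class_def iso_rel_def) (auto simp: push_def)
  qed
  have "?B = (\<Union>\<Gamma>'\<in>?O. isos \<Gamma> \<Gamma>')"
  proof (intro equalityI subsetI)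
    fix \<phi> assume "\<phi> \<in> ?B" then show "\<phi> \<in> (\<Union>\<Gamma>'\<in>?O. isos \<Gamma> \<Gamma>')" using push by blast
  next
    fix \<phi> assume "\<phi> \<in> (\<Union>\<Gamma>'\<in>?O. isos \<Gamma> \<Gamma>')"
    then obtain \<Gamma>' where "\<phi> \<in> isos \<Gamma> \<Gamma>'" "halves \<Gamma>' = std_labels h" by (auto simp: std_graphs_def)
    then show "\<phi> \<in> ?B" by (simp add: isos_iff)
  qed
  then have "(\<Prod>i\<in>UNIV. fact (h i)) = card (\<Union>\<Gamma>'\<in>?O. isos \<Gamma> \<Gamma>')" using B by simp
  also have "\<dots> = (\<Sum>\<Gamma>'\<in>?O. card (isos \<Gamma> \<Gamma>'))"
  proof (rule card_UN_disjoint)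
    show "finite ?O" using finite_std_graphs by auto
    show "\<forall>\<Gamma>'\<in>?O. finite (isos \<Gamma> \<Gamma>')"
    proof
      fix \<Gamma>' assume "\<Gamma>' \<in> ?O"
      then have "isos \<Gamma> \<Gamma>' \<subseteq> ?B" by (auto simp: isos_iff std_graphs_def)
      then show "finite (isos \<Gamma> \<Gamma>')" using B(1) by (rule finite_subset)
    qed
    \<comment> \<open>A common isomorphism would determine both targets by
      \<open>push_unique\<close>, as they have the same labels.\<close>
    show "\<forall>i\<in>?O. \<forall>j\<in>?O. i \<noteq> j \<longrightarrow> isos \<Gamma> i \<inter> isos \<Gamma> j = {}"
    proof (intro ballI impI, rule ccontr)
      fix i j assume ij: "i \<in> ?O" "j \<in> ?O" "i \<noteq> j" "isos \<Gamma> i \<inter> isos \<Gamma> j \<noteq> {}"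
      then obtain \<phi> where "\<phi> \<in> isos \<Gamma> i" "\<phi> \<in> isos \<Gamma> j" by auto
      moreover have "halves i = halves j" using ij by (auto simp: std_graphs_def)
      ultimately show False using ij(3) push_unique by metis
    qed
  qed
  also have "\<dots> = (\<Sum>\<Gamma>'\<in>?O. card (Aut \<Gamma>))"
  proof (rule sum.cong[OF refl])
    fix \<Gamma>' assume "\<Gamma>' \<in> ?O"
    then obtain \<phi> where "is_hgraph \<Gamma>'" "\<phi> \<in> isos \<Gamma> \<Gamma>'" by (auto simp: iso_class_def iso_rel_def)
    then show "card (isos \<Gamma> \<Gamma>') = card (Aut \<Gamma>)" using card_isos assms(1) by blast
  qed
  finally show eq: "card ?O * card (Aut \<Gamma>) = (\<Prod>i\<in>UNIV. fact (h i))" by simp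
  have "(\<Prod>i\<in>UNIV. fact (h i)) \<noteq> (0::nat)" by simp
  then show "?O \<noteq> {}" using eq by (metis card.empty mult_0)
qed

text \<open>By \<open>card_orbit\<close>, a class with \<open>h i\<close> labels of color
  \<open>i\<close> has (product of the \<open>fact (h i)\<close>) / |Aut| standard members, all of
  the same vertex weight. Dividing their total by the product of factorials leaves exactly the
  weight 1 / |Aut| of the class.\<close>

lemma graph_sum_eq_sum_std_graphs:
  fixes \<Lambda> :: "('c::finite \<Rightarrow> nat) \<Rightarrow> real"
  shows "graph_sum k \<Lambda> n = (\<Sum>h\<in>multi_indices (k * n).
    (\<Sum>\<Gamma>\<in>std_graphs k n h. \<Prod>v\<in>verts \<Gamma>. \<Lambda> (multideg \<Gamma> v)) / (\<Prod>i\<in>UNIV. fact (h i)))"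
proof -
  let ?w = "\<lambda>\<Gamma> :: ('c, nat) hgraph. \<Prod>v\<in>verts \<Gamma>. \<Lambda> (multideg \<Gamma> v)"
  let ?h = "\<lambda>(\<Gamma> :: ('c, nat) hgraph) i. card (halves \<Gamma> i)"
  define f :: "('c, nat) hgraph \<Rightarrow> real" where "f = (\<lambda>\<Gamma>. ?w \<Gamma> / (\<Prod>i\<in>UNIV. fact (?h \<Gamma> i)))"
  define M :: "('c \<Rightarrow> nat) set" where "M = multi_indices (k * n)"
  define S where "S = (\<Union>h\<in>M. std_graphs k n h :: ('c, nat) hgraph set)"
  have finM: "finite M" by (simp add: M_def finite_multi_indices)
  have finS: "finite S" unfolding S_def using finM finite_std_graphs by auto
  have hstd: "?h \<Gamma> = h" if "\<Gamma> \<in> std_graphs k n h" for \<Gamma> h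
    using that std_labels(2)[of h] by (auto simp: std_graphs_def)
  have quot: "iso_classes k n = iso_class ` {\<Gamma> :: ('c, nat) hgraph. is_hgraph \<Gamma> \<and> regular k \<Gamma> \<and>
      card (verts \<Gamma>) = n}"
    by (auto simp: iso_classes_def quotient_def iso_class_def)
  have self: "\<Gamma> \<in> iso_class \<Gamma>" if "is_hgraph \<Gamma>" for \<Gamma> :: "('c, nat) hgraph"
    using that equiv_class_self[OF equiv_iso_rel] by (simp add: iso_class_def)
  have class_eq: "iso_class \<Gamma>' = iso_class \<Gamma>" if "\<Gamma>' \<in> iso_class \<Gamma>" for \<Gamma> \<Gamma>' :: "('c, nat) hgraph"
    using that equiv_class_eq[OF equiv_iso_rel, of \<Gamma> \<Gamma>'] by (auto simp: iso_class_def)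
  have image: "iso_class ` S = iso_classes k n"
  proof (intro equalityI subsetI)
    fix G :: "('c, nat) hgraph set" assume "G \<in> iso_classes k n"
    then obtain \<Gamma> where \<Gamma>: "is_hgraph \<Gamma>" "regular k \<Gamma>" "card (verts \<Gamma>) = n" "G = iso_class \<Gamma>"
        by (auto simp: quot)
    then obtain \<Gamma>' where \<Gamma>': "\<Gamma>' \<in> std_graphs k n (?h \<Gamma>)" "\<Gamma>' \<in> iso_class \<Gamma>"
        using card_orbit(2)[OF \<Gamma>(1-3) refl] by blast
    have "?h \<Gamma> \<in> M" using regular_msize[OF \<Gamma>(1,2)] \<Gamma>(3) by (simp add: M_def multi_indices_def)
    then show "G \<in> iso_class ` S" using \<Gamma>' \<Gamma>(4) class_eq[OF \<Gamma>'(2)] by (auto simp: S_def)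
  next
    fix G assume "G \<in> iso_class ` S" then show "G \<in> iso_classes k n"
        by (auto simp: quot S_def std_graphs_def)
  qed
  have "(\<Sum>h\<in>M. (\<Sum>\<Gamma>\<in>std_graphs k n h. ?w \<Gamma>) / (\<Prod>i\<in>UNIV. fact (h i))) = (\<Sum>h\<in>M. \<Sum>\<Gamma>\<in>std_graphs k n h. f \<Gamma>)"
    unfolding sum_divide_distrib
  proof (intro sum.cong refl)
    fix h and \<Gamma> :: "('c, nat) hgraph" assume "\<Gamma> \<in> std_graphs k n h"
    from hstd[OF this] have "h = ?h \<Gamma>" by simp
    then show "?w \<Gamma> / (\<Prod>i\<in>UNIV. fact (h i)) = f \<Gamma>" by (simp add: f_def)
  qed
  also have "\<dots> = (\<Sum>\<Gamma>\<in>S. f \<Gamma>)"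
    unfolding S_def
  proof (rule sum.UNION_disjoint[symmetric, OF finM])
    show "\<forall>i\<in>M. \<forall>j\<in>M. i \<noteq> j \<longrightarrow> std_graphs k n i \<inter> std_graphs k n j = {}"
      using hstd by blast
  qed (use finite_std_graphs in auto)
  also have "\<dots> = (\<Sum>G\<in>iso_classes k n. \<Sum>\<Gamma>\<in>{\<Gamma> \<in> S. iso_class \<Gamma> = G}. f \<Gamma>)"
    using finS finite_imageI[OF finS, of iso_class] image by (intro sum.group[symmetric]) auto
  also have "\<dots> = (\<Sum>G\<in>iso_classes k n. graph_weight \<Lambda> (SOME \<Gamma>. \<Gamma> \<in> G))"
  proof (rule sum.cong[OF refl])
    fix G :: "('c, nat) hgraph set" assume "G \<in> iso_classes k n"
    then obtain \<Gamma>0 where \<Gamma>0: "is_hgraph \<Gamma>0" "regular k \<Gamma>0" "card (verts \<Gamma>0) = n" "G = iso_class \<Gamma>0"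
        by (auto simp: quot)
    define \<Gamma> where "\<Gamma> = (SOME \<Gamma>. \<Gamma> \<in> G)"
    have "\<Gamma>0 \<in> G" using self[OF \<Gamma>0(1)] \<Gamma>0(4) by simp
    then have \<Gamma>G: "\<Gamma> \<in> G" unfolding \<Gamma>_def by (rule someI)
    then have "is_hgraph \<Gamma>" "isos \<Gamma>0 \<Gamma> \<noteq> {}" using \<Gamma>0(4) by (auto simp: iso_class_def iso_rel_def)
    note inv = isos_invariants[OF \<Gamma>0(1) this]
    have \<Gamma>: "is_hgraph \<Gamma>" "regular k \<Gamma>" "card (verts \<Gamma>) = n" "G = iso_class \<Gamma>"
      using inv \<Gamma>0 \<open>is_hgraph \<Gamma>\<close> class_eq[of \<Gamma> \<Gamma>0] \<Gamma>G by auto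
    let ?O = "std_graphs k n (?h \<Gamma>) \<inter> iso_class \<Gamma>"
    have iso: "isos \<Gamma> \<Gamma>' \<noteq> {} \<and> is_hgraph \<Gamma>'" if "\<Gamma>' \<in> G" for \<Gamma>'
      using that \<Gamma>(4) by (auto simp: iso_class_def iso_rel_def)
    have Oeq: "{\<Gamma>' \<in> S. iso_class \<Gamma>' = G} = ?O"
    proof (intro equalityI subsetI)
      fix \<Gamma>' assume "\<Gamma>' \<in> {\<Gamma>' \<in> S. iso_class \<Gamma>' = G}"
      then obtain h where h: "\<Gamma>' \<in> std_graphs k n h" "iso_class \<Gamma>' = G" by (auto simp: S_def)
      then have "\<Gamma>' \<in> G" using self[of \<Gamma>'] by (auto simp: std_graphs_def)
      moreover have "h = ?h \<Gamma>"
        using hstd[OF h(1)] isos_invariants(4)[OF \<Gamma>(1), of \<Gamma>'] iso[OF \<open>\<Gamma>' \<in> G\<close>] by auto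
      ultimately show "\<Gamma>' \<in> ?O" using h \<Gamma>(4) by auto
    next
      fix \<Gamma>' assume "\<Gamma>' \<in> ?O"
      moreover have "?h \<Gamma> \<in> M" using regular_msize[OF \<Gamma>(1,2)] \<Gamma>(3) by (simp add: M_def multi_indices_def)
      ultimately show "\<Gamma>' \<in> {\<Gamma>' \<in> S. iso_class \<Gamma>' = G}" using \<Gamma>(4) class_eq by (auto simp: S_def)
    qed
    have fO: "f \<Gamma>' = f \<Gamma>" if "\<Gamma>' \<in> ?O" for \<Gamma>'
    proof -
      have "\<Gamma>' \<in> G" using that \<Gamma>(4) by simp
      note inv = isos_invariants[OF \<Gamma>(1), of \<Gamma>'] iso[OF this]
      then show ?thesis by (simp add: f_def)
    qed
    have orb: "real (card ?O) * real (card (Aut \<Gamma>)) = (\<Prod>i\<in>UNIV. fact (?h \<Gamma> i))"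
      using arg_cong[OF card_orbit(1)[OF \<Gamma>(1-3) refl], of real] by simp
    \<comment> \<open>The division by the order of the automorphism group is justified by the orbit
      equation itself, whose right side is a product of factorials.\<close>
    moreover have "(\<Prod>i\<in>UNIV. fact (?h \<Gamma> i)) \<noteq> (0::real)" by simp
    ultimately have "card (Aut \<Gamma>) \<noteq> 0" by (metis mult_zero_right of_nat_0)
    have "(\<Sum>\<Gamma>'\<in>{\<Gamma>' \<in> S. iso_class \<Gamma>' = G}. f \<Gamma>') = real (card ?O) * f \<Gamma>"
      unfolding Oeq using fO by simp
    also have "\<dots> = graph_weight \<Lambda> \<Gamma>"
      unfolding f_def graph_weight_def orb[symmetric] using \<open>card (Aut \<Gamma>) \<noteq> 0\<close> orb
      by (auto simp: field_simps)
    finally show "(\<Sum>\<Gamma>'\<in>{\<Gamma>' \<in> S. iso_class \<Gamma>' = G}. f \<Gamma>') = graph_weight \<Lambda> (SOME \<Gamma>. \<Gamma> \<in> G)"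
      by (simp add: \<Gamma>_def)
  qed
  finally show ?thesis by (simp add: graph_sum_def M_def)
qed

section \<open>Vertex partitions counted by sequences of multidegrees\<close>

lemma card_label_funcs:
  fixes H :: "'c::finite \<Rightarrow> 'h set"
  assumes "disjoint_labels H"
  shows "card {f \<in> (\<Union>i. H i) \<rightarrow>\<^sub>E N. \<forall>i. P i (restrict f (H i))} = (\<Prod>i\<in>UNIV. card {g \<in> H i \<rightarrow>\<^sub>E N. P i g})"
proof -
  let ?F = "{f \<in> (\<Union>i. H i) \<rightarrow>\<^sub>E N. \<forall>i. P i (restrict f (H i))}"
  let ?G = "Pi\<^sub>E UNIV (\<lambda>i. {g \<in> H i \<rightarrow>\<^sub>E N. P i g})"
  let ?glue = "\<lambda>g x. if x \<in> (\<Union>i. H i) then g (THE i. x \<in> H i) x else undefined"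
  have the: "(THE i. x \<in> H i) = i" if "x \<in> H i" for x i
    using assms that by (intro the_equality) (auto simp: disjoint_labels_def)
  have glue: "?glue g x = g i x" if "x \<in> H i" for g x i
    using that the[OF that] by auto
  have res: "restrict (?glue g) (H i) = g i" if "g \<in> ?G" for g i
  proof
    fix x
    have "g i \<in> extensional (H i)" using that by (auto simp: PiE_def Pi_def)
    then show "restrict (?glue g) (H i) x = g i x"
      using glue[of x i g] by (cases "x \<in> H i") (auto simp: extensional_def)
  qed
  have "bij_betw (\<lambda>f i. restrict f (H i)) ?F ?G"
  proof (rule bij_betw_byWitness[where f' = ?glue])
    show "\<forall>f\<in>?F. ?glue (\<lambda>i. restrict f (H i)) = f"
    proof (intro ballI ext)
      fix f x assume f: "f \<in> ?F"
      show "?glue (\<lambda>i. restrict f (H i)) x = f x"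
      proof (cases "x \<in> (\<Union>i. H i)")
        case True
        then obtain i where "x \<in> H i" by auto
        then show ?thesis using glue[of x i "\<lambda>i. restrict f (H i)"] by simp
      next
        case False
        have "f \<in> extensional (\<Union>i. H i)" using f by (auto simp: PiE_def)
        then show ?thesis using False by (simp add: extensional_def)
      qed
    qed
    show "\<forall>g\<in>?G. (\<lambda>i. restrict (?glue g) (H i)) = g" using res by blast
    show "(\<lambda>f i. restrict f (H i)) ` ?F \<subseteq> ?G" by (auto simp: PiE_UNIV_domain)
    show "?glue ` ?G \<subseteq> ?F"
    proof (intro subsetI)
      fix f assume "f \<in> ?glue ` ?G"
      then obtain g where g: "g \<in> ?G" and f: "f = ?glue g" by auto
      have "f x \<in> N" if "x \<in> H i" for x i
        unfolding f glue[OF that] using g that by (auto simp: PiE_def Pi_def)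
      moreover have "P i (restrict f (H i))" for i
        unfolding f res[OF g] using g by (auto simp: PiE_def Pi_def)
      moreover have "f \<in> extensional (\<Union>i. H i)" unfolding f extensional_def by simp
      ultimately show "f \<in> ?F" by (auto simp: PiE_def)
    qed
  qed
  then show ?thesis by (simp add: bij_betw_same_card card_PiE)
qed

text \<open>The factor \<open>fact n\<close> numbers the vertices, so a partition becomes a function
  sending each half-edge to a vertex. These functions are sorted by the multidegrees
  \<open>W j\<close> that they produce; for fixed \<open>W\<close> the colors are independent, and
  each contributes one multinomial coefficient.\<close>

lemma sum_vertex_partitions:
  fixes H :: "'c::finite \<Rightarrow> 'h set" and \<Lambda> :: "('c \<Rightarrow> nat) \<Rightarrow> real"
  assumes "disjoint_labels H" "\<And>i. finite (H i)" "k > 0"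
  shows "fact n * (\<Sum>V\<in>vertex_partitions k n H. \<Prod>v\<in>V. \<Lambda> (\<lambda>i. card (v \<inter> H i))) =
    (\<Sum>W | W \<in> {..<n} \<rightarrow>\<^sub>E multi_indices k \<and> (\<lambda>i. \<Sum>j<n. W j i) = (\<lambda>i. card (H i)).
       (\<Prod>j<n. \<Lambda> (W j)) * (\<Prod>i\<in>UNIV. fact (card (H i)) / (\<Prod>j<n. fact (W j i))))"
proof -
  define U where "U = (\<Union>i. H i)"
  define deg where "deg v = (\<lambda>i. card (v \<inter> H i))" for v
  \<comment> \<open>Being 0 on blocks of the wrong size, \<open>w\<close> enforces regularity by
    itself, and the sums may run over all partitions and all functions.\<close>
  define w where "w v = (if msize (deg v) = k then \<Lambda> (deg v) else 0)" for v
  define D where "D f = (\<lambda>j\<in>{..<n}. deg {x \<in> U. f x = j})" for f :: "'h \<Rightarrow> nat"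
  define FF where "FF = U \<rightarrow>\<^sub>E {..<n}"
  define WW :: "(nat \<Rightarrow> 'c \<Rightarrow> nat) set" where "WW = {..<n} \<rightarrow>\<^sub>E multi_indices k"
  have finU: "finite U" using assms by (auto simp: U_def)
  have finF: "finite FF" unfolding FF_def using finU by (intro finite_PiE) auto
  have finW: "finite WW" unfolding WW_def using finite_multi_indices by (intro finite_PiE) auto
  have "(\<Sum>V\<in>vertex_partitions k n H. \<Prod>v\<in>V. \<Lambda> (\<lambda>i. card (v \<inter> H i))) =
      (\<Sum>V\<in>vertex_partitions k n H. \<Prod>v\<in>V. w v)"
    by (intro sum.cong prod.cong refl) (auto simp: vertex_partitions_def w_def deg_def)
  also have "\<dots> = (\<Sum>V | partition_on U V \<and> card V = n. \<Prod>v\<in>V. w v)"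
  proof (rule sum.mono_neutral_left)
    show "finite {V. partition_on U V \<and> card V = n}"
      by (rule finite_subset[OF _ finitely_many_partition_on[OF finU]]) auto
    show "vertex_partitions k n H \<subseteq> {V. partition_on U V \<and> card V = n}"
      by (auto simp: vertex_partitions_def U_def)
    show "\<forall>V\<in>{V. partition_on U V \<and> card V = n} - vertex_partitions k n H. (\<Prod>v\<in>V. w v) = 0"
    proof
      fix V assume V: "V \<in> {V. partition_on U V \<and> card V = n} - vertex_partitions k n H"
      then obtain v where "v \<in> V" "msize (deg v) \<noteq> k" by (auto simp: vertex_partitions_def deg_def U_def)
      moreover have "finite V" using V finite_elements[OF finU] by auto
      ultimately show "(\<Prod>v\<in>V. w v) = 0" by (auto simp: w_def prod_zero_iff)
    qed
  qed
  also have "fact n * \<dots> = (\<Sum>f | f \<in> U \<rightarrow>\<^sub>E {..<n} \<and> f ` U = {..<n}. \<Prod>j<n. w {x \<in> U. f x = j})"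
    by (rule sum_partitions_eq_sum_surjections[OF finU])
  also have "\<dots> = (\<Sum>f\<in>FF. \<Prod>j<n. w {x \<in> U. f x = j})"
  proof (rule sum.mono_neutral_left[OF finF])
    show "\<forall>f\<in>FF - {f \<in> U \<rightarrow>\<^sub>E {..<n}. f ` U = {..<n}}. (\<Prod>j<n. w {x \<in> U. f x = j}) = 0"
    proof
      fix f assume f: "f \<in> FF - {f \<in> U \<rightarrow>\<^sub>E {..<n}. f ` U = {..<n}}"
      then have "f ` U \<subseteq> {..<n}" "f ` U \<noteq> {..<n}" by (auto simp: FF_def)
      then obtain j where "j < n" "j \<notin> f ` U" by auto
      then have "{x \<in> U. f x = j} = {}" by auto
      \<comment> \<open>An empty block has size 0, which differs from \<open>k\<close>; so functions
        that miss a vertex contribute nothing.\<close>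
      moreover have "w {} = 0" using assms(3) by (simp add: w_def deg_def msize_def)
      ultimately have "w {x \<in> U. f x = j} = 0" by (simp only:)
      then show "(\<Prod>j<n. w {x \<in> U. f x = j}) = 0" using \<open>j < n\<close> by (intro prod_zero) auto
    qed
  qed (auto simp: FF_def)
  also have "\<dots> = (\<Sum>f\<in>{f \<in> FF. D f \<in> WW}. \<Prod>j<n. \<Lambda> (D f j))"
  proof (rule sum.mono_neutral_cong_right[OF finF])
    show "\<forall>f\<in>FF - {f \<in> FF. D f \<in> WW}. (\<Prod>j<n. w {x \<in> U. f x = j}) = 0"
    proof
      fix f assume f: "f \<in> FF - {f \<in> FF. D f \<in> WW}"
      then obtain j where "j < n" "msize (deg {x \<in> U. f x = j}) \<noteq> k"
        by (auto simp: WW_def D_def multi_indices_def PiE_def Pi_def)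
      then show "(\<Prod>j<n. w {x \<in> U. f x = j}) = 0" by (auto simp: w_def prod_zero_iff)
    qed
    show "(\<Prod>j<n. w {x \<in> U. f x = j}) = (\<Prod>j<n. \<Lambda> (D f j))" if "f \<in> {f \<in> FF. D f \<in> WW}" for f
    proof (rule prod.cong[OF refl])
      fix j assume j: "j \<in> {..<n}"
      have "D f \<in> WW" using that by simp
      then have "D f j \<in> multi_indices k" using j unfolding WW_def by (rule PiE_mem)
      then show "w {x \<in> U. f x = j} = \<Lambda> (D f j)" using j by (auto simp: D_def w_def multi_indices_def)
    qed
  qed auto
  also have "\<dots> = (\<Sum>W\<in>WW. \<Sum>f\<in>{f \<in> {f \<in> FF. D f \<in> WW}. D f = W}. \<Prod>j<n. \<Lambda> (D f j))"
    using finF finW by (intro sum.group[symmetric]) auto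
  also have "\<dots> = (\<Sum>W\<in>WW. (\<Prod>j<n. \<Lambda> (W j)) * real (card {f \<in> FF. D f = W}))"
  proof (rule sum.cong[OF refl])
    fix W assume W: "W \<in> WW"
    have "{f \<in> {f \<in> FF. D f \<in> WW}. D f = W} = {f \<in> FF. D f = W}" using W by auto
    then show "(\<Sum>f\<in>{f \<in> {f \<in> FF. D f \<in> WW}. D f = W}. \<Prod>j<n. \<Lambda> (D f j)) =
        (\<Prod>j<n. \<Lambda> (W j)) * real (card {f \<in> FF. D f = W})"
      by simp
  qed
  also have "\<dots> = (\<Sum>W\<in>{W \<in> WW. (\<lambda>i. \<Sum>j<n. W j i) = (\<lambda>i. card (H i))}.
      (\<Prod>j<n. \<Lambda> (W j)) * (\<Prod>i\<in>UNIV. fact (card (H i)) / (\<Prod>j<n. fact (W j i))))"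
  proof -
    \<comment> \<open>Prescribing all multidegrees is a separate condition on the restriction to
      each color, so the count factors.\<close>
    have cardD: "card {f \<in> FF. D f = W} = (\<Prod>i\<in>UNIV. card {g \<in> H i \<rightarrow>\<^sub>E {..<n}. \<forall>j<n. card {x \<in> H i. g x =
        j} = W j i})"
      if W: "W \<in> WW" for W
    proof -
      have ext: "W j = undefined" if "\<not> j < n" for j using W that
          by (auto simp: WW_def PiE_def extensional_def)
      have "D f = W \<longleftrightarrow> (\<forall>i. \<forall>j<n. card {x \<in> H i. restrict f (H i) x = j} = W j i)" for f
      proof -
        have "D f = W \<longleftrightarrow> (\<forall>j<n. deg {x \<in> U. f x = j} = W j)"
        proof
          assume "D f = W" then show "\<forall>j<n. deg {x \<in> U. f x = j} = W j" by (auto simp: D_def)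
        next
          assume "\<forall>j<n. deg {x \<in> U. f x = j} = W j"
          then show "D f = W" using ext by (auto simp: D_def)
        qed
        also have "\<dots> \<longleftrightarrow> (\<forall>j<n. \<forall>i. card {x \<in> H i. restrict f (H i) x = j} = W j i)"
        proof -
          have "{x \<in> U. f x = j} \<inter> H i = {x \<in> H i. restrict f (H i) x = j}" for i j
            by (auto simp: U_def)
          then show ?thesis by (simp add: deg_def fun_eq_iff)
        qed
        finally show ?thesis by blast
      qed
      then show ?thesis unfolding FF_def U_def
        by (simp only: card_label_funcs[OF assms(1),
            where P = "\<lambda>i g. \<forall>j<n. card {x \<in> H i. g x = j} = W j i"])
    qed
    show ?thesis
    proof (rule sum.mono_neutral_cong_right[OF finW])
      show "\<forall>W\<in>WW - {W \<in> WW. (\<lambda>i. \<Sum>j<n. W j i) =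
          (\<lambda>i. card (H i))}. (\<Prod>j<n. \<Lambda> (W j)) * real (card {f \<in> FF. D f = W}) = 0"
      proof
        fix W assume W: "W \<in> WW - {W \<in> WW. (\<lambda>i. \<Sum>j<n. W j i) = (\<lambda>i. card (H i))}"
        then obtain i where "(\<Sum>j<n. W j i) \<noteq> card (H i)" by auto
        then have "card {g \<in> H i \<rightarrow>\<^sub>E {..<n}. \<forall>j<n. card {x \<in> H i. g x = j} = W j i} = 0"
          by (subst card_funcs_fibers_eq_0[OF assms(2)]) auto
        then have "card {f \<in> FF. D f = W} = 0" using cardD[of W] W by (auto simp: prod_zero_iff)
        then show "(\<Prod>j<n. \<Lambda> (W j)) * real (card {f \<in> FF. D f = W}) = 0" by simp
      qed
      show "(\<Prod>j<n. \<Lambda> (W j)) * real (card {f \<in> FF. D f = W}) =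
         (\<Prod>j<n. \<Lambda> (W j)) * (\<Prod>i\<in>UNIV. fact (card (H i)) / (\<Prod>j<n. fact (W j i)))"
        if "W \<in> {W \<in> WW. (\<lambda>i. \<Sum>j<n. W j i) = (\<lambda>i. card (H i))}" for W
      proof -
        have "real (card {g \<in> H i \<rightarrow>\<^sub>E {..<n}. \<forall>j<n. card {x \<in> H i. g x = j} = W j i}) =
            fact (card (H i)) / (\<Prod>j<n. fact (W j i))" for i
        proof -
          have "(\<Sum>j<n. W j i) = card (H i)" using that by (auto dest: fun_cong)
          from arg_cong[OF card_funcs_fibers[OF assms(2) this], of real]
          have "real (card {g \<in> H i \<rightarrow>\<^sub>E {..<n}. \<forall>j<n. card {x \<in> H i. g x = j} =
              W j i}) * (\<Prod>j<n. fact (W j i)) = fact (card (H i))"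
            by (simp only: of_nat_mult of_nat_prod of_nat_fact)
          then show ?thesis by (simp add: eq_divide_eq prod_zero_iff)
        qed
        then show ?thesis using that by (simp add: cardD)
      qed
    qed auto
  qed
  finally show ?thesis by (simp add: WW_def)
qed

definition gauss_moment :: "nat \<Rightarrow> real"
  where "gauss_moment m = (if even m then fact m / (2 ^ (m div 2) * fact (m div 2)) else 0)"

lemma card_pairings_eq_gauss_moment: "finite A \<Longrightarrow> real (card (pairings A)) = gauss_moment (card A)"
  using card_pairings[of A "card A div 2"] pairings_empty_if_odd[of A] by (auto simp: gauss_moment_def)

text \<open>The factorials of the label counts in the multinomial coefficients cancel those from the
  orbit count, and summing over all label counts \<open>h\<close> frees \<open>W\<close> from its
  constraint. What is left of the multinomials, the factorials of the \<open>W j\<close>, becomes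
  the denominators w! of the polynomial.\<close>

lemma graph_sum_eq_sum_moments:
  fixes \<Lambda> :: "('c::finite \<Rightarrow> nat) \<Rightarrow> real"
  assumes "k > 0"
  shows "fact n * graph_sum k \<Lambda> n = (\<Sum>W\<in>{..<n} \<rightarrow>\<^sub>E multi_indices k.
    (\<Prod>j<n. \<Lambda> (W j) / mfact (W j)) * (\<Prod>i\<in>UNIV. gauss_moment (\<Sum>j<n. W j i)))"
proof -
  define M :: "('c \<Rightarrow> nat) set" where "M = multi_indices (k * n)"
  define WW :: "(nat \<Rightarrow> 'c \<Rightarrow> nat) set" where "WW = {..<n} \<rightarrow>\<^sub>E multi_indices k"
  define tot :: "(nat \<Rightarrow> 'c \<Rightarrow> nat) \<Rightarrow> 'c \<Rightarrow> nat" where "tot W = (\<lambda>i. \<Sum>j<n. W j i)" for W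
  define t where "t W = (\<Prod>j<n. \<Lambda> (W j) / mfact (W j)) * (\<Prod>i\<in>UNIV. gauss_moment (tot W i))" for W
  have finM: "finite M" by (simp add: M_def finite_multi_indices)
  have finW: "finite WW" unfolding WW_def using finite_multi_indices by (intro finite_PiE) auto
  have "fact n * graph_sum k \<Lambda> n = (\<Sum>h\<in>M. (\<Prod>i\<in>UNIV. gauss_moment (h i)) / (\<Prod>i\<in>UNIV. fact (h i)) *
     (fact n * (\<Sum>V\<in>vertex_partitions k n (std_labels h). \<Prod>v\<in>V. \<Lambda> (\<lambda>i. card (v \<inter> std_labels h i)))))"
    unfolding graph_sum_eq_sum_std_graphs sum_std_graphs M_def
    by (subst sum_distrib_left) (simp add: card_pairings_eq_gauss_moment std_labels mult_ac)
  also have "\<dots> = (\<Sum>h\<in>M. \<Sum>W\<in>{W \<in> WW. tot W = h}. t W)"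
  proof (rule sum.cong[OF refl])
    fix h assume "h \<in> M"
    have "(\<Prod>i\<in>UNIV. gauss_moment (h i)) / (\<Prod>i\<in>UNIV. fact (h i)) *
       (fact n * (\<Sum>V\<in>vertex_partitions k n (std_labels h). \<Prod>v\<in>V. \<Lambda> (\<lambda>i. card (v \<inter> std_labels h i)))) =
       (\<Sum>W\<in>{W \<in> WW. tot W = h}. (\<Prod>i\<in>UNIV. gauss_moment (h i)) / (\<Prod>i\<in>UNIV. fact (h i)) *
          ((\<Prod>j<n. \<Lambda> (W j)) * (\<Prod>i\<in>UNIV. fact (h i) / (\<Prod>j<n. fact (W j i)))))"
      unfolding sum_vertex_partitions[OF std_labels(3,1) assms] std_labels(2) WW_def tot_def
      by (simp only: sum_distrib_left)
    also have "\<dots> = (\<Sum>W\<in>{W \<in> WW. tot W = h}. t W)"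
    proof (rule sum.cong[OF refl])
      fix W assume W: "W \<in> {W \<in> WW. tot W = h}"
      have "(\<Prod>i\<in>UNIV. \<Prod>j<n. fact (W j i) :: real) = (\<Prod>j<n. real (mfact (W j)))"
        by (subst prod.swap) (simp add: mfact_def)
      then show "(\<Prod>i\<in>UNIV. gauss_moment (h i)) / (\<Prod>i\<in>UNIV. fact (h i)) *
          ((\<Prod>j<n. \<Lambda> (W j)) * (\<Prod>i\<in>UNIV. fact (h i) / (\<Prod>j<n. fact (W j i)))) = t W"
        using W by (simp add: t_def prod_dividef)
    qed
    finally show "(\<Prod>i\<in>UNIV. gauss_moment (h i)) / (\<Prod>i\<in>UNIV. fact (h i)) *
       (fact n * (\<Sum>V\<in>vertex_partitions k n (std_labels h). \<Prod>v\<in>V. \<Lambda> (\<lambda>i. card (v \<inter> std_labels h i)))) =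
       (\<Sum>W\<in>{W \<in> WW. tot W = h}. t W)" .
  qed
  also have "\<dots> = (\<Sum>W\<in>WW. t W)"
  proof (rule sum.group[OF finW finM])
    show "tot ` WW \<subseteq> M"
    proof (intro subsetI)
      fix h assume "h \<in> tot ` WW"
      then obtain W where W: "W \<in> WW" "h = tot W" by auto
      have "msize h = (\<Sum>j<n. msize (W j))"
        unfolding W msize_def tot_def by (rule sum.swap)
      also have "\<dots> = (\<Sum>j<n. k)"
        using W by (intro sum.cong refl) (auto simp: WW_def multi_indices_def PiE_def Pi_def)
      finally show "h \<in> M" by (simp add: M_def multi_indices_def)
    qed
  qed
  finally show ?thesis by (simp add: WW_def t_def tot_def)
qed

section \<open>The weighted count as a Gaussian integral\<close>

text \<open>Monomials over an arbitrary commutative ring, so that one set of algebraic rules serves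
  both the real form and the complex polynomial.\<close>

definition mpow :: "'a::comm_ring_1^'c \<Rightarrow> ('c::finite \<Rightarrow> nat) \<Rightarrow> 'a"
  where "mpow x w = (\<Prod>i\<in>UNIV. (x $ i) ^ w i)"

definition real_form :: "nat \<Rightarrow> (('c::finite \<Rightarrow> nat) \<Rightarrow> real) \<Rightarrow> real^'c \<Rightarrow> real"
  where "real_form k \<Lambda> x = (\<Sum>w\<in>multi_indices k. \<Lambda> w / mfact w * mpow x w)"

text \<open>Lebesgue measure on vectors is the image of a product measure that is indexed by basis
  vectors instead of coordinates; \<open>c\<close> translates the former into the latter. After this
  reindexing the claim is Fubini's theorem for products.\<close>

lemma lborel_prod_vec:
  fixes f :: "'c::finite \<Rightarrow> real \<Rightarrow> real"
  assumes "\<And>i. integrable lborel (f i)"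
  shows "integrable lborel (\<lambda>x :: real^'c. \<Prod>i\<in>UNIV. f i (x $ i))"
    "(\<integral>x. (\<Prod>i\<in>UNIV. f i (x $ i)) \<partial>(lborel :: (real^'c) measure)) = (\<Prod>i\<in>UNIV. \<integral>x. f i x \<partial>lborel)"
proof -
  let ?B = "Basis :: (real^'c) set"
  let ?T = "\<lambda>g. \<Sum>b\<in>?B. g b *\<^sub>R b"
  define c where "c b = (THE i. b = axis i (1::real))" for b :: "real^'c"
  have c: "c (axis i 1) = i" for i unfolding c_def by (rule the_equality) (auto simp: axis_eq_axis)
  have bij: "bij_betw (\<lambda>i :: 'c. axis i (1::real)) UNIV ?B"
    by (auto simp: bij_betw_def Basis_vec_def inj_on_def axis_eq_axis)
  interpret product_sigma_finite "\<lambda>_ :: real^'c. lborel :: real measure" by standard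
  have comp: "?T g $ i = g (axis i 1)" for g i
    using inner_sum_left_Basis[of "axis i 1" g] by (simp add: inner_axis axis_in_Basis_iff)
  have prod_eq: "(\<Prod>i\<in>UNIV. f i (?T g $ i)) = (\<Prod>b\<in>?B. f (c b) (g b))" for g
    unfolding prod.reindex_bij_betw[OF bij, symmetric] comp c ..
  have meas: "(\<lambda>x :: real^'c. \<Prod>i\<in>UNIV. f i (x $ i)) \<in> borel_measurable borel"
    using assms by (intro borel_measurable_prod measurable_compose[OF _ borel_measurable_integrable[OF
        assms, simplified]]) auto
  have T: "?T \<in> measurable (Pi\<^sub>M ?B (\<lambda>_. lborel)) borel" by measurable
  have "integrable (Pi\<^sub>M ?B (\<lambda>_. lborel)) (\<lambda>g. \<Prod>b\<in>?B. f (c b) (g b))"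
    using assms by (intro product_integrable_prod) auto
  then show "integrable lborel (\<lambda>x :: real^'c. \<Prod>i\<in>UNIV. f i (x $ i))"
    by (subst lborel_eq) (simp only: integrable_distr_eq[OF T meas] prod_eq)
  have "(\<integral>x. (\<Prod>i\<in>UNIV. f i (x $ i)) \<partial>(lborel :: (real^'c) measure)) =
      (\<integral>g. (\<Prod>b\<in>?B. f (c b) (g b)) \<partial>Pi\<^sub>M ?B (\<lambda>_. lborel))"
    by (subst lborel_eq) (simp only: integral_distr[OF T meas] prod_eq)
  also have "\<dots> = (\<Prod>b\<in>?B. \<integral>x. f (c b) x \<partial>lborel)"
    using assms by (intro product_integral_prod) auto
  also have "\<dots> = (\<Prod>i\<in>UNIV. \<integral>x. f i x \<partial>lborel)"
    unfolding prod.reindex_bij_betw[OF bij, symmetric] by (simp add: c)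
  finally show "(\<integral>x. (\<Prod>i\<in>UNIV. f i (x $ i)) \<partial>(lborel :: (real^'c) measure)) =
      (\<Prod>i\<in>UNIV. \<integral>x. f i x \<partial>lborel)" .
qed

lemma integral_normal_power:
  "integrable lborel (\<lambda>x. std_normal_density x * x ^ m)"
  "(\<integral>x. std_normal_density x * x ^ m \<partial>lborel) = gauss_moment m"
proof -
  show "integrable lborel (\<lambda>x. std_normal_density x * x ^ m)" by (rule integrable_std_normal_moment)
  show "(\<integral>x. std_normal_density x * x ^ m \<partial>lborel) = gauss_moment m"
  proof (cases "even m")
    case True
    then show ?thesis using integral_std_normal_moment_even[of "m div 2"] by (simp add: gauss_moment_def)
  next
    case False
    then have "m = 2 * (m div 2) + 1" by (metis odd_two_times_div_two_succ)
    then show ?thesis using integral_std_normal_moment_odd[of "m div 2"] False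
        by (simp add: gauss_moment_def)
  qed
qed

definition std_gauss :: "real^'c::finite \<Rightarrow> real"
  where "std_gauss x = (\<Prod>i\<in>UNIV. std_normal_density (x $ i))"

lemma integral_gauss_mpow:
  "integrable lborel (\<lambda>x :: real^'c::finite. std_gauss x * mpow x h)"
  "(\<integral>x. std_gauss x * mpow x h \<partial>lborel) = (\<Prod>i\<in>(UNIV :: 'c set). gauss_moment (h i))"
  using lborel_prod_vec[of "\<lambda>i x. std_normal_density x * x ^ h i"] integral_normal_power
  by (simp_all add: std_gauss_def mpow_def prod.distrib)

lemma real_form_power:
  "real_form k \<Lambda> x ^ n = (\<Sum>W\<in>{..<n} \<rightarrow>\<^sub>E multi_indices k. (\<Prod>j<n. \<Lambda> (W j) / mfact (W j)) *
      mpow x (\<lambda>i. \<Sum>j<n. W j i))"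
proof -
  have "real_form k \<Lambda> x ^ n = (\<Prod>j<n. \<Sum>w\<in>multi_indices k. \<Lambda> w / mfact w * mpow x w)"
    by (simp add: real_form_def)
  also have "\<dots> = (\<Sum>W\<in>{..<n} \<rightarrow>\<^sub>E multi_indices k. \<Prod>j<n. \<Lambda> (W j) / mfact (W j) * mpow x (W j))"
    by (rule prod_sum_PiE) (auto simp: finite_multi_indices)
  also have "\<dots> = (\<Sum>W\<in>{..<n} \<rightarrow>\<^sub>E multi_indices k. (\<Prod>j<n. \<Lambda> (W j) / mfact (W j)) *
      mpow x (\<lambda>i. \<Sum>j<n. W j i))"
  proof (rule sum.cong[OF refl])
    fix W :: "nat \<Rightarrow> 'a \<Rightarrow> nat"
    have "(\<Prod>j<n. mpow x (W j)) = mpow x (\<lambda>i. \<Sum>j<n. W j i)"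
      unfolding mpow_def power_sum by (rule prod.swap)
    then show "(\<Prod>j<n. \<Lambda> (W j) / mfact (W j) * mpow x (W j)) =
       (\<Prod>j<n. \<Lambda> (W j) / mfact (W j)) * mpow x (\<lambda>i. \<Sum>j<n. W j i)"
      unfolding prod.distrib by simp
  qed
  finally show ?thesis .
qed

text \<open>Wick's formula: expanding the power chooses a multi-index for each of the
  \<open>n\<close> factors, and these sequences are the ones that record the multidegrees of
  \<open>n\<close> numbered vertices. Each resulting monomial integrates to a product of moments,
  one for each color, which counts the matchings.\<close>

theorem graph_sum_eq_gauss_integral:
  fixes \<Lambda> :: "('c::finite \<Rightarrow> nat) \<Rightarrow> real"
  shows "integrable lborel (\<lambda>x. std_gauss x * real_form k \<Lambda> x ^ n)"
    "k > 0 \<Longrightarrow> fact n * graph_sum k \<Lambda> n = (\<integral>x. std_gauss x * real_form k \<Lambda> x ^ n \<partial>lborel)"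
proof -
  define WW :: "(nat \<Rightarrow> 'c \<Rightarrow> nat) set" where "WW = {..<n} \<rightarrow>\<^sub>E multi_indices k"
  have eq: "std_gauss x * real_form k \<Lambda> x ^ n =
      (\<Sum>W\<in>WW. (\<Prod>j<n. \<Lambda> (W j) / mfact (W j)) * (std_gauss x * mpow x (\<lambda>i. \<Sum>j<n. W j i)))" for x
    unfolding real_form_power sum_distrib_left WW_def by (simp add: mult_ac)
  show "integrable lborel (\<lambda>x. std_gauss x * real_form k \<Lambda> x ^ n)"
    unfolding eq by (intro Bochner_Integration.integrable_sum integrable_mult_right integral_gauss_mpow)
  show "fact n * graph_sum k \<Lambda> n = (\<integral>x. std_gauss x * real_form k \<Lambda> x ^ n \<partial>lborel)" if "k > 0"
    unfolding graph_sum_eq_sum_moments[OF that] eq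
    by (simp add: Bochner_Integration.integral_sum integral_gauss_mpow WW_def)
qed

section \<open>Gaussian integrals of quadratic forms\<close>

lemma bij_betw_axis_Basis: "bij_betw (\<lambda>i :: 'n::finite. axis i (1::real)) UNIV Basis"
  by (auto simp: bij_betw_def Basis_vec_def inj_on_def axis_eq_axis)

lemma prod_Basis_vec: "(\<Prod>b\<in>(Basis :: (real^'n) set). F b) = (\<Prod>i\<in>UNIV. F (axis i 1))"
  by (rule prod.reindex_bij_betw[OF bij_betw_axis_Basis, symmetric])

lemma sum_Basis_vec_component: "(\<Sum>b\<in>(Basis :: (real^'n) set). g b *\<^sub>R b) $ i = g (axis i 1)"
  using inner_sum_left_Basis[of "axis i 1 :: real^'n" g] by (simp add: inner_axis)

text \<open>With the integral over coordinate \<open>m\<close> taken innermost, the shear is a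
  translation by the value of coordinate \<open>n\<close>, which is constant there because
  \<open>m \<noteq> n\<close>. Translation invariance on the line finishes the argument.\<close>

lemma nn_integral_shear:
  fixes g :: "real^'n \<Rightarrow> ennreal"
  assumes [measurable]: "g \<in> borel_measurable borel" and "m \<noteq> n"
  shows "(\<integral>\<^sup>+x. g (\<chi> i. if i = m then x $ m + x $ n else x $ i) \<partial>lborel) = (\<integral>\<^sup>+x. g x \<partial>lborel)"
proof -
  let ?h = "\<lambda>x :: real^'n. \<chi> i. if i = m then x $ m + x $ n else x $ i"
  let ?B = "Basis :: (real^'n) set"
  let ?e = "axis m 1 :: real^'n"
  let ?T = "\<lambda>g. \<Sum>b\<in>?B. g b *\<^sub>R b"
  interpret product_sigma_finite "\<lambda>_ :: real^'n. lborel :: real measure" by standard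
  have eB: "?e \<in> ?B" by (simp add: axis_in_Basis_iff)
  have T: "?T \<in> measurable (Pi\<^sub>M ?B (\<lambda>_. lborel)) borel" by measurable
  have iterated: "(\<integral>\<^sup>+x. f x \<partial>lborel) =
      (\<integral>\<^sup>+z. (\<integral>\<^sup>+y. f (?T (z(?e := y))) \<partial>lborel) \<partial>Pi\<^sub>M (?B - {?e}) (\<lambda>_. lborel))"
    if f[measurable]: "f \<in> borel_measurable borel" for f :: "real^'n \<Rightarrow> ennreal"
  proof -
    have "(\<integral>\<^sup>+x. f x \<partial>lborel) = (\<integral>\<^sup>+z. f (?T z) \<partial>Pi\<^sub>M ?B (\<lambda>_. lborel))"
      by (subst lborel_eq, subst nn_integral_distr[OF T]) (simp_all add: f)
    also have "\<dots> = (\<integral>\<^sup>+z. f (?T z) \<partial>Pi\<^sub>M (insert ?e (?B - {?e})) (\<lambda>_. lborel))"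
      using eB by (simp add: insert_absorb)
    also have "(\<integral>\<^sup>+z. f (?T z) \<partial>Pi\<^sub>M (insert ?e (?B - {?e})) (\<lambda>_. lborel)) =
        (\<integral>\<^sup>+z. (\<integral>\<^sup>+y. f (?T (z(?e := y))) \<partial>lborel) \<partial>Pi\<^sub>M (?B - {?e}) (\<lambda>_. lborel))"
      using eB by (intro product_nn_integral_insert) (auto simp: insert_absorb)
    finally show ?thesis .
  qed
  define base where "base z = ?T (z(?e := 0))" for z :: "real^'n \<Rightarrow> real"
  have shift: "?T (z(?e := y)) = base z + y *\<^sub>R ?e" for z :: "real^'n \<Rightarrow> real" and y
    unfolding base_def vec_eq_iff sum_Basis_vec_component vector_add_component vector_scaleR_component
    by (simp add: axis_eq_axis, simp add: axis_def)
  have meas: "(\<lambda>y. g (?T (z(?e := y)))) \<in> borel_measurable borel" for z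
    unfolding shift by measurable
  have h: "?h (?T (z(?e := y))) = ?T (z(?e := z (axis n 1) + 1 * y))" for z :: "real^'n \<Rightarrow> real" and y
    unfolding vec_eq_iff vec_lambda_beta sum_Basis_vec_component using assms(2)
        by (auto simp: axis_eq_axis)
  have "linear ?h" by (rule linearI) (auto simp: algebra_simps plus_vec_def scaleR_vec_def vec_eq_iff)
  then have hm: "?h \<in> borel_measurable borel"
    by (intro borel_measurable_continuous_onI linear_continuous_on)
        (simp add: linear_conv_bounded_linear)
  have "(\<integral>\<^sup>+x. g (?h x) \<partial>lborel) =
      (\<integral>\<^sup>+z. (\<integral>\<^sup>+y. g (?h (?T (z(?e := y)))) \<partial>lborel) \<partial>Pi\<^sub>M (?B - {?e}) (\<lambda>_. lborel))"
    by (rule iterated) (rule measurable_compose[OF hm assms(1)])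
  also have "\<dots> = (\<integral>\<^sup>+z. (\<integral>\<^sup>+y. g (?T (z(?e := y))) \<partial>lborel) \<partial>Pi\<^sub>M (?B - {?e}) (\<lambda>_. lborel))"
    unfolding h
  proof (rule nn_integral_cong)
    fix z
    show "(\<integral>\<^sup>+y. g (?T (z(?e := z (axis n 1) + 1 * y))) \<partial>lborel) = (\<integral>\<^sup>+y. g (?T (z(?e := y))) \<partial>lborel)"
      using nn_integral_real_affine[OF meas[of z], where c = 1 and t = "z (axis n 1)"] by simp
  qed
  also have "\<dots> = (\<integral>\<^sup>+x. g x \<partial>lborel)" by (rule iterated[symmetric]) fact
  finally show ?thesis .
qed

text \<open>
  The change of variables formula of \<open>HOL-Analysis\<close> needs a well-ordered index type, hence this direct
  argument by reduction to elementary matrices.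
\<close>

lemma nn_integral_linear_vec:
  fixes f :: "real^'n \<Rightarrow> real^'n" and g :: "real^'n \<Rightarrow> ennreal"
  assumes "linear f" "det (matrix f) \<noteq> 0" "g \<in> borel_measurable borel"
  shows "(\<integral>\<^sup>+x. g x \<partial>lborel) = ennreal \<bar>det (matrix f)\<bar> * (\<integral>\<^sup>+x. g (f x) \<partial>lborel)"
proof -
  let ?P = "\<lambda>f :: real^'n \<Rightarrow> real^'n. det (matrix f) \<noteq> 0 \<longrightarrow>
      (\<forall>g :: real^'n \<Rightarrow> ennreal. g \<in> borel_measurable borel \<longrightarrow>
    (\<integral>\<^sup>+x. g x \<partial>lborel) = ennreal \<bar>det (matrix f)\<bar> * (\<integral>\<^sup>+x. g (f x) \<partial>lborel))"
  have "?P f"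
  proof (induction rule: induct_linear_elementary[OF assms(1)])
    case (1 f1 f2)
    show ?case
    proof (intro impI allI)
      fix g :: "real^'n \<Rightarrow> ennreal"
      assume det: "det (matrix (f1 \<circ> f2)) \<noteq> 0" and g[measurable]: "g \<in> borel_measurable borel"
      have eq: "det (matrix (f1 \<circ> f2)) = det (matrix f1) * det (matrix f2)"
        using matrix_compose[OF 1(2,1)] by (simp add: det_mul)
      have [measurable]: "f1 \<in> borel_measurable borel"
        using 1(1) by (intro borel_measurable_continuous_onI linear_continuous_on)
            (simp add: linear_conv_bounded_linear)
      have nz: "det (matrix f1) \<noteq> 0" "det (matrix f2) \<noteq> 0" using det eq by auto
      have "(\<integral>\<^sup>+x. g x \<partial>lborel) = ennreal \<bar>det (matrix f1)\<bar> * (\<integral>\<^sup>+x. g (f1 x) \<partial>lborel)"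
        using 1(3) nz(1) g by blast
      also have "(\<integral>\<^sup>+x. g (f1 x) \<partial>lborel) = ennreal \<bar>det (matrix f2)\<bar> * (\<integral>\<^sup>+x. g (f1 (f2 x)) \<partial>lborel)"
      proof -
        have "(\<lambda>x. g (f1 x)) \<in> borel_measurable borel" by measurable
        then show ?thesis using 1(4) nz(2) by blast
      qed
      finally show "(\<integral>\<^sup>+x. g x \<partial>lborel) =
          ennreal \<bar>det (matrix (f1 \<circ> f2))\<bar> * (\<integral>\<^sup>+x. g ((f1 \<circ> f2) x) \<partial>lborel)"
        by (simp add: eq abs_mult ennreal_mult mult.assoc)
    qed
  next
    case (2 f i)
    \<comment> \<open>A map that annihilates a coordinate is singular, so the premise on the
      determinant fails.\<close>
    then have "\<not> inj f"
      by (metis (full_types) linear_injective_imp_surjective one_neq_zero surjE vec_component)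
    then show ?case using det_nz_iff_inj[OF 2(1)] by blast
  next
    case (3 c)
    let ?h = "\<lambda>x :: real^'n. \<chi> i. c i * x $ i"
    have det: "det (matrix ?h) = (\<Prod>i\<in>UNIV. c i)"
      by (simp add: axis_def matrix_def det_diagonal)
    show ?case
    proof (intro impI allI)
      fix g :: "real^'n \<Rightarrow> ennreal"
      assume nz: "det (matrix ?h) \<noteq> 0" and g[measurable]: "g \<in> borel_measurable borel"
      then have c: "c i \<noteq> 0" for i using det by (auto simp: prod_zero_iff)
      define cc where "cc b = c (THE i. b = axis i (1::real))" for b :: "real^'n"
      have cc: "cc (axis i 1) = c i" for i
      proof -
        have "(THE j. axis i (1::real) = axis j 1) = i" by (rule the_equality) (auto simp: axis_eq_axis)
        then show ?thesis by (simp add: cc_def)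
      qed
      have T: "0 + (\<Sum>j\<in>Basis. (cc j * (x \<bullet> j)) *\<^sub>R j) = ?h x" for x
        unfolding vec_eq_iff vec_lambda_beta add_0 sum_Basis_vec_component by (simp add: cc inner_axis)
      have [measurable]: "?h \<in> borel_measurable borel"
        unfolding T[symmetric] by measurable
      have "lborel = density (distr lborel borel ?h) (\<lambda>_. ennreal (\<Prod>j\<in>Basis. \<bar>cc j\<bar>))"
        unfolding T[symmetric] by (rule lborel_affine_euclidean) (auto simp: Basis_vec_def cc c)
      also have "(\<Prod>j\<in>(Basis :: (real^'n) set). \<bar>cc j\<bar>) = \<bar>det (matrix ?h)\<bar>"
        unfolding det prod_Basis_vec cc abs_prod ..
      finally have "(\<integral>\<^sup>+x. g x \<partial>lborel) =
          (\<integral>\<^sup>+x. g x \<partial>density (distr lborel borel ?h) (\<lambda>_. ennreal \<bar>det (matrix ?h)\<bar>))"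
        by simp
      then show "(\<integral>\<^sup>+x. g x \<partial>lborel) = ennreal \<bar>det (matrix ?h)\<bar> * (\<integral>\<^sup>+x. g (?h x) \<partial>lborel)"
        by (simp add: nn_integral_density nn_integral_distr nn_integral_cmult)
    qed
  next
    case (4 m n)
    let ?t = "Transposition.transpose m n"
    let ?h = "\<lambda>x :: real^'n. \<chi> i. x $ ?t i"
    have "linear ?h" by (rule linearI) (simp_all add: plus_vec_def scaleR_vec_def)
    then have [measurable]: "?h \<in> borel_measurable borel"
      by (intro borel_measurable_continuous_onI linear_continuous_on)
          (simp add: linear_conv_bounded_linear)
    have "(\<chi> i j. if ?t i = j then 1 else 0) = (\<chi> i j. if j = ?t i then 1 else (0::real))"
      by (auto intro!: Cart_lambda_cong)
    then have "matrix ?h = transpose (\<chi> i j. mat 1 $ i $ ?t j)"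
      by (auto simp: matrix_eq transpose_def axis_def mat_def matrix_def)
    then have det: "\<bar>det (matrix ?h)\<bar> = 1"
      by (simp add: det_permute_columns permutes_swap_id sign_swap_id abs_mult)
    \<comment> \<open>Lebesgue measure is characterized by the volumes of boxes, and exchanging two
      coordinates only permutes the side lengths.\<close>
    have "lborel = distr lborel borel ?h"
    proof (rule lborel_eqI)
      fix l u :: "real^'n" assume le: "\<And>b. b \<in> Basis \<Longrightarrow> l \<bullet> b \<le> u \<bullet> b"
      have le': "l $ i \<le> u $ i" for i using le[of "axis i 1"] by (simp add: axis_in_Basis_iff inner_axis)
      have "?h -` box l u = box (?h l) (?h u)"
        by (auto simp: mem_box_cart) (metis transpose_involutory)+
      then have "emeasure (distr lborel borel ?h) (box l u) = emeasure lborel (box (?h l) (?h u))"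
        by (subst emeasure_distr) auto
      also have "\<dots> = ennreal (\<Prod>b\<in>Basis. (?h u - ?h l) \<bullet> b)"
        by (subst emeasure_lborel_box_eq) (auto simp: Basis_vec_def inner_axis le')
      also have "(\<Prod>b\<in>Basis. (?h u - ?h l) \<bullet> b) = (\<Prod>i\<in>UNIV. (u - l) $ ?t i)"
        unfolding prod_Basis_vec by (simp add: inner_axis)
      also have "\<dots> = (\<Prod>i\<in>UNIV. (u - l) $ i)"
        by (rule prod.reindex_bij_betw) (simp add: bij_swap_iff)
      also have "\<dots> = (\<Prod>b\<in>Basis. (u - l) \<bullet> b)"
        unfolding prod_Basis_vec by (simp add: inner_axis)
      finally show "emeasure (distr lborel borel ?h) (box l u) = ennreal (\<Prod>b\<in>Basis. (u - l) \<bullet> b)" .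
    qed simp
    then have "(\<integral>\<^sup>+x. g x \<partial>lborel) = (\<integral>\<^sup>+x. g x \<partial>distr lborel borel ?h)" for g :: "real^'n \<Rightarrow> ennreal"
      by (rule arg_cong)
    moreover have "(\<integral>\<^sup>+x. g x \<partial>distr lborel borel ?h) = (\<integral>\<^sup>+x. g (?h x) \<partial>lborel)"
      if "g \<in> borel_measurable borel" for g :: "real^'n \<Rightarrow> ennreal"
      using that by (subst nn_integral_distr) auto
    ultimately show ?case unfolding det by (metis ennreal_1 mult_1)
  next
    case (5 m n)
    let ?h = "\<lambda>x :: real^'n. \<chi> i. if i = m then x $ m + x $ n else x $ i"
    have "matrix ?h = (\<chi> k. if k = m then row m (mat 1) + 1 *s row n (mat 1) else row k (mat 1))"
      by (auto simp: matrix_def vec_eq_iff row_def mat_def axis_def)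
    then have "det (matrix ?h) = 1"
      using det_row_operation[OF 5, of "mat 1" "1::real"] by simp
    then show ?case using nn_integral_shear[OF _ 5] by simp
  qed
  then have "g \<in> borel_measurable borel \<longrightarrow>
    (\<integral>\<^sup>+x. g x \<partial>lborel) = ennreal \<bar>det (matrix f)\<bar> * (\<integral>\<^sup>+x. g (f x) \<partial>lborel)"
    using assms(2) by (rule spec[OF mp])
  then show ?thesis using assms(3) by (rule mp)
qed

text \<open>Gram-Schmidt orthonormalization for the inner product given by \<open>Q\<close>; the
  columns of \<open>P\<close> are the resulting basis. As long as fewer than \<open>CARD('n)\<close>
  vectors have been found, some \<open>y\<close> lies outside their span, and its residual
  \<open>z\<close> is nonzero and hence of positive length.\<close>

lemma posdef_congruence:
  fixes Q :: "real^'n^'n"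
  assumes sym: "transpose Q = Q" and pos: "\<And>x. x \<noteq> 0 \<Longrightarrow> x \<bullet> (Q *v x) > 0"
  obtains P :: "real^'n^'n" where "transpose P ** Q ** P = mat 1"
proof -
  have symQ: "x \<bullet> (Q *v y) = y \<bullet> (Q *v x)" for x y
    by (metis sym dot_lmul_matrix inner_commute transpose_matrix_vector)
  have "m \<le> CARD('n) \<Longrightarrow> \<exists>B. finite B \<and> card B = m \<and> (\<forall>u\<in>B. \<forall>v\<in>B. u \<bullet> (Q *v v) = (if u = v then 1 else 0))"
      for m
  proof (induction m)
    case 0
    show ?case by (rule exI[of _ "{}"]) auto
  next
    case (Suc m)
    then obtain B where B: "finite B" "card B = m" "\<And>u v. u \<in> B \<Longrightarrow> v \<in> B \<Longrightarrow>
        u \<bullet> (Q *v v) = (if u = v then 1 else 0)"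
      by auto
    have "span B \<noteq> UNIV"
    proof
      assume "span B = UNIV"
      then have "dim (UNIV :: (real^'n) set) \<le> card B" using B(1) by (metis dim_le_card order_refl)
      then show False using Suc.prems B(2) by simp
    qed
    then obtain y where y: "y \<notin> span B" by auto
    define z where "z = y - (\<Sum>b\<in>B. (b \<bullet> (Q *v y)) *\<^sub>R b)"
    have "(\<Sum>b\<in>B. (b \<bullet> (Q *v y)) *\<^sub>R b) \<in> span B" by (intro span_sum span_scale span_base)
    then have "z \<noteq> 0" using y by (auto simp: z_def)
    define q where "q = z \<bullet> (Q *v z)"
    have q: "q > 0" unfolding q_def using \<open>z \<noteq> 0\<close> by (rule pos)
    have zb: "b \<bullet> (Q *v z) = 0" if b: "b \<in> B" for b
    proof -
      have "z \<bullet> (Q *v b) = y \<bullet> (Q *v b) - (\<Sum>b'\<in>B. (b' \<bullet> (Q *v y)) * (b' \<bullet> (Q *v b)))"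
        by (simp add: z_def inner_diff_left inner_sum_left)
      also have "(\<Sum>b'\<in>B. (b' \<bullet> (Q *v y)) * (b' \<bullet> (Q *v b))) =
          (\<Sum>b'\<in>B. if b' = b then b \<bullet> (Q *v y) else 0)"
        using b B(3) by (intro sum.cong) auto
      also have "\<dots> = b \<bullet> (Q *v y)" using b B(1) by simp
      finally show ?thesis using symQ[of y b] symQ[of b z] by simp
    qed
    define u where "u = (1 / sqrt q) *\<^sub>R z"
    have Qu: "Q *v u = (1 / sqrt q) *\<^sub>R (Q *v z)" by (simp add: u_def matrix_vector_mult_scaleR)
    have uu: "u \<bullet> (Q *v u) = 1"
      using q unfolding Qu by (simp add: u_def q_def[symmetric] field_simps)
    have ub: "b \<bullet> (Q *v u) = 0" if "b \<in> B" for b unfolding Qu using zb[OF that] by simp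
    have bu: "u \<bullet> (Q *v b) = 0" if "b \<in> B" for b using ub[OF that] symQ[of u b] by simp
    have "u \<notin> B" using uu ub by auto
    show ?case
    proof (intro exI[of _ "insert u B"] conjI ballI)
      show "card (insert u B) = Suc m" using B \<open>u \<notin> B\<close> by simp
      fix v w assume "v \<in> insert u B" "w \<in> insert u B"
      then show "v \<bullet> (Q *v w) = (if v = w then 1 else 0)"
        using uu ub bu B(3) \<open>u \<notin> B\<close> by auto
    qed (use B in auto)
  qed
  then obtain B where B: "finite B" "card B = CARD('n)" "\<forall>u\<in>B. \<forall>v\<in>B. u \<bullet> (Q *v v) =
      (if u = v then 1 else 0)"
    by blast
  then obtain f where f: "bij_betw f (UNIV :: 'n set) B"
    using finite_same_card_bij[of "UNIV :: 'n set" B] by auto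
  define P :: "real^'n^'n" where "P = (\<chi> i j. f j $ i)"
  have "(transpose P ** Q ** P) $ i $ j = mat 1 $ i $ j" for i j
  proof -
    have "(transpose P ** Q ** P) $ i $ j = (\<Sum>k\<in>UNIV. (\<Sum>l\<in>UNIV. f i $ l * Q $ l $ k) * f j $ k)"
      by (simp add: matrix_matrix_mult_def transpose_def P_def)
    also have "\<dots> = (\<Sum>l\<in>UNIV. \<Sum>k\<in>UNIV. f i $ l * (Q $ l $ k * f j $ k))"
      unfolding sum_distrib_right by (subst sum.swap) (simp add: mult_ac)
    also have "\<dots> = f i \<bullet> (Q *v f j)"
      by (simp add: inner_vec_def matrix_vector_mult_def sum_distrib_left)
    also have "\<dots> = (if i = j then 1 else 0)"
      using B(3) f by (auto simp: bij_betw_def inj_on_def)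
    finally show ?thesis by (simp add: mat_def)
  qed
  then show thesis by (intro that[of P]) (simp add: vec_eq_iff)
qed

lemma std_gauss_eq: "exp (- (x \<bullet> x) / 2) = sqrt (2 * pi) ^ CARD('n) * std_gauss x" for x :: "real^'n"
proof -
  have "exp (- (x \<bullet> x) / 2) = (\<Prod>i\<in>UNIV. exp (- (x $ i)\<^sup>2 / 2))"
    by (simp add: inner_vec_def exp_sum[symmetric] sum_divide_distrib[symmetric] sum_negf
        power2_eq_square)
  also have "\<dots> = (\<Prod>i\<in>(UNIV :: 'n set). sqrt (2 * pi) * std_normal_density (x $ i))"
    by (intro prod.cong) (simp_all add: std_normal_density_def)
  finally show ?thesis by (simp add: prod.distrib std_gauss_def)
qed

lemma integral_exp_norm_square:
  "integrable lborel (\<lambda>x :: real^'n. exp (- (x \<bullet> x) / 2))"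
  "(\<integral>x. exp (- (x \<bullet> x) / 2) \<partial>(lborel :: (real^'n) measure)) = sqrt (2 * pi) ^ CARD('n)"
proof -
  have eq: "exp (- (x \<bullet> x) / 2) = sqrt (2 * pi) ^ CARD('n) * (std_gauss x * mpow x (\<lambda>_. 0))"
      for x :: "real^'n"
    unfolding std_gauss_eq by (simp add: mpow_def)
  show "integrable lborel (\<lambda>x :: real^'n. exp (- (x \<bullet> x) / 2))"
    unfolding eq by (intro integrable_mult_right integral_gauss_mpow)
  show "(\<integral>x. exp (- (x \<bullet> x) / 2) \<partial>(lborel :: (real^'n) measure)) = sqrt (2 * pi) ^ CARD('n)"
    unfolding eq by (simp add: integral_gauss_mpow gauss_moment_def)
qed

text \<open>The substitution by \<open>P\<close> turns the form into the squared norm, and the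
  determinant of the congruence gives |det P| = 1 / sqrt (det Q). The nonnegative integral is
  evaluated before the real one, so that its finite value also proves integrability.\<close>

lemma integral_exp_quadratic_form:
  fixes Q :: "real^'n^'n"
  assumes sym: "transpose Q = Q" and pos: "\<And>x. x \<noteq> 0 \<Longrightarrow> x \<bullet> (Q *v x) > 0"
  shows "det Q > 0" "integrable lborel (\<lambda>x. exp (- (x \<bullet> (Q *v x)) / 2))"
    "(\<integral>x. exp (- (x \<bullet> (Q *v x)) / 2) \<partial>lborel) = sqrt (2 * pi) ^ CARD('n) / sqrt (det Q)"
proof -
  obtain P :: "real^'n^'n" where P: "transpose P ** Q ** P = mat 1" using posdef_congruence[OF sym pos]
      by blast
  have "det P * det Q * det P = 1"
    using arg_cong[OF P, of det] by (simp add: det_mul)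
  then have detQ: "det Q * (det P)\<^sup>2 = 1" by (simp add: power2_eq_square mult_ac)
  then have dP: "det P \<noteq> 0" by auto
  have "det Q = 1 / (det P)\<^sup>2" using detQ dP by (simp add: field_simps)
  then show "det Q > 0" using dP by simp
  then have sq: "sqrt (det Q) * \<bar>det P\<bar> = 1"
    using arg_cong[OF detQ, of sqrt] by (simp add: real_sqrt_mult)
  let ?f = "\<lambda>x. exp (- (x \<bullet> (Q *v x)) / 2)"
  have "continuous_on UNIV ?f" by (intro continuous_intros) auto
  then have meas: "?f \<in> borel_measurable borel" by (rule borel_measurable_continuous_onI)
  have quad: "(P *v x) \<bullet> (Q *v (P *v x)) = x \<bullet> x" for x
  proof -
    have "(P *v x) \<bullet> (Q *v (P *v x)) = x \<bullet> ((transpose P ** Q ** P) *v x)"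
      unfolding matrix_vector_mul_assoc[symmetric] by (metis dot_lmul_matrix vector_transpose_matrix)
    then show ?thesis by (simp add: P)
  qed
  have "(\<integral>\<^sup>+x. ennreal (?f x) \<partial>lborel) = ennreal \<bar>det P\<bar> * (\<integral>\<^sup>+x. ennreal (?f (P *v x)) \<partial>lborel)"
    using nn_integral_linear_vec[of "(*v) P" "\<lambda>x. ennreal (?f x)"] dP meas by simp
  also have "(\<integral>\<^sup>+x. ennreal (?f (P *v x)) \<partial>lborel) = ennreal (sqrt (2 * pi) ^ CARD('n))"
    unfolding quad using integral_exp_norm_square[where 'n = 'n] by (subst nn_integral_eq_integral) auto
  finally have nn: "(\<integral>\<^sup>+x. ennreal (?f x) \<partial>lborel) = ennreal (\<bar>det P\<bar> * sqrt (2 * pi) ^ CARD('n))"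
    by (simp add: ennreal_mult)
  show "integrable lborel ?f"
    using nn meas by (intro integrableI_nonneg) auto
  have "(\<integral>x. ?f x \<partial>lborel) = \<bar>det P\<bar> * sqrt (2 * pi) ^ CARD('n)"
    using nn meas by (subst integral_eq_nn_integral) auto
  also have "\<bar>det P\<bar> = 1 / sqrt (det Q)"
    using sq \<open>det Q > 0\<close> by (simp add: field_simps)
  finally show "(\<integral>x. ?f x \<partial>lborel) = sqrt (2 * pi) ^ CARD('n) / sqrt (det Q)" by simp
qed

section \<open>Laplace's method\<close>

text \<open>The hypothesis forces \<open>u n\<close> to tend to 1, and the logarithm lies between (u
  - 1) / u and u - 1; both bounds, multiplied by \<open>n\<close>, tend to \<open>c\<close>.\<close>

lemma tendsto_power_exp:
  fixes u :: "nat \<Rightarrow> real"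
  assumes "(\<lambda>n. real n * (u n - 1)) \<longlonglongrightarrow> c"
  shows "(\<lambda>n. u n ^ n) \<longlonglongrightarrow> exp c"
proof -
  have "(\<lambda>n. real n * (u n - 1) * (1 / real n)) \<longlonglongrightarrow> c * 0"
    by (intro tendsto_mult assms lim_1_over_n)
  moreover have "\<forall>\<^sub>F n in sequentially. real n * (u n - 1) * (1 / real n) = u n - 1"
    using eventually_gt_at_top[of 0] by eventually_elim simp
  ultimately have "(\<lambda>n. u n - 1) \<longlonglongrightarrow> 0" by (simp add: tendsto_cong)
  then have u: "u \<longlonglongrightarrow> 1" by (simp add: LIM_zero_iff)
  then have pos: "\<forall>\<^sub>F n in sequentially. u n > 0" by (rule order_tendstoD) simp
  have "(\<lambda>n. real n * ln (u n)) \<longlonglongrightarrow> c"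
  proof (rule tendsto_sandwich)
    show "\<forall>\<^sub>F n in sequentially. real n * (u n - 1) / u n \<le> real n * ln (u n)"
      using pos
    proof eventually_elim
      case (elim n)
      have "ln (1 / u n) \<le> 1 / u n - 1" using elim by (intro ln_le_minus_one) simp
      then have "(u n - 1) / u n \<le> ln (u n)" using elim by (simp add: ln_div field_simps)
      then have "real n * ((u n - 1) / u n) \<le> real n * ln (u n)" by (rule mult_left_mono) simp
      then show ?case by simp
    qed
    show "\<forall>\<^sub>F n in sequentially. real n * ln (u n) \<le> real n * (u n - 1)"
      using pos by eventually_elim (intro mult_left_mono ln_le_minus_one, auto)
    show "(\<lambda>n. real n * (u n - 1) / u n) \<longlonglongrightarrow> c"
      using tendsto_divide[OF assms u] by simp
  qed fact
  then have "(\<lambda>n. exp (real n * ln (u n))) \<longlonglongrightarrow> exp c" by (rule tendsto_exp)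
  moreover have "\<forall>\<^sub>F n in sequentially. exp (real n * ln (u n)) = u n ^ n"
    using pos by eventually_elim (simp add: exp_of_nat_mult)
  ultimately show ?thesis by (simp add: tendsto_cong)
qed

text \<open>The one-variable formula along the segment from y to y + h. The Lagrange form of the
  remainder suits the later use, where only the continuity of \<open>F\<close> at the maximum is
  available.\<close>

lemma taylor2_vec:
  fixes \<psi> :: "real^'n \<Rightarrow> real" and G :: "real^'n \<Rightarrow> real^'n" and F :: "real^'n \<Rightarrow> real^'n^'n"
  assumes d1: "\<And>y. (\<psi> has_derivative (\<lambda>h. G y \<bullet> h)) (at y)"
    and d2: "\<And>y. (G has_derivative (\<lambda>h. F y *v h)) (at y)"
  shows "\<exists>s\<in>{0..1}. \<psi> (y + h) = \<psi> y + G y \<bullet> h + (h \<bullet> (F (y + s *\<^sub>R h) *v h)) / 2"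
proof -
  define df where "df m t = (if m = 0 then \<psi> (y + t *\<^sub>R h) else if m = 1 then G (y + t *\<^sub>R h) \<bullet> h
     else h \<bullet> (F (y + t *\<^sub>R h) *v h))" for m :: nat and t :: real
  have line: "((\<lambda>t. y + t *\<^sub>R h) has_derivative (\<lambda>t. t *\<^sub>R h)) (at t)" for t
    by (auto intro!: derivative_eq_intros)
  have "((\<lambda>t. \<psi> (y + t *\<^sub>R h)) has_derivative (\<lambda>k. G (y + t *\<^sub>R h) \<bullet> (k *\<^sub>R h))) (at t)" for t
    by (rule has_derivative_compose[OF line d1])
  then have 1: "((\<lambda>t. \<psi> (y + t *\<^sub>R h)) has_field_derivative (G (y + t *\<^sub>R h) \<bullet> h)) (at t)" for t
    by (simp add: has_field_derivative_def mult_commute_abs)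
  have "((\<lambda>t. G (y + t *\<^sub>R h)) has_derivative (\<lambda>k. F (y + t *\<^sub>R h) *v (k *\<^sub>R h))) (at t)" for t
    by (rule has_derivative_compose[OF line d2])
  then have "((\<lambda>t. G (y + t *\<^sub>R h) \<bullet> h) has_derivative (\<lambda>k. (F (y + t *\<^sub>R h) *v (k *\<^sub>R h)) \<bullet> h)) (at t)"
      for t
    by (rule has_derivative_inner_left)
  then have 2: "((\<lambda>t. G (y + t *\<^sub>R h) \<bullet> h) has_field_derivative (h \<bullet> (F (y + t *\<^sub>R h) *v h))) (at t)"
      for t
    by (simp add: has_field_derivative_def matrix_vector_mult_scaleR inner_commute mult_commute_abs)
  have "\<exists>t. 0 < t \<and> t \<le> 1 \<and> df 0 1 = (\<Sum>m<2. df m 0 / fact m * 1 ^ m) + df 2 t / fact 2 * 1 ^ 2"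
  proof (rule Maclaurin2)
    show "\<forall>m t. m < 2 \<and> 0 \<le> t \<and> t \<le> 1 \<longrightarrow> (df m has_real_derivative df (Suc m) t) (at t)"
    proof (intro allI impI)
      fix m t assume "m < (2::nat) \<and> 0 \<le> t \<and> t \<le> (1::real)"
      then have "m = 0 \<or> m = 1" by auto
      then show "(df m has_real_derivative df (Suc m) t) (at t)"
        using 1[of t] 2[of t] by (auto simp: df_def[abs_def])
    qed
  qed auto
  then obtain t where "0 < t" "t \<le> 1" "df 0 1 = df 0 0 + df 1 0 + df 2 t / 2"
    by (auto simp: numeral_2_eq_2)
  then show ?thesis by (intro bexI[of _ t]) (auto simp: df_def)
qed

text \<open>A crude matrix norm: it dominates the quadratic form on unit vectors and visibly tends
  to 0 with the entries.\<close>

definition entry_sum :: "real^'n^'n \<Rightarrow> real"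
  where "entry_sum A = (\<Sum>i\<in>UNIV. \<Sum>j\<in>UNIV. \<bar>A $ i $ j\<bar>)"

lemma quadratic_form_bound: "\<bar>h \<bullet> (A *v h)\<bar> \<le> entry_sum A * (h \<bullet> h)"
proof -
  have "\<bar>h \<bullet> (A *v h)\<bar> = \<bar>\<Sum>i\<in>UNIV. \<Sum>j\<in>UNIV. h $ i * (A $ i $ j * h $ j)\<bar>"
    by (simp add: inner_vec_def matrix_vector_mult_def sum_distrib_left)
  also have "\<dots> \<le> (\<Sum>i\<in>UNIV. \<Sum>j\<in>UNIV. \<bar>h $ i * (A $ i $ j * h $ j)\<bar>)"
    by (rule order_trans[OF sum_abs]) (intro sum_mono sum_abs)
  also have "\<dots> \<le> (\<Sum>i\<in>UNIV. \<Sum>j\<in>UNIV. \<bar>A $ i $ j\<bar> * (h \<bullet> h))"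
  proof (intro sum_mono)
    fix i j
    have "\<bar>h $ i\<bar> * \<bar>h $ j\<bar> \<le> norm h * norm h"
      by (intro mult_mono component_le_norm_cart) auto
    then have "\<bar>A $ i $ j\<bar> * (\<bar>h $ i\<bar> * \<bar>h $ j\<bar>) \<le> \<bar>A $ i $ j\<bar> * (h \<bullet> h)"
      by (intro mult_left_mono) (auto simp: dot_square_norm power2_eq_square)
    then show "\<bar>h $ i * (A $ i $ j * h $ j)\<bar> \<le> \<bar>A $ i $ j\<bar> * (h \<bullet> h)"
      by (simp add: abs_mult mult_ac)
  qed
  finally show ?thesis by (simp add: entry_sum_def sum_distrib_right)
qed

text \<open>A vector x on which a semidefinite form vanishes lies in the kernel: moving from x along
  Q x changes the form to first order by twice the squared norm of Q x, so a small negative step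
  would make it negative.\<close>

lemma semidef_nonsingular_posdef:
  fixes Q :: "real^'n^'n"
  assumes sym: "transpose Q = Q" and nonneg: "\<And>x. x \<bullet> (Q *v x) \<ge> 0" and det: "det Q \<noteq> 0" and "x \<noteq> 0"
  shows "x \<bullet> (Q *v x) > 0"
proof (rule ccontr)
  assume "\<not> ?thesis"
  then have x0: "x \<bullet> (Q *v x) = 0" using nonneg[of x] by simp
  have symQ: "x \<bullet> (Q *v y) = y \<bullet> (Q *v x)" for x y
    by (metis sym dot_lmul_matrix inner_commute transpose_matrix_vector)
  define y where "y = Q *v x"
  define b where "b = y \<bullet> (Q *v y)"
  have b: "b \<ge> 0" unfolding b_def by (rule nonneg)
  have expand: "0 \<le> t * t * b + 2 * t * (y \<bullet> y)" for t
  proof -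
    have "0 \<le> (x + t *\<^sub>R y) \<bullet> (Q *v (x + t *\<^sub>R y))" by (rule nonneg)
    also have "\<dots> = x \<bullet> (Q *v x) + t * (x \<bullet> (Q *v y)) + t * (y \<bullet> (Q *v x)) + t * t * b"
      by (simp add: matrix_vector_right_distrib matrix_vector_mult_scaleR inner_add_left inner_add_right
          b_def algebra_simps)
    also have "x \<bullet> (Q *v y) = y \<bullet> y" unfolding symQ[of x y] by (simp add: y_def)
    also have "y \<bullet> (Q *v x) = y \<bullet> y" by (simp add: y_def)
    finally show ?thesis using x0 by simp
  qed
  have "y \<bullet> y = 0"
  proof (rule ccontr)
    assume "y \<bullet> y \<noteq> 0"
    then have yy: "y \<bullet> y > 0" using inner_ge_zero[of y] by linarith
    \<comment> \<open>Adding 1 to \<open>b\<close> avoids a division by zero and keeps the quadratic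
      term below \<open>y \<bullet> y\<close> in size, that is, below half of the linear
      one.\<close>
    define t where "t = - (y \<bullet> y) / (b + 1)"
    have "t * t * b + 2 * t * (y \<bullet> y) = t * (t * b + 2 * (y \<bullet> y))" by (simp add: algebra_simps)
    moreover have "t < 0" using yy b by (simp add: t_def field_simps)
    moreover have "t * b + 2 * (y \<bullet> y) > 0"
    proof -
      have "t * b = - ((y \<bullet> y) * (b / (b + 1)))" by (simp add: t_def)
      moreover have "(y \<bullet> y) * (b / (b + 1)) \<le> (y \<bullet> y) * 1" using yy b by (intro mult_left_mono) auto
      ultimately show ?thesis using yy by linarith
    qed
    ultimately have "t * t * b + 2 * t * (y \<bullet> y) < 0" by (simp add: mult_neg_pos)
    then show False using expand[of t] by simp
  qed
  then have "Q *v x = Q *v 0" by (simp add: y_def)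
  moreover have "inj ((*v) Q)"
    using det det_nz_iff_inj[of "(*v) Q"] by simp
  ultimately have "x = 0" by (metis injD)
  then show False using \<open>x \<noteq> 0\<close> by simp
qed

lemma posdef_lower_bound:
  fixes Q :: "real^'n^'n"
  assumes "\<And>x. x \<noteq> 0 \<Longrightarrow> x \<bullet> (Q *v x) > 0"
  obtains a where "a > 0" "\<And>x. a * (x \<bullet> x) \<le> x \<bullet> (Q *v x)"
proof -
  let ?f = "\<lambda>x. x \<bullet> (Q *v x)"
  have "continuous_on (sphere 0 1) ?f" by (intro continuous_intros)
  moreover have "(axis undefined 1 :: real^'n) \<in> sphere 0 1" by (simp add: norm_axis_1)
  ultimately obtain u where u: "u \<in> sphere 0 1" "\<And>x. x \<in> sphere 0 1 \<Longrightarrow> ?f u \<le> ?f x"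
    using continuous_attains_inf[OF compact_sphere, of 0 1 ?f] by blast
  have "u \<noteq> 0" using u(1) by auto
  then have "?f u > 0" by (rule assms)
  moreover have "?f u * (x \<bullet> x) \<le> ?f x" for x
  proof (cases "x = 0")
    case False
    have "?f u \<le> ?f ((1 / norm x) *\<^sub>R x)" using False by (intro u(2)) simp
    also have "\<dots> = ?f x / (norm x)\<^sup>2"
      by (simp add: matrix_vector_mult_scaleR power2_eq_square)
    finally show ?thesis using False by (simp add: field_simps dot_square_norm)
  qed simp
  ultimately show thesis by (rule that)
qed

text \<open>At a maximum the rescaled increments are nonpositive, so their limit shows that -F is
  semidefinite; nonsingularity makes it definite. By continuity of \<open>F\<close> this persists
  nearby and gives a Gaussian upper bound, which later serves for dominated convergence and for
  isolating the maxima.\<close>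

lemma nondegenerate_maximum:
  fixes \<psi> :: "real^'n \<Rightarrow> real" and G :: "real^'n \<Rightarrow> real^'n" and F :: "real^'n \<Rightarrow> real^'n^'n"
  assumes d1: "\<And>y. (\<psi> has_derivative (\<lambda>h. G y \<bullet> h)) (at y)"
    and d2: "\<And>y. (G has_derivative (\<lambda>h. F y *v h)) (at y)"
    and cont: "isCont F y0"
    and sym: "transpose (F y0) = F y0" and det: "det (F y0) \<noteq> 0"
    and max: "\<And>y. \<psi> y \<le> 1" and one: "\<psi> y0 = 1"
  shows "\<And>x. x \<noteq> 0 \<Longrightarrow> x \<bullet> ((- F y0) *v x) > 0"
    and "\<exists>a>0. \<exists>\<epsilon>>0. \<forall>h. norm h < \<epsilon> \<longrightarrow> 0 \<le> \<psi> (y0 + h) \<and> \<psi> (y0 + h) \<le> exp (- a * (h \<bullet> h))"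
    and "\<And>z. (\<lambda>n. real n * (\<psi> (y0 + (1 / sqrt (real n)) *\<^sub>R z) - 1)) \<longlonglongrightarrow> - (z \<bullet> ((- F y0) *v z)) / 2"
proof -
  have "(\<lambda>h. G y0 \<bullet> h) = (\<lambda>v. 0)"
    by (rule differential_zero_maxmin[OF _ open_UNIV d1]) (use max one in auto)
  then have G0: "G y0 \<bullet> h = 0" for h by metis
  have neg: "(- F y0) *v x = - (F y0 *v x)" for x
    by (simp add: matrix_vector_mult_def vec_eq_iff sum_negf)
  have taylor: "\<exists>s\<in>{0..1}. \<psi> (y0 + h) = 1 + (h \<bullet> (F (y0 + s *\<^sub>R h) *v h)) / 2" for h
    using taylor2_vec[OF d1 d2, where y = y0 and h = h] G0 one by simp
  show lim: "(\<lambda>n. real n * (\<psi> (y0 + (1 / sqrt (real n)) *\<^sub>R z) - 1)) \<longlonglongrightarrow> - (z \<bullet> ((- F y0) *v z)) / 2" for z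
  proof -
    let ?r = "\<lambda>n. 1 / sqrt (real n)"
    obtain s where s: "\<And>n. s n \<in> {0..1}"
      "\<And>n. \<psi> (y0 + ?r n *\<^sub>R z) = 1 + ((?r n *\<^sub>R z) \<bullet> (F (y0 + s n *\<^sub>R ?r n *\<^sub>R z) *v (?r n *\<^sub>R z))) / 2"
      using taylor[of "?r n *\<^sub>R z" for n] by metis
    have r: "?r \<longlonglongrightarrow> 0" by real_asymp
    have sr: "(\<lambda>n. s n * ?r n) \<longlonglongrightarrow> 0"
    proof (rule Lim_null_comparison[OF _ r], rule always_eventually, rule allI)
      fix n
      have "\<bar>s n\<bar> * ?r n \<le> 1 * ?r n" using s(1)[of n] by (intro mult_right_mono) auto
      then show "norm (s n * ?r n) \<le> ?r n" by (simp add: abs_mult)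
    qed
    have "(\<lambda>n. y0 + (s n * ?r n) *\<^sub>R z) \<longlonglongrightarrow> y0 + 0 *\<^sub>R z"
      by (intro tendsto_intros sr)
    then have "(\<lambda>n. F (y0 + (s n * ?r n) *\<^sub>R z)) \<longlonglongrightarrow> F y0"
      using cont by (intro isCont_tendsto_compose[of y0 F]) auto
    then have "(\<lambda>n. (\<Sum>i\<in>UNIV. z $ i * (\<Sum>j\<in>UNIV. F (y0 + (s n * ?r n) *\<^sub>R z) $ i $ j * z $ j)) / 2)
        \<longlonglongrightarrow> (\<Sum>i\<in>UNIV. z $ i * (\<Sum>j\<in>UNIV. F y0 $ i $ j * z $ j)) / 2"
      by (intro tendsto_intros) auto
    then have "(\<lambda>n. (z \<bullet> (F (y0 + (s n * ?r n) *\<^sub>R z) *v z)) / 2) \<longlonglongrightarrow> (z \<bullet> (F y0 *v z)) / 2"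
      by (simp add: inner_vec_def matrix_vector_mult_def)
    moreover have "\<forall>\<^sub>F n in sequentially. (z \<bullet> (F (y0 + (s n * ?r n) *\<^sub>R z) *v z)) / 2 =
       real n * (\<psi> (y0 + ?r n *\<^sub>R z) - 1)"
      using eventually_gt_at_top[of 0]
    proof eventually_elim
      case (elim n)
      then show ?case unfolding s(2)[of n] by (simp add: matrix_vector_mult_scaleR)
    qed
    ultimately have "(\<lambda>n. real n * (\<psi> (y0 + ?r n *\<^sub>R z) - 1)) \<longlonglongrightarrow> (z \<bullet> (F y0 *v z)) / 2"
      by (rule Lim_transform_eventually)
    then show ?thesis by (simp add: neg)
  qed
  have nonneg: "x \<bullet> ((- F y0) *v x) \<ge> 0" for x
  proof -
    have "- (x \<bullet> ((- F y0) *v x)) / 2 \<le> 0"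
      by (rule LIMSEQ_le_const2[OF lim]) (use max in \<open>auto simp: mult_nonneg_nonpos\<close>)
    then show ?thesis by simp
  qed
  have "transpose (- F y0) = - F y0"
    using sym by (simp add: transpose_def vec_eq_iff)
  moreover have "det (- F y0) \<noteq> 0"
  proof -
    have "inj ((*v) (F y0))" using det det_nz_iff_inj[of "(*v) (F y0)"] by simp
    then have "inj ((*v) (- F y0))" by (simp add: inj_def neg)
    then show ?thesis using det_nz_iff_inj[of "(*v) (- F y0)"] by simp
  qed
  ultimately show pos: "x \<bullet> ((- F y0) *v x) > 0" if "x \<noteq> 0" for x
    using nonneg that by (intro semidef_nonsingular_posdef)
  obtain b where b: "b > 0" "\<And>x. b * (x \<bullet> x) \<le> x \<bullet> ((- F y0) *v x)"
    using posdef_lower_bound[OF pos] by blast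
  have "((\<lambda>y. entry_sum (F y - F y0)) \<longlongrightarrow> entry_sum (F y0 - F y0)) (at y0)"
    unfolding entry_sum_def using cont by (intro tendsto_intros) (auto simp: isCont_def)
  then have "((\<lambda>y. entry_sum (F y - F y0)) \<longlongrightarrow> 0) (at y0)" by (simp add: entry_sum_def)
  \<comment> \<open>Half of the lower bound \<open>b\<close> is spent on the variation of
    \<open>F\<close>. The other half survives, and the factor 1/2 of Taylor's formula turns it into
    b / 4.\<close>
  then have "\<forall>\<^sub>F y in at y0. entry_sum (F y - F y0) < b / 2"
    by (rule order_tendstoD) (use b in simp)
  then obtain e1 where e1: "e1 > 0" "\<And>y. y \<noteq> y0 \<Longrightarrow> dist y y0 < e1 \<Longrightarrow> entry_sum (F y - F y0) < b / 2"
    unfolding eventually_at by auto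
  have e1': "entry_sum (F y - F y0) < b / 2" if "dist y y0 < e1" for y
    using e1(2)[of y] that b by (cases "y = y0") (auto simp: entry_sum_def)
  have "isCont \<psi> y0" using d1 by (rule has_derivative_continuous)
  \<comment> \<open>Besides the upper bound, nonnegativity near the maximum is required so that
    powers can be estimated monotonically.\<close>
  then have "\<forall>\<^sub>F y in at y0. \<psi> y > 0"
    unfolding isCont_def by (rule order_tendstoD) (simp add: one)
  then obtain e2 where e2: "e2 > 0" "\<And>y. y \<noteq> y0 \<Longrightarrow> dist y y0 < e2 \<Longrightarrow> \<psi> y > 0"
    unfolding eventually_at by auto
  have "0 \<le> \<psi> (y0 + h) \<and> \<psi> (y0 + h) \<le> exp (- (b / 4) * (h \<bullet> h))" if h: "norm h < min e1 e2" for h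
  proof
    show "0 \<le> \<psi> (y0 + h)"
      using e2(2)[of "y0 + h"] h one by (cases "h = 0") (auto simp: dist_norm)
    obtain s where s: "s \<in> {0..1}" "\<psi> (y0 + h) = 1 + (h \<bullet> (F (y0 + s *\<^sub>R h) *v h)) / 2"
      using taylor by blast
    have "norm (s *\<^sub>R h) \<le> 1 * norm h" using s(1) unfolding norm_scaleR by (intro mult_right_mono) auto
    then have "dist (y0 + s *\<^sub>R h) y0 < e1" using h by (simp add: dist_norm)
    then have ent: "entry_sum (F (y0 + s *\<^sub>R h) - F y0) < b / 2" by (rule e1')
    have "h \<bullet> (F (y0 + s *\<^sub>R h) *v h) = h \<bullet> ((F (y0 + s *\<^sub>R h) - F y0) *v h) - h \<bullet> ((- F y0) *v h)"
      unfolding neg by (simp add: matrix_vector_mult_diff_rdistrib inner_diff_right)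
    also have "\<dots> \<le> entry_sum (F (y0 + s *\<^sub>R h) - F y0) * (h \<bullet> h) - b * (h \<bullet> h)"
      using quadratic_form_bound[of h "F (y0 + s *\<^sub>R h) - F y0"] b(2)[of h] by linarith
    also have "\<dots> \<le> (b / 2) * (h \<bullet> h) - b * (h \<bullet> h)"
      using ent by (intro diff_right_mono mult_right_mono) auto
    finally have "\<psi> (y0 + h) \<le> 1 + (- (b / 4) * (h \<bullet> h))" unfolding s(2) by (simp add: field_simps)
    also have "\<dots> \<le> exp (- (b / 4) * (h \<bullet> h))" by (rule exp_ge_add_one_self)
    finally show "\<psi> (y0 + h) \<le> exp (- (b / 4) * (h \<bullet> h))" .
  qed
  moreover have "b / 4 > 0" "min e1 e2 > 0" using b e1 e2 by auto
  ultimately show "\<exists>a>0. \<exists>\<epsilon>>0. \<forall>h. norm h < \<epsilon> \<longrightarrow> 0 \<le> \<psi> (y0 + h) \<and> \<psi> (y0 + h) \<le> exp (- a * (h \<bullet> h))"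
    by blast
qed

section \<open>Localization at one maximum\<close>

lemma lborel_integral_affine_vec:
  fixes f :: "real^'n \<Rightarrow> real"
  assumes "f \<in> borel_measurable borel" "c > 0"
  shows "(\<integral>x. f x \<partial>lborel) = c ^ CARD('n) * (\<integral>x. f (t + c *\<^sub>R x) \<partial>lborel)"
proof -
  have T: "(\<lambda>x. t + c *\<^sub>R x) \<in> measurable lborel borel" by measurable
  have "(\<integral>x. f x \<partial>lborel) =
      (\<integral>x. f x \<partial>density (distr lborel borel (\<lambda>x. t + c *\<^sub>R x)) (\<lambda>_. ennreal (\<bar>c\<bar> ^ DIM(real^'n))))"
    using lborel_affine[of c t] assms(2) by simp
  also have "\<dots> = (\<integral>x. \<bar>c\<bar> ^ DIM(real^'n) *\<^sub>R f x \<partial>distr lborel borel (\<lambda>x. t + c *\<^sub>R x))"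
    using assms by (intro integral_density) auto
  also have "\<dots> = (\<integral>x. \<bar>c\<bar> ^ DIM(real^'n) *\<^sub>R f (t + c *\<^sub>R x) \<partial>lborel)"
    using assms by (intro integral_distr[OF T]) auto
  finally show ?thesis using assms(2) by simp
qed

text \<open>In the scale y0 + z / sqrt n the n-th powers converge pointwise to a Gaussian. The
  domination hypothesis scales in the same way, its n-th power being exp (-a |z|^2) for every n, so
  dominated convergence applies.\<close>

lemma local_laplace:
  fixes \<psi> :: "real^'n \<Rightarrow> real" and Q :: "real^'n^'n"
  assumes meas[measurable]: "\<psi> \<in> borel_measurable borel" and "r > 0" "a > 0"
    and dom: "\<And>h. norm h < r \<Longrightarrow> 0 \<le> \<psi> (y0 + h) \<and> \<psi> (y0 + h) \<le> exp (- a * (h \<bullet> h))"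
    and lim: "\<And>z. (\<lambda>n. real n * (\<psi> (y0 + (1 / sqrt (real n)) *\<^sub>R z) - 1)) \<longlonglongrightarrow> - (z \<bullet> (Q *v z)) / 2"
  shows "(\<lambda>n. sqrt (real n) ^ CARD('n) * (\<integral>y. indicator (ball y0 r) y * \<psi> y ^ n \<partial>lborel))
     \<longlonglongrightarrow> (\<integral>z. exp (- (z \<bullet> (Q *v z)) / 2) \<partial>lborel)"
proof -
  have [measurable]: "ball y0 r \<in> sets borel" by simp
  define f where "f n z = indicator (ball y0 r) (y0 + (1 / sqrt (real n)) *\<^sub>R z) *
      \<psi> (y0 + (1 / sqrt (real n)) *\<^sub>R z) ^ n"
    for n :: nat and z :: "real^'n"
  have scale: "sqrt (real n) ^ CARD('n) * (\<integral>y. indicator (ball y0 r) y * \<psi> y ^ n \<partial>lborel) =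
      (\<integral>z. f n z \<partial>lborel)"
    if "n > 0" for n
  proof -
    have "(\<integral>y. indicator (ball y0 r) y * \<psi> y ^ n \<partial>lborel) =
        (1 / sqrt (real n)) ^ CARD('n) * (\<integral>z. f n z \<partial>lborel)"
      unfolding f_def
    proof (rule lborel_integral_affine_vec)
      show "(\<lambda>y. indicator (ball y0 r) y * \<psi> y ^ n) \<in> borel_measurable borel" by measurable
    qed (use that in simp)
    then show ?thesis using that by (simp add: field_simps)
  qed
  \<comment> \<open>The factor 2 compensates the division by 2 in the exponent of
    \<open>integral_exp_quadratic_form\<close>.\<close>
  have "transpose ((2 * a) *\<^sub>R mat 1) = (2 * a) *\<^sub>R (mat 1 :: real^'n^'n)"
    by (simp add: transpose_def vec_eq_iff mat_def)
  then have "integrable lborel (\<lambda>z :: real^'n. exp (- (z \<bullet> (((2 * a) *\<^sub>R mat 1) *v z)) / 2))"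
    by (rule integral_exp_quadratic_form) (use \<open>a > 0\<close> in \<open>simp add:
        scaleR_matrix_vector_assoc[symmetric]\<close>)
  then have w: "integrable lborel (\<lambda>z :: real^'n. exp (- a * (z \<bullet> z)))"
    by (simp add: scaleR_matrix_vector_assoc[symmetric] mult_ac)
  \<comment> \<open>The index starts at 1: as 1 / sqrt 0 is 0, the function \<open>f 0\<close> is
    constantly 1 and escapes the dominating function.\<close>
  have "(\<lambda>n. \<integral>z. f (Suc n) z \<partial>lborel) \<longlonglongrightarrow> (\<integral>z. exp (- (z \<bullet> (Q *v z)) / 2) \<partial>lborel)"
  proof (rule integral_dominated_convergence[OF _ _ w])
    show "AE z in lborel. (\<lambda>n. f (Suc n) z) \<longlonglongrightarrow> exp (- (z \<bullet> (Q *v z)) / 2)"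
    proof (rule AE_I2)
      fix z :: "real^'n"
      have "(\<lambda>n. \<psi> (y0 + (1 / sqrt (real n)) *\<^sub>R z) ^ n) \<longlonglongrightarrow> exp (- (z \<bullet> (Q *v z)) / 2)"
        by (rule tendsto_power_exp[OF lim])
      moreover have "\<forall>\<^sub>F n in sequentially. \<psi> (y0 + (1 / sqrt (real n)) *\<^sub>R z) ^ n = f n z"
      proof -
        have "(\<lambda>n. 1 / sqrt (real n) * norm z) \<longlonglongrightarrow> 0" by real_asymp
        then have "\<forall>\<^sub>F n in sequentially. 1 / sqrt (real n) * norm z < r"
          using \<open>r > 0\<close> by (rule order_tendstoD)
        then show ?thesis
          by eventually_elim (simp add: f_def dist_norm)
      qed
      ultimately have "(\<lambda>n. f n z) \<longlonglongrightarrow> exp (- (z \<bullet> (Q *v z)) / 2)"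
        by (rule Lim_transform_eventually)
      then show "(\<lambda>n. f (Suc n) z) \<longlonglongrightarrow> exp (- (z \<bullet> (Q *v z)) / 2)" by (rule LIMSEQ_Suc)
    qed
    show "AE z in lborel. norm (f (Suc n) z) \<le> exp (- a * (z \<bullet> z))" for n
    proof (rule AE_I2)
      fix z :: "real^'n"
      let ?h = "(1 / sqrt (real (Suc n))) *\<^sub>R z"
      show "norm (f (Suc n) z) \<le> exp (- a * (z \<bullet> z))"
      proof (cases "norm ?h < r")
        case True
        have "norm (f (Suc n) z) = \<psi> (y0 + ?h) ^ Suc n"
          using dom[OF True] True unfolding f_def by (simp add: dist_norm abs_mult)
        also have "\<dots> \<le> exp (- a * (?h \<bullet> ?h)) ^ Suc n"
          using dom[OF True] by (intro power_mono) auto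
        also have "\<dots> = exp (real (Suc n) * (- a * (?h \<bullet> ?h)))" by (simp only: exp_of_nat_mult)
        also have "real (Suc n) * (- a * (?h \<bullet> ?h)) = - a * (z \<bullet> z)"
          by (simp add: inner_scaleR_left inner_scaleR_right field_simps)
        finally show ?thesis .
      next
        case False
        then show ?thesis unfolding f_def by (simp add: dist_norm)
      qed
    qed
    show "(\<lambda>z. exp (- (z \<bullet> (Q *v z)) / 2)) \<in> borel_measurable lborel"
    proof -
      have "continuous_on UNIV (\<lambda>z. exp (- (z \<bullet> (Q *v z)) / 2))" by (intro continuous_intros) auto
      from borel_measurable_continuous_onI[OF this] show ?thesis by simp
    qed
    show "f (Suc n) \<in> borel_measurable lborel" for n unfolding f_def by measurable
  qed
  then have "(\<lambda>n. \<integral>z. f n z \<partial>lborel) \<longlonglongrightarrow> (\<integral>z. exp (- (z \<bullet> (Q *v z)) / 2) \<partial>lborel)"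
    by (rule LIMSEQ_imp_Suc)
  moreover have "\<forall>\<^sub>F n in sequentially. (\<integral>z. f n z \<partial>lborel) =
      sqrt (real n) ^ CARD('n) * (\<integral>y. indicator (ball y0 r) y * \<psi> y ^ n \<partial>lborel)"
    using eventually_gt_at_top[of 0] by eventually_elim (simp add: scale)
  ultimately show ?thesis by (rule Lim_transform_eventually)
qed

text \<open>The exponent is n - 1 because one factor of the integrand is reserved for integrability
  when the part away from the maxima is estimated.\<close>

lemma sqrt_power_times_geometric:
  fixes q :: real
  assumes "0 \<le> q" "q < 1"
  shows "(\<lambda>n. sqrt (real n) ^ d * q ^ (n - 1)) \<longlonglongrightarrow> 0"
proof (cases "q = 0")
  case True
  have "\<forall>\<^sub>F n in sequentially. 0 = sqrt (real n) ^ d * q ^ (n - 1)"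
    using eventually_gt_at_top[of 1] by eventually_elim (simp add: True)
  then show ?thesis by (rule Lim_transform_eventually[OF tendsto_const])
next
  case False
  then have q: "0 < q" using assms by simp
  have "(\<lambda>n. real n powr (real d / 2) * q powr (real n - 1)) \<longlonglongrightarrow> 0"
    using q \<open>q < 1\<close> by real_asymp
  moreover have "\<forall>\<^sub>F n in sequentially. real n powr (real d / 2) * q powr (real n - 1) =
      sqrt (real n) ^ d * q ^ (n - 1)"
    using eventually_gt_at_top[of 0]
  proof eventually_elim
    case (elim n)
    have "sqrt (real n) ^ d = real n powr (real d / 2)"
      using elim by (simp add: powr_half_sqrt[symmetric] powr_realpow[symmetric] powr_powr)
    moreover have "q ^ (n - 1) = q powr (real n - 1)"
      using q elim by (simp add: powr_realpow[symmetric] of_nat_diff)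
    ultimately show ?case by simp
  qed
  ultimately show ?thesis by (rule Lim_transform_eventually)
qed

text \<open>Division by the value at a point of \<open>Y\<close> turns extrema of either sign into
  maxima with value 1. These are isolated by the Gaussian bound and form a compact set because of
  the decay at infinity, so there are finitely many. The conclusion is a difference, as the signed
  main terms can cancel and need not converge.\<close>

theorem laplace_method:
  fixes \<phi> :: "real^'n \<Rightarrow> real" and G :: "real^'n \<Rightarrow> real^'n" and F :: "real^'n \<Rightarrow> real^'n^'n"
  assumes d1: "\<And>y. (\<phi> has_derivative (\<lambda>h. G y \<bullet> h)) (at y)"
    and d2: "\<And>y. (G has_derivative (\<lambda>h. F y *v h)) (at y)"
    and cont: "\<And>y. isCont F y"
    and sym: "\<And>y. transpose (F y) = F y"
    and infinity: "(\<phi> \<longlongrightarrow> 0) at_infinity"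
    and int: "integrable lborel \<phi>"
    and m: "m > 0" "\<And>y. \<bar>\<phi> y\<bar> \<le> m"
    and Y: "Y = {y. \<bar>\<phi> y\<bar> = m}"
    and det: "\<And>y. y \<in> Y \<Longrightarrow> det (F y) \<noteq> 0"
  shows "finite Y"
    and "\<And>y. y \<in> Y \<Longrightarrow> det ((- 1 / \<phi> y) *\<^sub>R F y) > 0"
    and "(\<lambda>n. sqrt (real n) ^ CARD('n) * (\<integral>y. \<phi> y ^ n \<partial>lborel) / m ^ n -
      sqrt (2 * pi) ^ CARD('n) * (\<Sum>y\<in>Y. sgn (\<phi> y) ^ n / sqrt (det ((- 1 / \<phi> y) *\<^sub>R F y)))) \<longlonglongrightarrow> 0"
proof -
  have contphi: "continuous_on UNIV \<phi>"
    using has_derivative_continuous[OF d1] by (intro continuous_at_imp_continuous_on) blast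
  then have [measurable]: "\<phi> \<in> borel_measurable borel" by (rule borel_measurable_continuous_onI)
  define Q where "Q y = (- 1 / \<phi> y) *\<^sub>R F y" for y
  define \<psi> where "\<psi> y x = \<phi> x / \<phi> y" for y x
  have nz: "\<phi> y \<noteq> 0" if "y \<in> Y" for y using that m(1) by (auto simp: Y)
  have symQ: "transpose (Q y) = Q y" for y
    using sym[of y] by (simp add: Q_def transpose_def vec_eq_iff)
  have nd: "(\<forall>x. x \<noteq> 0 \<longrightarrow> x \<bullet> (Q y *v x) > 0) \<and>
     (\<exists>a>0. \<exists>\<epsilon>>0. \<forall>h. norm h < \<epsilon> \<longrightarrow> 0 \<le> \<psi> y (y + h) \<and> \<psi> y (y + h) \<le> exp (- a * (h \<bullet> h))) \<and>
     (\<forall>z. (\<lambda>n. real n * (\<psi> y (y + (1 / sqrt (real n)) *\<^sub>R z) - 1)) \<longlonglongrightarrow> - (z \<bullet> (Q y *v z)) / 2)"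
    if y: "y \<in> Y" for y
  proof -
    let ?c = "1 / \<phi> y"
    have neg: "- (?c *\<^sub>R F y) = Q y" by (simp add: Q_def vec_eq_iff)
    have 1: "(\<psi> y has_derivative (\<lambda>h. (?c *\<^sub>R G x) \<bullet> h)) (at x)" for x
      using has_derivative_mult_right[OF d1, of ?c x] by (simp add: \<psi>_def[abs_def])
    have 2: "((\<lambda>x. ?c *\<^sub>R G x) has_derivative (\<lambda>h. (?c *\<^sub>R F x) *v h)) (at x)" for x
      using has_derivative_scaleR_right[OF d2, of ?c x] by (simp add: scaleR_matrix_vector_assoc)
    have 3: "isCont (\<lambda>x. ?c *\<^sub>R F x) y" using cont by (intro continuous_intros) auto
    have 4: "transpose (?c *\<^sub>R F y) = ?c *\<^sub>R F y"
      using sym[of y] by (simp add: transpose_def vec_eq_iff)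
    have 5: "det (?c *\<^sub>R F y) \<noteq> 0"
    proof -
      have "inj ((*v) (F y))" using det[OF y] det_nz_iff_inj[of "(*v) (F y)"] by simp
      then have "inj ((*v) (?c *\<^sub>R F y))" using nz[OF y]
          by (simp add: inj_def scaleR_matrix_vector_assoc[symmetric])
      then show ?thesis using det_nz_iff_inj[of "(*v) (?c *\<^sub>R F y)"] by simp
    qed
    have 6: "\<psi> y x \<le> 1" for x
    proof -
      have "\<phi> x / \<phi> y \<le> \<bar>\<phi> x / \<phi> y\<bar>" by (rule abs_ge_self)
      also have "\<dots> \<le> 1" using m y by (simp add: abs_divide Y)
      finally show ?thesis by (simp add: \<psi>_def)
    qed
    have 7: "\<psi> y y = 1" using nz[OF y] by (simp add: \<psi>_def)
    show ?thesis using nondegenerate_maximum[OF 1 2 3 4 5 6 7] unfolding neg by blast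
  qed
  have posQ: "x \<bullet> (Q y *v x) > 0" if "y \<in> Y" "x \<noteq> 0" for x y using nd that by blast
  show "det ((- 1 / \<phi> y) *\<^sub>R F y) > 0" if "y \<in> Y" for y
    using integral_exp_quadratic_form(1)[OF symQ posQ[OF that]] by (simp add: Q_def)
  have "\<exists>a e. \<forall>y\<in>Y. a y > 0 \<and> e y > 0 \<and>
     (\<forall>h. norm h < e y \<longrightarrow> 0 \<le> \<psi> y (y + h) \<and> \<psi> y (y + h) \<le> exp (- a y * (h \<bullet> h)))"
  proof -
    have "\<forall>y\<in>Y. \<exists>p. fst p > 0 \<and> snd p > 0 \<and>
     (\<forall>h. norm h < snd p \<longrightarrow> 0 \<le> \<psi> y (y + h) \<and> \<psi> y (y + h) \<le> exp (- fst p * (h \<bullet> h)))"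
      using nd by fastforce
    then obtain p where "\<forall>y\<in>Y. fst (p y) > 0 \<and> snd (p y) > 0 \<and>
     (\<forall>h. norm h < snd (p y) \<longrightarrow> 0 \<le> \<psi> y (y + h) \<and> \<psi> y (y + h) \<le> exp (- fst (p y) * (h \<bullet> h)))"
      by metis
    then show ?thesis by (intro exI[of _ "\<lambda>y. fst (p y)"] exI[of _ "\<lambda>y. snd (p y)"])
  qed
  then obtain a e where ae: "\<And>y. y \<in> Y \<Longrightarrow> a y > 0" "\<And>y. y \<in> Y \<Longrightarrow> e y > 0"
    "\<And>y h. y \<in> Y \<Longrightarrow> norm h < e y \<Longrightarrow> 0 \<le> \<psi> y (y + h) \<and> \<psi> y (y + h) \<le> exp (- a y * (h \<bullet> h))"
    by blast
  \<comment> \<open>Near \<open>y\<close> the Gaussian bound is below 1 except at \<open>y\<close>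
    itself, whereas another point of \<open>Y\<close> would have the absolute value 1.\<close>
  have isolated: "x = y" if "x \<in> Y" "y \<in> Y" "dist y x < e y" for x y
  proof (rule ccontr)
    assume "x \<noteq> y"
    define h where "h = x - y"
    have h: "h \<noteq> 0" "norm h < e y" "x = y + h" using that \<open>x \<noteq> y\<close>
        by (auto simp: h_def dist_norm norm_minus_commute)
    have "a y * (h \<bullet> h) > 0" using ae(1)[OF that(2)] h(1) by simp
    then have "exp (- a y * (h \<bullet> h)) < 1" by simp
    then have "\<bar>\<psi> y x\<bar> < 1" using ae(3)[OF that(2) h(2)] unfolding h(3) by linarith
    moreover have "\<bar>\<psi> y x\<bar> = 1" using that m(1) by (simp add: \<psi>_def Y abs_divide)
    ultimately show False by simp
  qed
  have "\<exists>R>0. \<forall>x. norm x \<ge> R \<longrightarrow> \<bar>\<phi> x\<bar> < m / 2"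
  proof -
    have "\<forall>\<^sub>F x in at_infinity. dist (\<phi> x) 0 < m / 2"
      using tendstoD[OF infinity, of "m / 2"] m(1) by simp
    then show ?thesis unfolding eventually_at_infinity_pos by simp
  qed
  then obtain R where R: "R > 0" "\<And>x. norm x \<ge> R \<Longrightarrow> \<bar>\<phi> x\<bar> < m / 2" by blast
  have "compact Y"
  proof -
    have "closed {y. \<bar>\<phi> y\<bar> = m}"
      using contphi by (intro closed_Collect_eq continuous_intros)
    moreover have "bounded Y"
    proof (rule boundedI)
      fix x assume "x \<in> Y"
      then have "\<not> \<bar>\<phi> x\<bar> < m / 2" using m(1) by (simp add: Y)
      then show "norm x \<le> R" using R(2)[of x] by linarith
    qed
    ultimately show ?thesis by (simp add: compact_eq_bounded_closed Y)
  qed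
  show finY: "finite Y"
  proof -
    have "Y \<subseteq> (\<Union>y\<in>Y. ball y (e y))" using ae(2) by force
    then obtain C where C: "C \<subseteq> Y" "finite C" "Y \<subseteq> (\<Union>y\<in>C. ball y (e y))"
      using compactE_image[OF \<open>compact Y\<close>, of Y "\<lambda>y. ball y (e y)"] open_ball by blast
    have "Y \<subseteq> C" using C isolated by fastforce
    then show ?thesis using C(2) finite_subset by blast
  qed
  have "\<forall>y\<in>Y. \<exists>d>0. \<forall>x\<in>Y. x \<noteq> y \<longrightarrow> d \<le> dist y x"
    using finite_set_avoid[OF finY] by blast
  then obtain d where d: "\<And>y. y \<in> Y \<Longrightarrow> d y > 0" "\<And>x y. y \<in> Y \<Longrightarrow> x \<in> Y \<Longrightarrow> x \<noteq> y \<Longrightarrow> d y \<le> dist y x"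
    by metis
  \<comment> \<open>One radius for all maxima: below each \<open>e y\<close> for the local estimate,
    and at most half the separation so that the balls are disjoint. The entry 1 covers an empty
    \<open>Y\<close>.\<close>
  define r where "r = Min (insert 1 ((\<lambda>y. min (e y) (d y / 2)) ` Y))"
  have r: "r > 0" using finY ae(2) d(1) by (auto simp: r_def)
  have re: "r \<le> e y" "r \<le> d y / 2" if "y \<in> Y" for y
  proof -
    have "r \<le> min (e y) (d y / 2)" unfolding r_def using finY that by (intro Min_le) auto
    then show "r \<le> e y" "r \<le> d y / 2" by auto
  qed
  define C where "C = - (\<Union>y\<in>Y. ball y r)"
  have closedC: "closed C" unfolding C_def by (auto intro!: open_UN)
  then have [measurable]: "C \<in> sets borel" by (rule borel_closed)
  have [measurable]: "ball y r \<in> sets borel" for y :: "real^'n" by simp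
  \<comment> \<open>Outside the balls the maximum is missed by a uniform factor: by compactness
    inside radius \<open>R\<close>, and by the choice of \<open>R\<close> beyond it.\<close>
  have "\<exists>q. 0 \<le> q \<and> q < 1 \<and> (\<forall>x\<in>C. \<bar>\<phi> x\<bar> \<le> m * q)"
  proof (cases "C \<inter> cball 0 R = {}")
    case True
    have "\<bar>\<phi> x\<bar> \<le> m * (1 / 2)" if "x \<in> C" for x
      using R(2)[of x] True that by (force simp: dist_norm)
    then show ?thesis by (intro exI[of _ "1 / 2"]) auto
  next
    case False
    have "compact (C \<inter> cball 0 R)" using closedC by (simp add: closed_Int_compact)
    moreover have "continuous_on (C \<inter> cball 0 R) (\<lambda>x. \<bar>\<phi> x\<bar>)"
      using contphi by (intro continuous_intros) (auto intro: continuous_on_subset)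
    ultimately obtain u where u: "u \<in> C \<inter> cball 0 R" "\<And>x. x \<in> C \<inter> cball 0 R \<Longrightarrow> \<bar>\<phi> x\<bar> \<le> \<bar>\<phi> u\<bar>"
      using continuous_attains_sup[OF _ False, of "\<lambda>x. \<bar>\<phi> x\<bar>"] by blast
    have "u \<notin> Y" using u(1) r by (auto simp: C_def)
    then have "\<bar>\<phi> u\<bar> < m" using m(2)[of u] by (simp add: Y)
    define q where "q = max (1 / 2) (\<bar>\<phi> u\<bar> / m)"
    have "\<bar>\<phi> x\<bar> \<le> m * q" if "x \<in> C" for x
    proof (cases "norm x \<le> R")
      case True
      then have "\<bar>\<phi> x\<bar> \<le> m * (\<bar>\<phi> u\<bar> / m)" using u(2)[of x] that m(1) by simp
      also have "\<dots> \<le> m * q" using m(1) by (intro mult_left_mono) (auto simp: q_def)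
      finally show ?thesis .
    next
      case False
      then have "\<bar>\<phi> x\<bar> \<le> m * (1 / 2)" using R(2)[of x] by simp
      also have "\<dots> \<le> m * q" using m(1) by (intro mult_left_mono) (auto simp: q_def)
      finally show ?thesis .
    qed
    moreover have "0 \<le> q" "q < 1" using \<open>\<bar>\<phi> u\<bar> < m\<close> m(1) by (auto simp: q_def)
    ultimately show ?thesis by blast
  qed
  then obtain q where q: "0 \<le> q" "q < 1" "\<And>x. x \<in> C \<Longrightarrow> \<bar>\<phi> x\<bar> \<le> m * q" by blast
  have powint: "integrable lborel (\<lambda>x. \<phi> x ^ n)" if "n > 0" for n
  proof (rule Bochner_Integration.integrable_bound[of _ "\<lambda>x. m ^ (n - 1) * \<phi> x"])
    show "integrable lborel (\<lambda>x. m ^ (n - 1) * \<phi> x)" using int by simp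
    show "AE x in lborel. norm (\<phi> x ^ n) \<le> norm (m ^ (n - 1) * \<phi> x)"
    proof (rule AE_I2)
      fix x
      have "\<bar>\<phi> x\<bar> ^ (n - 1) * \<bar>\<phi> x\<bar> \<le> m ^ (n - 1) * \<bar>\<phi> x\<bar>"
        using m by (intro mult_right_mono power_mono) auto
      moreover have "\<bar>\<phi> x\<bar> ^ n = \<bar>\<phi> x\<bar> ^ (n - 1) * \<bar>\<phi> x\<bar>" using that by (simp add: power_eq_if)
      ultimately show "norm (\<phi> x ^ n) \<le> norm (m ^ (n - 1) * \<phi> x)" using m(1)
          by (simp add: abs_mult power_abs)
    qed
  qed simp
  define L where "L y = (\<integral>z. exp (- (z \<bullet> (Q y *v z)) / 2) \<partial>lborel)" for y
  define J where "J y n = sqrt (real n) ^ CARD('n) * (\<integral>x. indicator (ball y r) x * \<psi> y x ^ n \<partial>lborel)"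
      for y n
  define E where "E n = sqrt (real n) ^ CARD('n) * (\<integral>x. indicator C x * \<phi> x ^ n \<partial>lborel) / m ^ n" for n
  have Jlim: "J y \<longlonglongrightarrow> L y" if y: "y \<in> Y" for y
    unfolding J_def L_def
  proof (rule local_laplace[OF _ r ae(1)[OF y]])
    show "\<psi> y \<in> borel_measurable borel" unfolding \<psi>_def[abs_def] by measurable
    show "0 \<le> \<psi> y (y + h) \<and> \<psi> y (y + h) \<le> exp (- a y * (h \<bullet> h))" if "norm h < r" for h
      using ae(3)[OF y, of h] re(1)[OF y] that by simp
    show "(\<lambda>n. real n * (\<psi> y (y + (1 / sqrt (real n)) *\<^sub>R z) - 1)) \<longlonglongrightarrow> - (z \<bullet> (Q y *v z)) / 2" for z
      using nd[OF y] by blast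
  qed
  have Elim: "E \<longlonglongrightarrow> 0"
  proof (rule Lim_null_comparison)
    have "(\<lambda>n. sqrt (real n) ^ CARD('n) * q ^ (n - 1) * ((\<integral>x. \<bar>\<phi> x\<bar> \<partial>lborel) / m)) \<longlonglongrightarrow>
        0 * ((\<integral>x. \<bar>\<phi> x\<bar> \<partial>lborel) / m)"
      by (intro tendsto_mult tendsto_const sqrt_power_times_geometric q)
    then show "(\<lambda>n. sqrt (real n) ^ CARD('n) * q ^ (n - 1) * ((\<integral>x. \<bar>\<phi> x\<bar> \<partial>lborel) / m)) \<longlonglongrightarrow> 0" by simp
    show "\<forall>\<^sub>F n in sequentially. norm (E n) \<le> sqrt (real n) ^ CARD('n) * q ^ (n - 1) *
        ((\<integral>x. \<bar>\<phi> x\<bar> \<partial>lborel) / m)"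
      using eventually_gt_at_top[of 0]
    proof eventually_elim
      case (elim n)
      have "\<bar>\<integral>x. indicator C x * \<phi> x ^ n \<partial>lborel\<bar> \<le> (\<integral>x. (m * q) ^ (n - 1) * \<bar>\<phi> x\<bar> \<partial>lborel)"
      proof (rule order_trans[OF integral_abs_bound], rule integral_mono)
        show "integrable lborel (\<lambda>x. \<bar>indicator C x * \<phi> x ^ n\<bar>)"
          using integrable_real_mult_indicator[OF _ powint[OF elim], of C] by (simp add: mult.commute)
        show "integrable lborel (\<lambda>x. (m * q) ^ (n - 1) * \<bar>\<phi> x\<bar>)" using int by simp
        fix x
        have "\<bar>\<phi> x\<bar> ^ n = \<bar>\<phi> x\<bar> ^ (n - 1) * \<bar>\<phi> x\<bar>" using elim by (simp add: power_eq_if)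
        moreover have "\<bar>\<phi> x\<bar> ^ (n - 1) * \<bar>\<phi> x\<bar> \<le> (m * q) ^ (n - 1) * \<bar>\<phi> x\<bar>" if "x \<in> C"
          using q(3)[OF that] by (intro mult_right_mono power_mono) auto
        moreover have "0 \<le> (m * q) ^ (n - 1) * \<bar>\<phi> x\<bar>" using m(1) q(1) by simp
        ultimately show "\<bar>indicator C x * \<phi> x ^ n\<bar> \<le> (m * q) ^ (n - 1) * \<bar>\<phi> x\<bar>"
          by (auto simp: indicator_def abs_mult power_abs)
      qed
      also have "\<dots> = (m * q) ^ (n - 1) * (\<integral>x. \<bar>\<phi> x\<bar> \<partial>lborel)" by simp
      finally have "\<bar>\<integral>x. indicator C x * \<phi> x ^ n \<partial>lborel\<bar> / m ^ n \<le> (m * q) ^ (n - 1) *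
          (\<integral>x. \<bar>\<phi> x\<bar> \<partial>lborel) / m ^ n"
        using m(1) by (intro divide_right_mono) auto
      also have "\<dots> = q ^ (n - 1) * ((\<integral>x. \<bar>\<phi> x\<bar> \<partial>lborel) / m)"
        using m(1) elim by (simp add: power_mult_distrib power_eq_if[of m n])
      finally have *: "\<bar>\<integral>x. indicator C x * \<phi> x ^ n \<partial>lborel\<bar> / m ^ n \<le> q ^ (n - 1) *
          ((\<integral>x. \<bar>\<phi> x\<bar> \<partial>lborel) / m)" .
      have "norm (E n) = sqrt (real n) ^ CARD('n) * (\<bar>\<integral>x. indicator C x * \<phi> x ^ n \<partial>lborel\<bar> / m ^ n)"
        using m(1) by (simp add: E_def abs_mult abs_divide)
      also have "\<dots> \<le> sqrt (real n) ^ CARD('n) * (q ^ (n - 1) * ((\<integral>x. \<bar>\<phi> x\<bar> \<partial>lborel) / m))"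
        using * by (intro mult_left_mono) auto
      finally show ?case by (simp add: mult.assoc)
    qed
  qed
  have split: "sqrt (real n) ^ CARD('n) * (\<integral>x. \<phi> x ^ n \<partial>lborel) / m ^ n =
      (\<Sum>y\<in>Y. sgn (\<phi> y) ^ n * J y n) + E n"
    if n: "n > 0" for n
  proof -
    have pt: "\<phi> x ^ n = (\<Sum>y\<in>Y. indicator (ball y r) x * \<phi> x ^ n) + indicator C x * \<phi> x ^ n" for x
    proof (cases "x \<in> C")
      case True
      then have "indicator (ball y r) x = (0::real)" if "y \<in> Y" for y using that by (auto simp: C_def)
      then show ?thesis using True by simp
    next
      case False
      then obtain y where y: "y \<in> Y" "x \<in> ball y r" by (auto simp: C_def)
      have "indicator (ball y' r) x = (0::real)" if y': "y' \<in> Y - {y}" for y'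
      proof (rule ccontr)
        assume "\<not> ?thesis"
        then have "dist y' x < r" by (auto simp: indicator_def split: if_splits)
        moreover have "dist y x < r" using y by simp
        ultimately have "dist y y' < 2 * r" using dist_triangle2[of y y' x] by simp
        moreover have "d y \<le> dist y y'" using d(2)[OF y(1)] y' by auto
        ultimately show False using re(2)[OF y(1)] by simp
      qed
      then have "(\<Sum>y\<in>Y. indicator (ball y r) x * \<phi> x ^ n) = indicator (ball y r) x * \<phi> x ^ n"
        by (subst sum.remove[OF finY y(1)]) simp
      then show ?thesis using False y(2) by simp
    qed
    have int_ind: "integrable lborel (\<lambda>x. indicator S x * \<phi> x ^ n)" if "S \<in> sets borel" for S
      using integrable_real_mult_indicator[OF _ powint[OF n], of S] that by (simp add: mult.commute)
    have "(\<integral>x. \<phi> x ^ n \<partial>lborel) =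
        (\<integral>x. (\<Sum>y\<in>Y. indicator (ball y r) x * \<phi> x ^ n) + indicator C x * \<phi> x ^ n \<partial>lborel)"
      using pt by simp
    also have "\<dots> = (\<Sum>y\<in>Y. \<integral>x. indicator (ball y r) x * \<phi> x ^ n \<partial>lborel) + (\<integral>x. indicator C x *
        \<phi> x ^ n \<partial>lborel)"
      using int_ind by (subst Bochner_Integration.integral_add)
          (auto simp: Bochner_Integration.integral_sum)
    also have "(\<Sum>y\<in>Y. \<integral>x. indicator (ball y r) x * \<phi> x ^ n \<partial>lborel) =
        (\<Sum>y\<in>Y. \<phi> y ^ n * (\<integral>x. indicator (ball y r) x * \<psi> y x ^ n \<partial>lborel))"
    proof (rule sum.cong[OF refl])
      fix y assume y: "y \<in> Y"
      have "(\<lambda>x. indicator (ball y r) x * \<phi> x ^ n) =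
          (\<lambda>x. \<phi> y ^ n * (indicator (ball y r) x * \<psi> y x ^ n))"
        using nz[OF y] by (simp add: \<psi>_def power_divide)
      then show "(\<integral>x. indicator (ball y r) x * \<phi> x ^ n \<partial>lborel) =
          \<phi> y ^ n * (\<integral>x. indicator (ball y r) x * \<psi> y x ^ n \<partial>lborel)"
        by simp
    qed
    finally have eq: "(\<integral>x. \<phi> x ^ n \<partial>lborel) =
        (\<Sum>y\<in>Y. \<phi> y ^ n * (\<integral>x. indicator (ball y r) x * \<psi> y x ^ n \<partial>lborel)) + (\<integral>x. indicator C x * \<phi> x ^ n
            \<partial>lborel)" .
    have "sqrt (real n) ^ CARD('n) * (\<integral>x. \<phi> x ^ n \<partial>lborel) / m ^ n =
       (\<Sum>y\<in>Y. \<phi> y ^ n / m ^ n * J y n) + E n"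
    proof -
      have "sqrt (real n) ^ CARD('n) * (\<Sum>y\<in>Y. \<phi> y ^ n * (\<integral>x. indicator (ball y r) x *
          \<psi> y x ^ n \<partial>lborel)) / m ^ n =
          (\<Sum>y\<in>Y. \<phi> y ^ n / m ^ n * J y n)"
        unfolding sum_distrib_left sum_divide_distrib J_def
            by (rule sum.cong[OF refl]) (simp only: times_divide_eq_left times_divide_eq_right mult_ac)
      then show ?thesis unfolding eq E_def by (simp only: distrib_left add_divide_distrib)
    qed
    also have "(\<Sum>y\<in>Y. \<phi> y ^ n / m ^ n * J y n) = (\<Sum>y\<in>Y. sgn (\<phi> y) ^ n * J y n)"
    proof (rule sum.cong[OF refl])
      fix y assume "y \<in> Y"
      then have "sgn (\<phi> y) = \<phi> y / m" by (simp add: Y real_sgn_eq)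
      then show "\<phi> y ^ n / m ^ n * J y n = sgn (\<phi> y) ^ n * J y n" by (simp add: power_divide)
    qed
    finally show ?thesis .
  qed
  have Lval: "L y = sqrt (2 * pi) ^ CARD('n) / sqrt (det (Q y))" if "y \<in> Y" for y
    unfolding L_def by (rule integral_exp_quadratic_form(3)[OF symQ posQ[OF that]])
  \<comment> \<open>The signs may alternate with \<open>n\<close>, so no limit of the main terms is
    taken; they multiply errors that tend to 0 and are bounded by 1.\<close>
  have "(\<lambda>n. (\<Sum>y\<in>Y. sgn (\<phi> y) ^ n * (J y n - L y)) + E n) \<longlonglongrightarrow> (\<Sum>y\<in>Y. 0) + 0"
  proof (intro tendsto_add tendsto_sum Elim)
    fix y assume "y \<in> Y"
    then have "(\<lambda>n. \<bar>J y n - L y\<bar>) \<longlonglongrightarrow> 0"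
      using Jlim by (simp add: LIM_zero tendsto_rabs_zero)
    then show "(\<lambda>n. sgn (\<phi> y) ^ n * (J y n - L y)) \<longlonglongrightarrow> 0"
    proof (rule Lim_null_comparison[OF always_eventually, rotated], intro allI)
      fix n
      have "\<bar>sgn (\<phi> y)\<bar> ^ n \<le> 1 ^ n" by (intro power_mono) (auto simp: abs_sgn_eq)
      then show "norm (sgn (\<phi> y) ^ n * (J y n - L y)) \<le> \<bar>J y n - L y\<bar>"
        by (simp add: abs_mult power_abs mult_left_le_one_le)
    qed
  qed
  moreover have "\<forall>\<^sub>F n in sequentially. (\<Sum>y\<in>Y. sgn (\<phi> y) ^ n * (J y n - L y)) + E n =
      sqrt (real n) ^ CARD('n) * (\<integral>y. \<phi> y ^ n \<partial>lborel) / m ^ n -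
      sqrt (2 * pi) ^ CARD('n) * (\<Sum>y\<in>Y. sgn (\<phi> y) ^ n / sqrt (det (Q y)))"
    using eventually_gt_at_top[of 0]
  proof eventually_elim
    case (elim n)
    have "(\<Sum>y\<in>Y. sgn (\<phi> y) ^ n * L y) =
        sqrt (2 * pi) ^ CARD('n) * (\<Sum>y\<in>Y. sgn (\<phi> y) ^ n / sqrt (det (Q y)))"
      unfolding sum_distrib_left by (intro sum.cong) (auto simp: Lval)
    then show ?case unfolding split[OF elim] by (simp add: right_diff_distrib sum_subtractf)
  qed
  ultimately show "(\<lambda>n. sqrt (real n) ^ CARD('n) * (\<integral>y. \<phi> y ^ n \<partial>lborel) / m ^ n -
      sqrt (2 * pi) ^ CARD('n) * (\<Sum>y\<in>Y. sgn (\<phi> y) ^ n / sqrt (det ((- 1 / \<phi> y) *\<^sub>R F y)))) \<longlonglongrightarrow> 0"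
    unfolding Q_def[symmetric] by (simp add: Lim_transform_eventually)
qed

section \<open>Derivatives of forms\<close>

text \<open>The partial derivative of a monomial. If \<open>w i = 0\<close>, the truncated exponent
  is harmless because the leading factor vanishes.\<close>

definition dmpow :: "'c \<Rightarrow> ('c::finite \<Rightarrow> nat) \<Rightarrow> 'a::comm_ring_1^'c \<Rightarrow> 'a"
  where "dmpow i w x = of_nat (w i) * mpow x (w(i := w i - 1))"

definition ddmpow :: "'c \<Rightarrow> 'c \<Rightarrow> ('c::finite \<Rightarrow> nat) \<Rightarrow> 'a::comm_ring_1^'c \<Rightarrow> 'a"
  where "ddmpow i j w x = of_nat (w j) * dmpow i (w(j := w j - 1)) x"

lemma mpower_eq_mpow: "mpower = mpow"
  by (simp add: fun_eq_iff mpower_def mpow_def)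

lemma mpow_split: "mpow x w = (x $ i) ^ w i * (\<Prod>j\<in>UNIV - {i}. (x $ j) ^ w j)"
  unfolding mpow_def by (rule prod.remove) auto

lemma dmpow_eq: "dmpow i w x = of_nat (w i) * (x $ i) ^ (w i - 1) * (\<Prod>j\<in>UNIV - {i}. (x $ j) ^ w j)"
proof -
  have "(\<Prod>j\<in>UNIV - {i}. (x $ j) ^ (w(i := w i - 1)) j) = (\<Prod>j\<in>UNIV - {i}. (x $ j) ^ w j)"
    by (rule prod.cong) auto
  then show ?thesis unfolding dmpow_def mpow_split[of x _ i] by simp
qed

lemma msize_decr: "w i > 0 \<Longrightarrow> msize (w(i := w i - Suc 0)) = msize w - Suc 0"
  unfolding msize_def by (simp add: sum.remove[of UNIV i])

lemma ddmpow_commute: "ddmpow i j w x = ddmpow j i w x"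
proof (cases "i = j")
  case False
  then have "w(j := w j - 1, i := (w(j := w j - 1)) i - 1) =
      w(i := w i - 1, j := (w(i := w i - 1)) j - 1)"
    by (auto simp: fun_upd_twist)
  then show ?thesis using False unfolding ddmpow_def dmpow_def by (simp add: mult_ac)
qed simp

lemma euler_mpow: "(\<Sum>i\<in>UNIV. x $ i * dmpow i w x) = of_nat (msize w) * mpow x w"
proof -
  have "x $ i * dmpow i w x = of_nat (w i) * mpow x w" for i
    unfolding dmpow_eq mpow_split[of x w i] by (cases "w i") (auto simp: mult_ac)
  then show ?thesis by (simp add: msize_def sum_distrib_right)
qed

lemma euler_dmpow: "(\<Sum>i\<in>UNIV. x $ i * ddmpow i j w x) = of_nat (msize w - 1) * dmpow j w x"
proof (cases "w j = 0")
  case False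
  have "(\<Sum>i\<in>UNIV. x $ i * ddmpow i j w x) =
      of_nat (w j) * (\<Sum>i\<in>UNIV. x $ i * dmpow i (w(j := w j - 1)) x)"
    by (simp add: ddmpow_def sum_distrib_left mult_ac)
  then show ?thesis unfolding euler_mpow using False by (simp add: msize_decr dmpow_def mult_ac)
qed (simp add: ddmpow_def dmpow_def)

lemma mpow_cscale: "mpow (cscale \<tau> x) w = \<tau> ^ msize w * of_real (mpow x w)"
  by (simp add: mpow_def cscale_def msize_def power_mult_distrib prod.distrib power_sum)

lemma dmpow_cscale: "dmpow i w (cscale \<tau> x) = \<tau> ^ (msize w - 1) * of_real (dmpow i w x)"
  by (cases "w i = 0") (auto simp: dmpow_def mpow_cscale msize_decr)

lemma ddmpow_cscale: "ddmpow i j w (cscale \<tau> x) = \<tau> ^ (msize w - 2) * of_real (ddmpow i j w x)"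
  by (cases "w j = 0") (auto simp: ddmpow_def dmpow_cscale msize_decr numeral_2_eq_2)

lemma mpow_scaleR: "mpow (t *\<^sub>R x) w = t ^ msize w * mpow x w"
  for x :: "real^'c::finite"
  by (simp add: mpow_def msize_def power_mult_distrib prod.distrib power_sum)

lemma dmpow_scaleR: "dmpow i w (t *\<^sub>R x) = t ^ (msize w - 1) * dmpow i w x"
  for x :: "real^'c::finite"
  by (cases "w i = 0") (auto simp: dmpow_def mpow_scaleR msize_decr)

lemma ddmpow_scaleR: "ddmpow i j w (t *\<^sub>R x) = t ^ (msize w - 2) * ddmpow i j w x"
  for x :: "real^'c::finite"
  by (cases "w j = 0") (auto simp: ddmpow_def dmpow_scaleR msize_decr numeral_2_eq_2)

lemma has_field_derivative_mpow:
  fixes z :: "'a::real_normed_field^'c::finite"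
  shows "((\<lambda>t. mpow (\<chi> j. if j = i then t else z $ j) w) has_field_derivative dmpow i w z) (at (z $ i))"
proof -
  have "(\<Prod>j\<in>UNIV - {i}. ((\<chi> j. if j = i then t else z $ j) $ j) ^ w j) = (\<Prod>j\<in>UNIV - {i}. (z $ j) ^ w j)"
      for t
    by (rule prod.cong) auto
  then have "mpow (\<chi> j. if j = i then t else z $ j) w = t ^ w i * (\<Prod>j\<in>UNIV - {i}. (z $ j) ^ w j)" for t
    unfolding mpow_split[of _ w i] by simp
  then show ?thesis
    unfolding dmpow_eq by (auto intro!: derivative_eq_intros)
qed

lemma has_derivative_mpow [derivative_intros]:
  fixes y :: "real^'c::finite"
  shows "((\<lambda>y. mpow y w) has_derivative (\<lambda>h. \<Sum>i\<in>UNIV. h $ i * dmpow i w y)) (at y)"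
proof -
  have "((\<lambda>y :: real^'c. (y $ i) ^ w i) has_derivative (\<lambda>h. of_nat (w i) * (y $ i) ^ (w i - 1) *
      h $ i)) (at y)" for i
    by (auto intro!: derivative_eq_intros bounded_linear.has_derivative[OF bounded_linear_vec_nth])
  from has_derivative_prod[of UNIV "\<lambda>i y. (y $ i) ^ w i", OF this]
  show ?thesis unfolding mpow_def[abs_def] dmpow_eq by (simp add: mult_ac)
qed

lemma isCont_mpow: "isCont (\<lambda>y :: real^'c::finite. mpow y w) x"
  by (rule has_derivative_continuous[OF has_derivative_mpow])

section \<open>Derivatives of the real form and of the complex polynomial\<close>

definition dform :: "nat \<Rightarrow> (('c::finite \<Rightarrow> nat) \<Rightarrow> real) \<Rightarrow> 'c \<Rightarrow> real^'c \<Rightarrow> real"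
  where "dform k \<Lambda> i x = (\<Sum>w\<in>multi_indices k. \<Lambda> w / mfact w * dmpow i w x)"

definition ddform :: "nat \<Rightarrow> (('c::finite \<Rightarrow> nat) \<Rightarrow> real) \<Rightarrow> 'c \<Rightarrow> 'c \<Rightarrow> real^'c \<Rightarrow> real"
  where "ddform k \<Lambda> i j x = (\<Sum>w\<in>multi_indices k. \<Lambda> w / mfact w * ddmpow i j w x)"

lemma ddform_commute: "ddform k \<Lambda> i j x = ddform k \<Lambda> j i x"
  unfolding ddform_def by (simp only: ddmpow_commute[of i j])

lemma euler_form: "(\<Sum>i\<in>UNIV. x $ i * dform k \<Lambda> i x) = real k * real_form k \<Lambda> x"
proof -
  have "(\<Sum>i\<in>UNIV. x $ i * dform k \<Lambda> i x) =
      (\<Sum>w\<in>multi_indices k. \<Lambda> w / mfact w * (\<Sum>i\<in>UNIV. x $ i * dmpow i w x))"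
    unfolding dform_def sum_distrib_left by (subst sum.swap) (simp add: mult_ac)
  then show ?thesis unfolding euler_mpow real_form_def sum_distrib_left
    by (auto simp: multi_indices_def mult_ac intro!: sum.cong)
qed

text \<open>Euler's identity for the first derivatives, which are homogeneous of degree k - 1. At
  maximizers it makes x an eigenvector of the Hessian.\<close>

lemma euler_dform: "(\<Sum>i\<in>UNIV. x $ i * ddform k \<Lambda> i j x) = real (k - 1) * dform k \<Lambda> j x"
proof -
  have "(\<Sum>i\<in>UNIV. x $ i * ddform k \<Lambda> i j x) =
      (\<Sum>w\<in>multi_indices k. \<Lambda> w / mfact w * (\<Sum>i\<in>UNIV. x $ i * ddmpow i j w x))"
    unfolding ddform_def sum_distrib_left by (subst sum.swap) (simp add: mult_ac)
  then show ?thesis unfolding euler_dmpow dform_def sum_distrib_left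
    by (auto simp: multi_indices_def mult_ac intro!: sum.cong)
qed

lemma real_form_scaleR: "real_form k \<Lambda> (t *\<^sub>R x) = t ^ k * real_form k \<Lambda> x"
  unfolding real_form_def sum_distrib_left by (rule sum.cong) (auto simp: mpow_scaleR multi_indices_def)

lemma dform_scaleR: "dform k \<Lambda> i (t *\<^sub>R x) = t ^ (k - 1) * dform k \<Lambda> i x"
  unfolding dform_def sum_distrib_left by (rule sum.cong) (auto simp: dmpow_scaleR multi_indices_def)

lemma ddform_scaleR: "ddform k \<Lambda> i j (t *\<^sub>R x) = t ^ (k - 2) * ddform k \<Lambda> i j x"
  unfolding ddform_def sum_distrib_left by (rule sum.cong) (auto simp: ddmpow_scaleR multi_indices_def)

lemma has_derivative_real_form:
  "(real_form k \<Lambda> has_derivative (\<lambda>h. \<Sum>i\<in>UNIV. h $ i * dform k \<Lambda> i y)) (at y)"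
proof -
  have "(real_form k \<Lambda> has_derivative (\<lambda>h. \<Sum>w\<in>multi_indices k. \<Lambda> w / mfact w *
      (\<Sum>i\<in>UNIV. h $ i * dmpow i w y))) (at y)"
    unfolding real_form_def[abs_def]
        by (intro has_derivative_sum has_derivative_mult_right has_derivative_mpow)
  also have "(\<lambda>h. \<Sum>w\<in>multi_indices k. \<Lambda> w / mfact w * (\<Sum>i\<in>UNIV. h $ i * dmpow i w y)) =
      (\<lambda>h. \<Sum>i\<in>UNIV. h $ i * dform k \<Lambda> i y)"
    unfolding dform_def sum_distrib_left by (subst sum.swap) (simp add: mult_ac)
  finally show ?thesis .
qed

lemma has_derivative_dform:
  "(dform k \<Lambda> j has_derivative (\<lambda>h. \<Sum>i\<in>UNIV. h $ i * ddform k \<Lambda> i j y)) (at y)"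
proof -
  have "(dform k \<Lambda> j has_derivative (\<lambda>h. \<Sum>w\<in>multi_indices k. \<Lambda> w / mfact w *
      (of_nat (w j) * (\<Sum>i\<in>UNIV. h $ i * dmpow i (w(j := w j - 1)) y)))) (at y)"
    unfolding dform_def[abs_def] dmpow_def[of j]
    by (intro has_derivative_sum has_derivative_mult_right has_derivative_mpow)
  also have "(\<lambda>h. \<Sum>w\<in>multi_indices k. \<Lambda> w / mfact w *
      (of_nat (w j) * (\<Sum>i\<in>UNIV. h $ i * dmpow i (w(j := w j - 1)) y))) = (\<lambda>h. \<Sum>i\<in>UNIV. h $ i * ddform k \<Lambda>
          i j y)"
    unfolding ddform_def ddmpow_def sum_distrib_left by (subst sum.swap) (simp add: mult_ac)
  finally show ?thesis .
qed

lemma continuous_real_form: "isCont (real_form k \<Lambda>) y" "isCont (dform k \<Lambda> i) y"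
    "isCont (ddform k \<Lambda> i j) y"
  unfolding real_form_def[abs_def] dform_def[abs_def] ddform_def[abs_def] ddmpow_def dmpow_def
  by (intro continuous_intros isCont_mpow)+

lemma action_poly_eq:
  "action_poly k \<Lambda> z = - (\<Sum>i\<in>UNIV. (z $ i)\<^sup>2 / 2) + (\<Sum>w\<in>multi_indices k. of_real (\<Lambda> w / mfact w) *
      mpow z w)"
  unfolding action_poly_def mpower_eq_mpow by (simp add: sum_divide_distrib)

lemma partial_eqI:
  "((\<lambda>t. f (\<chi> j. if j = i then t else z $ j)) has_field_derivative D) (at (z $ i)) \<Longrightarrow> partial i f z = D"
  unfolding partial_def by (rule DERIV_imp_deriv)

lemma partial_action_poly:
  fixes \<Lambda> :: "('c::finite \<Rightarrow> nat) \<Rightarrow> real"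
  shows "partial i (action_poly k \<Lambda>) =
      (\<lambda>z. - (z $ i) + (\<Sum>w\<in>multi_indices k. of_real (\<Lambda> w / mfact w) * dmpow i w z))"
proof (rule ext, rule partial_eqI)
  fix z :: "complex^'c"
  have sq: "((\<lambda>t. \<Sum>j\<in>UNIV. ((\<chi> j. if j =
      i then t else z $ j) $ j)\<^sup>2 / 2) has_field_derivative z $ i) (at (z $ i))"
  proof -
    have "((\<lambda>t. ((\<chi> j. if j = i then t else z $ j) $ j)\<^sup>2 / 2) has_field_derivative (if j =
        i then z $ i else 0)) (at (z $ i))" for j
      by (auto intro!: derivative_eq_intros)
    then have "((\<lambda>t. \<Sum>j\<in>UNIV. ((\<chi> j. if j =
        i then t else z $ j) $ j)\<^sup>2 / 2) has_field_derivative (\<Sum>j\<in>UNIV.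
            if j = i then z $ i else 0)) (at (z $ i))"
      by (intro DERIV_sum)
    then show ?thesis by simp
  qed
  show "((\<lambda>t. action_poly k \<Lambda> (\<chi> j. if j = i then t else z $ j)) has_field_derivative
      - (z $ i) + (\<Sum>w\<in>multi_indices k. of_real (\<Lambda> w / mfact w) * dmpow i w z)) (at (z $ i))"
    unfolding action_poly_eq
    by (intro DERIV_add DERIV_minus sq DERIV_sum DERIV_cmult has_field_derivative_mpow)
qed

lemma Hess_action_poly:
  "Hess (action_poly k \<Lambda>) z =
      (\<chi> i j. - (if i = j then 1 else 0) + (\<Sum>w\<in>multi_indices k. of_real (\<Lambda> w / mfact w) * ddmpow i j w
          z))"
proof -
  have "partial i (partial j (action_poly k \<Lambda>)) z =
     - (if i = j then 1 else 0) + (\<Sum>w\<in>multi_indices k. of_real (\<Lambda> w / mfact w) * ddmpow i j w z)" for i j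
    unfolding partial_action_poly
  proof (rule partial_eqI)
    have 1: "((\<lambda>t. (\<chi> l. if l = i then t else z $ l) $ j) has_field_derivative (if i =
        j then 1 else 0)) (at (z $ i))"
      by (auto intro!: derivative_eq_intros)
    show "((\<lambda>t. - ((\<chi> l. if l =
        i then t else z $ l) $ j) + (\<Sum>w\<in>multi_indices k. of_real (\<Lambda> w / mfact w) * dmpow j w (\<chi> l.
            if l = i then t else z $ l)))
       has_field_derivative - (if i = j then 1 else 0) + (\<Sum>w\<in>multi_indices k. of_real (\<Lambda> w / mfact w) *
           ddmpow i j w z)) (at (z $ i))"
      unfolding dmpow_def[of j] ddmpow_def
      by (intro DERIV_add DERIV_minus 1 DERIV_sum DERIV_cmult has_field_derivative_mpow)
  qed
  then show ?thesis by (simp add: Hess_def)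
qed

lemma action_poly_cscale:
  assumes "norm x = 1"
  shows "action_poly k \<Lambda> (cscale \<tau> x) = - \<tau>\<^sup>2 / 2 + \<tau> ^ k * of_real (real_form k \<Lambda> x)"
proof -
  have "(\<Sum>i\<in>UNIV. (x $ i)\<^sup>2) = (norm x)\<^sup>2"
    by (simp add: norm_vec_def L2_set_def sum_nonneg)
  then have "(\<Sum>i\<in>UNIV. (cscale \<tau> x $ i)\<^sup>2 / 2) = \<tau>\<^sup>2 / 2 * of_real ((norm x)\<^sup>2)"
    by (simp add: cscale_def power_mult_distrib sum_distrib_left[symmetric] sum_divide_distrib[symmetric]
        flip: of_real_power of_real_sum)
  moreover have "(\<Sum>w\<in>multi_indices k. of_real (\<Lambda> w / mfact w) * mpow (cscale \<tau> x) w) =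
      \<tau> ^ k * of_real (real_form k \<Lambda> x)"
    unfolding real_form_def of_real_sum sum_distrib_left
    by (rule sum.cong) (auto simp: mpow_cscale multi_indices_def)
  ultimately show ?thesis unfolding action_poly_eq using assms by simp
qed

lemma partial_action_poly_cscale:
  "partial i (action_poly k \<Lambda>) (cscale \<tau> x) =
      - \<tau> * of_real (x $ i) + \<tau> ^ (k - 1) * of_real (dform k \<Lambda> i x)"
proof -
  have "(\<Sum>w\<in>multi_indices k. of_real (\<Lambda> w / mfact w) * dmpow i w (cscale \<tau> x)) =
      \<tau> ^ (k - 1) * of_real (dform k \<Lambda> i x)"
    unfolding dform_def of_real_sum sum_distrib_left
    by (rule sum.cong) (auto simp: dmpow_cscale multi_indices_def)
  then show ?thesis unfolding partial_action_poly by (simp add: cscale_def)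
qed

lemma Hess_action_poly_cscale:
  "Hess (action_poly k \<Lambda>) (cscale \<tau> x) =
      (\<chi> i j. - (if i = j then 1 else 0) + \<tau> ^ (k - 2) * of_real (ddform k \<Lambda> i j x))"
proof -
  have "(\<Sum>w\<in>multi_indices k. of_real (\<Lambda> w / mfact w) * ddmpow i j w (cscale \<tau> x)) =
      \<tau> ^ (k - 2) * of_real (ddform k \<Lambda> i j x)" for i j
    unfolding ddform_def of_real_sum sum_distrib_left
    by (rule sum.cong) (auto simp: ddmpow_cscale multi_indices_def)
  then show ?thesis unfolding Hess_action_poly by simp
qed

text \<open>A polynomial function that vanishes on the whole real space has only zero coefficients.
  This is what makes the maximum of |V| on the sphere positive.\<close>

lemma real_form_nonzero:
  assumes "w0 \<in> multi_indices k" "\<Lambda> w0 \<noteq> 0"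
  shows "\<exists>x. real_form k \<Lambda> x \<noteq> 0"
proof (rule ccontr)
  assume "\<not> ?thesis"
  then have zero: "real_form k \<Lambda> x = 0" for x by simp
  define a where "a w = \<Lambda> w / mfact w" for w
  text \<open>Comparing coefficients of one variable at a time isolates the monomial \<open>w0\<close>.\<close>
  have "(\<Sum>w\<in>{w \<in> multi_indices k. \<forall>i\<in>S. w i = w0 i}. a w * mpow x w) = 0" if "finite S"
      for S and x :: "real^'a"
    using that
  proof (induction S arbitrary: x rule: finite_induct)
    case empty
    then show ?case using zero[of x] by (simp add: real_form_def a_def)
  next
    case (insert i S)
    let ?W = "{w \<in> multi_indices k. \<forall>i\<in>S. w i = w0 i}"
    have fin: "finite ?W" by (rule finite_subset[OF _ finite_multi_indices[of k]]) auto
    define p where "p = (\<Sum>w\<in>?W. monom (a w * mpow (\<chi> j. if j = i then 1 else x $ j) w) (w i))"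
    define r where "r w = (\<Prod>j\<in>UNIV - {i}. (x $ j) ^ w j)" for w
    have split: "mpow (\<chi> j. if j = i then t else x $ j) w = t ^ w i * r w" for t w
    proof -
      have "(\<Prod>j\<in>UNIV - {i}. ((\<chi> j. if j = i then t else x $ j) $ j) ^ w j) = r w"
        unfolding r_def by (rule prod.cong) auto
      then show ?thesis unfolding mpow_split[of _ w i] by simp
    qed
    have "poly p t = 0" for t
    proof -
      have "poly p t = (\<Sum>w\<in>?W. a w * mpow (\<chi> j. if j = i then t else x $ j) w)"
        unfolding p_def poly_sum by (rule sum.cong) (simp_all add: poly_monom split)
      also have "\<dots> = 0" by (rule insert.IH)
      finally show ?thesis .
    qed
    then have "p = 0" by (simp add: poly_all_0_iff_0[symmetric])
    then have "(\<Sum>w\<in>?W. coeff (monom (a w * mpow (\<chi> j. if j = i then 1 else x $ j) w) (w i)) (w0 i)) = 0"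
      by (metis (no_types, lifting) coeff_0 coeff_sum p_def sum.cong)
    then have "(\<Sum>w\<in>?W. if w i = w0 i then a w * r w else 0) = 0"
      by (simp add: split coeff_monom)
    then have "(\<Sum>w\<in>{w \<in> ?W. w i = w0 i}. a w * r w) = 0"
      using sum.inter_filter[OF fin, of "\<lambda>w. a w * r w" "\<lambda>w. w i = w0 i"] by simp
    then have "(x $ i) ^ w0 i * (\<Sum>w\<in>{w \<in> ?W. w i = w0 i}. a w * r w) = 0" by simp
    moreover have "{w \<in> ?W. w i = w0 i} = {w \<in> multi_indices k. \<forall>i\<in>insert i S. w i = w0 i}" by auto
    moreover have "mpow x w = (x $ i) ^ w0 i * r w" if "w i = w0 i" for w
      unfolding mpow_split[of x w i] r_def using that by simp
    ultimately show ?case by (simp add: sum_distrib_left mult_ac)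
  qed
  from this[of UNIV "\<chi> i. 1"]
  have "(\<Sum>w\<in>{w \<in> multi_indices k. \<forall>i. w i = w0 i}. a w * mpow (\<chi> i. 1) w) = 0" by simp
  moreover have "{w \<in> multi_indices k. \<forall>i. w i = w0 i} = {w0}" using assms(1) by auto
  ultimately have "a w0 = 0" by (simp add: mpow_def)
  then show False using assms(2) by (simp add: a_def mfact_def)
qed

section \<open>The Gaussian factor and the radial maximum\<close>

lemma has_derivative_exp_norm_square:
  "((\<lambda>y :: real^'n. exp (- (y \<bullet> y) / 2)) has_derivative (\<lambda>h. - (y \<bullet> h) * exp (- (y \<bullet> y) / 2))) (at y)"
  by (auto intro!: derivative_eq_intros simp: inner_commute algebra_simps)

lemma has_derivative_vecI:
  fixes f :: "'a::real_normed_vector \<Rightarrow> real^'n"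
  assumes "\<And>i. ((\<lambda>x. f x $ i) has_derivative (\<lambda>h. f' h $ i)) (at a)"
  shows "(f has_derivative f') (at a)"
  using assms by (subst has_derivative_componentwise_within) (auto simp: Basis_vec_def inner_axis)

text \<open>In the unit u = r / sqrt k both sides are k-th powers up to a common factor, and it
  remains to compare u exp (-u^2 / 2) with exp (-1 / 2). This follows from u \<le> (1 + u^2) / 2
  \<le> exp ((u^2 - 1) / 2), where the first inequality is strict unless u = 1.\<close>

lemma radial_bound:
  fixes r :: real and k :: nat
  assumes "r \<ge> 0" "k > 0"
  shows "r ^ k * exp (- r\<^sup>2 / 2) \<le> sqrt (real k) ^ k * exp (- real k / 2)"
    and "r \<noteq> sqrt (real k) \<Longrightarrow> r ^ k * exp (- r\<^sup>2 / 2) < sqrt (real k) ^ k * exp (- real k / 2)"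
proof -
  define u where "u = r / sqrt (real k)"
  have r: "r = sqrt (real k) * u" and u0: "u \<ge> 0" using assms by (auto simp: u_def)
  have r2: "r\<^sup>2 = real k * u\<^sup>2" using assms by (simp add: r power_mult_distrib)
  have pw: "r ^ k * exp (- r\<^sup>2 / 2) = sqrt (real k) ^ k * (u * exp (- u\<^sup>2 / 2)) ^ k"
  proof -
    have "exp (- r\<^sup>2 / 2) = exp (real k * (- u\<^sup>2 / 2))" unfolding r2 by simp
    then have "exp (- r\<^sup>2 / 2) = exp (- u\<^sup>2 / 2) ^ k" by (simp only: exp_of_nat_mult)
    then show ?thesis by (simp add: r power_mult_distrib)
  qed
  have ek: "exp (- real k / 2) = exp (- 1 / 2) ^ k"
    using exp_of_nat_mult[of k "- 1 / 2 :: real"] by simp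
  have le: "(1 + u\<^sup>2) / 2 \<le> exp ((u\<^sup>2 - 1) / 2)"
    using exp_ge_add_one_self[of "(u\<^sup>2 - 1) / 2"] by (simp add: field_simps)
  have split: "exp ((u\<^sup>2 - 1) / 2) * exp (- u\<^sup>2 / 2) = exp (- 1 / 2)"
    by (simp add: exp_add[symmetric] field_simps)
  have "u \<le> (1 + u\<^sup>2) / 2" using sum_squares_bound[of u 1] by (simp add: field_simps)
  then have "u * exp (- u\<^sup>2 / 2) \<le> exp ((u\<^sup>2 - 1) / 2) * exp (- u\<^sup>2 / 2)"
    using le by (intro mult_right_mono) auto
  then have "(u * exp (- u\<^sup>2 / 2)) ^ k \<le> exp (- 1 / 2) ^ k"
    using u0 unfolding split by (intro power_mono) auto
  then show "r ^ k * exp (- r\<^sup>2 / 2) \<le> sqrt (real k) ^ k * exp (- real k / 2)"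
    unfolding pw ek by (intro mult_left_mono) auto
  assume "r \<noteq> sqrt (real k)"
  then have "u \<noteq> 1" using r by auto
  then have "0 < (u - 1)\<^sup>2" by simp
  then have "u < (1 + u\<^sup>2) / 2" by (simp add: power2_diff field_simps)
  then have "u * exp (- u\<^sup>2 / 2) < exp ((u\<^sup>2 - 1) / 2) * exp (- u\<^sup>2 / 2)"
    using le by (intro mult_strict_right_mono) auto
  then have "(u * exp (- u\<^sup>2 / 2)) ^ k < exp (- 1 / 2) ^ k"
    using u0 assms(2) unfolding split by (intro power_strict_mono) auto
  then show "r ^ k * exp (- r\<^sup>2 / 2) < sqrt (real k) ^ k * exp (- real k / 2)"
    unfolding pw ek using assms(2) by (intro mult_strict_left_mono) auto
qed

section \<open>Maxima of the Gaussian-weighted form and critical points\<close>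

locale nonzero_form =
  fixes k :: nat and \<Lambda> :: "('c::finite \<Rightarrow> nat) \<Rightarrow> real"
  assumes k3: "k \<ge> 3" and nonzero: "\<exists>w\<in>multi_indices k. \<Lambda> w \<noteq> 0"
begin

abbreviation V :: "real^'c \<Rightarrow> real" where "V \<equiv> real_form k \<Lambda>"
abbreviation dV :: "'c \<Rightarrow> real^'c \<Rightarrow> real" where "dV \<equiv> dform k \<Lambda>"
abbreviation ddV :: "'c \<Rightarrow> 'c \<Rightarrow> real^'c \<Rightarrow> real" where "ddV \<equiv> ddform k \<Lambda>"

definition M :: real where "M = Sup ((\<lambda>x. \<bar>V x\<bar>) ` sphere 0 1)"

definition X :: "(real^'c) set" where "X = {x. norm x = 1 \<and> \<bar>V x\<bar> = M}"

definition \<phi> :: "real^'c \<Rightarrow> real" where "\<phi> y = V y * exp (- (y \<bullet> y) / 2)"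

text \<open>\<open>G\<close> and \<open>F\<close> are the gradient and the Hessian of
  \<open>\<phi>\<close>, written out so that symmetry and continuity can be read off from the
  entries.\<close>

definition G :: "real^'c \<Rightarrow> real^'c"
  where "G y = (\<chi> i. (dV i y - y $ i * V y) * exp (- (y \<bullet> y) / 2))"

definition F :: "real^'c \<Rightarrow> real^'c^'c"
  where "F y = (\<chi> i j. (ddV i j y - y $ i * dV j y - y $ j * dV i y - (if i =
      j then V y else 0) + y $ i * y $ j * V y)
     * exp (- (y \<bullet> y) / 2))"

text \<open>The maximum of |\<phi>|: the largest value of |V| on the sphere times the radial factor
  at its peak, the radius sqrt k.\<close>

definition m :: real where "m = M * (sqrt k ^ k * exp (- k / 2))"

definition Y :: "(real^'c) set" where "Y = {y. \<bar>\<phi> y\<bar> = m}"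

section \<open>The maximum of the weighted form and its critical equations\<close>

lemma V_le_M: "norm x = 1 \<Longrightarrow> \<bar>V x\<bar> \<le> M"
  and X_nonempty: "X \<noteq> {}"
proof -
  have cont: "continuous_on (sphere 0 1) (\<lambda>x. \<bar>V x\<bar>)"
    by (intro continuous_intros continuous_at_imp_continuous_on ballI continuous_real_form)
  have ne: "(axis undefined 1 :: real^'c) \<in> sphere 0 1" by (simp add: norm_axis_1)
  obtain u where u: "u \<in> sphere 0 1" "\<And>x. x \<in> sphere 0 1 \<Longrightarrow> \<bar>V x\<bar> \<le> \<bar>V u\<bar>"
    using continuous_attains_sup[OF compact_sphere _ cont] ne by blast
  have M: "M = \<bar>V u\<bar>" unfolding M_def using u by (intro cSup_eq_maximum) auto
  show "norm x = 1 \<Longrightarrow> \<bar>V x\<bar> \<le> M" using u(2)[of x] M by simp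
  have "u \<in> X" using u(1) M by (simp add: X_def)
  then show "X \<noteq> {}" by auto
qed

lemma V_bound: "\<bar>V y\<bar> \<le> norm y ^ k * M"
proof (cases "y = 0")
  case True
  moreover have "V 0 = 0" using real_form_scaleR[of k \<Lambda> 0 0] k3 by (simp add: power_0_left)
  ultimately show ?thesis using k3 by (simp add: power_0_left)
next
  case False
  have "V y = norm y ^ k * V ((1 / norm y) *\<^sub>R y)"
    using False real_form_scaleR[of k \<Lambda> "norm y" "(1 / norm y) *\<^sub>R y"] by simp
  moreover have "\<bar>V ((1 / norm y) *\<^sub>R y)\<bar> \<le> M" using False by (intro V_le_M) simp
  ultimately show ?thesis by (simp add: abs_mult mult_left_mono)
qed

lemma M_pos: "M > 0"
proof -
  obtain x where "V x \<noteq> 0" using nonzero real_form_nonzero by blast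
  then have "0 < norm x ^ k * M" using V_bound[of x] by linarith
  then show ?thesis by (simp add: zero_less_mult_iff)
qed

lemma m_pos: "m > 0" using M_pos k3 by (simp add: m_def)

lemma phi_eq: "\<bar>\<phi> y\<bar> = \<bar>V y\<bar> * exp (- (norm y)\<^sup>2 / 2)"
  by (simp add: \<phi>_def abs_mult dot_square_norm)

lemma phi_le: "\<bar>\<phi> y\<bar> \<le> M * (norm y ^ k * exp (- (norm y)\<^sup>2 / 2))"
proof -
  have "\<bar>V y\<bar> * exp (- (norm y)\<^sup>2 / 2) \<le> norm y ^ k * M * exp (- (norm y)\<^sup>2 / 2)"
    using V_bound by (intro mult_right_mono) auto
  then show ?thesis unfolding phi_eq by (simp add: mult_ac)
qed

lemma phi_le_m: "\<bar>\<phi> y\<bar> \<le> m"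
proof -
  have "M * (norm y ^ k * exp (- (norm y)\<^sup>2 / 2)) \<le> M * (sqrt k ^ k * exp (- k / 2))"
    using radial_bound(1)[of "norm y" k] k3 M_pos by (intro mult_left_mono) auto
  then show ?thesis using phi_le[of y] by (simp add: m_def)
qed

text \<open>By homogeneity the bound on |\<phi>| is a product of an angular and a radial bound.
  Equality forces equality in both, and the radial bound is strict away from sqrt k.\<close>

lemma Y_eq: "Y = (\<lambda>x. sqrt k *\<^sub>R x) ` X"
proof (intro equalityI subsetI)
  fix y assume "y \<in> Y"
  then have y: "\<bar>\<phi> y\<bar> = m" by (simp add: Y_def)
  have n: "norm y = sqrt k"
  proof (rule ccontr)
    assume "norm y \<noteq> sqrt k"
    then have "M * (norm y ^ k * exp (- (norm y)\<^sup>2 / 2)) < M * (sqrt k ^ k * exp (- k / 2))"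
      using radial_bound(2)[of "norm y" k] k3 M_pos by (intro mult_strict_left_mono) auto
    then show False using phi_le[of y] y by (simp add: m_def)
  qed
  define x where "x = (1 / sqrt k) *\<^sub>R y"
  have yx: "y = sqrt k *\<^sub>R x" using k3 by (simp add: x_def)
  have "norm x = 1" using n k3 by (simp add: x_def)
  moreover have "\<bar>V x\<bar> = M"
  proof -
    have "sqrt k ^ k * \<bar>V x\<bar> * exp (- k / 2) = M * (sqrt k ^ k * exp (- k / 2))"
      using y n unfolding phi_eq m_def by (simp add: yx real_form_scaleR abs_mult \<open>norm x = 1\<close>)
    then show ?thesis using k3 by simp
  qed
  ultimately show "y \<in> (\<lambda>x. sqrt k *\<^sub>R x) ` X" using yx by (auto simp: X_def)
next
  fix y assume "y \<in> (\<lambda>x. sqrt k *\<^sub>R x) ` X"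
  then show "y \<in> Y" using k3 by (auto simp: Y_def X_def phi_eq real_form_scaleR abs_mult m_def)
qed

lemma deriv_phi: "(\<phi> has_derivative (\<lambda>h. G y \<bullet> h)) (at y)"
proof -
  have "(\<phi> has_derivative (\<lambda>h. V y * (- (y \<bullet> h) * exp (- (y \<bullet> y) / 2)) +
      (\<Sum>i\<in>UNIV. h $ i * dV i y) * exp (- (y \<bullet> y) / 2))) (at y)"
    unfolding \<phi>_def[abs_def] by (intro has_derivative_mult has_derivative_real_form
        has_derivative_exp_norm_square)
  moreover have "V y * (- (y \<bullet> h) * exp (- (y \<bullet> y) / 2)) + (\<Sum>i\<in>UNIV. h $ i * dV i y) *
      exp (- (y \<bullet> y) / 2) = G y \<bullet> h" for h
  proof -
    have "G y \<bullet> h = (\<Sum>i\<in>UNIV. (h $ i * dV i y - V y * (y $ i * h $ i)) * exp (- (y \<bullet> y) / 2))"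
      by (simp add: G_def inner_vec_def algebra_simps)
    also have "\<dots> = ((\<Sum>i\<in>UNIV. h $ i * dV i y) - V y * (y \<bullet> h)) * exp (- (y \<bullet> y) / 2)"
      by (simp add: inner_vec_def sum_distrib_right[symmetric] sum_subtractf sum_distrib_left[symmetric])
    finally show ?thesis by (simp add: algebra_simps)
  qed
  ultimately show ?thesis by simp
qed

lemma deriv_G: "(G has_derivative (\<lambda>h. F y *v h)) (at y)"
proof (rule has_derivative_vecI)
  fix i
  let ?e = "exp (- (y \<bullet> y) / 2)"
  have coord: "((\<lambda>x. x $ i) has_derivative (\<lambda>h. h $ i)) (at y)"
    by (rule bounded_linear.has_derivative[OF bounded_linear_vec_nth has_derivative_ident])
  have "((\<lambda>x. (dV i x - x $ i * V x) * exp (- (x \<bullet> x) / 2)) has_derivative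
     (\<lambda>h. (dV i y - y $ i * V y) * (- (y \<bullet> h) * ?e) +
       ((\<Sum>j\<in>UNIV. h $ j * ddV j i y) - (y $ i * (\<Sum>j\<in>UNIV. h $ j * dV j y) + h $ i * V y)) * ?e)) (at y)"
    by (intro has_derivative_mult has_derivative_diff has_derivative_dform coord has_derivative_real_form
        has_derivative_exp_norm_square)
  moreover have "(dV i y - y $ i * V y) * (- (y \<bullet> h) * ?e) +
       ((\<Sum>j\<in>UNIV. h $ j * ddV j i y) - (y $ i * (\<Sum>j\<in>UNIV. h $ j * dV j y) + h $ i * V y)) * ?e =
           (F y *v h) $ i" for h
  proof -
    have "(F y *v h) $ i = (\<Sum>j\<in>UNIV. (h $ j * ddV j i y - y $ i * (h $ j * dV j y) - dV i y *
        (y $ j * h $ j)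
        - (if i = j then h $ j * V y else 0) + y $ i * V y * (y $ j * h $ j)) * ?e)"
      unfolding F_def matrix_vector_mult_def
          by (auto simp: algebra_simps ddform_commute[of k \<Lambda> _ i] intro!: sum.cong)
    also have "\<dots> = ((\<Sum>j\<in>UNIV. h $ j * ddV j i y) - y $ i * (\<Sum>j\<in>UNIV. h $ j * dV j y) - dV i y * (y \<bullet> h)
        - h $ i * V y + y $ i * V y * (y \<bullet> h)) * ?e"
      by (simp add: inner_vec_def sum_distrib_right[symmetric] sum_subtractf sum.distrib
          sum_distrib_left[symmetric])
    finally show ?thesis by (simp add: algebra_simps)
  qed
  ultimately show "((\<lambda>x. G x $ i) has_derivative (\<lambda>h. (F y *v h) $ i)) (at y)"
    by (simp add: G_def)
qed

lemma isCont_F: "isCont F y"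
  unfolding isCont_def F_def[abs_def]
  by (intro tendsto_intros continuous_real_form[unfolded isCont_def]) (auto intro!: tendsto_intros
      continuous_real_form[unfolded isCont_def])

lemma sym_F: "transpose (F y) = F y"
  unfolding F_def transpose_def vec_eq_iff by (simp add: ddform_commute algebra_simps)

lemma phi_at_infinity: "(\<phi> \<longlongrightarrow> 0) at_infinity"
proof (rule Lim_null_comparison)
  have "((\<lambda>r. M * (r ^ k / exp r)) \<longlongrightarrow> M * 0) at_top"
    by (intro tendsto_mult tendsto_const tendsto_power_div_exp_0)
  then show "((\<lambda>y :: real^'c. M * (norm y ^ k / exp (norm y))) \<longlongrightarrow> 0) at_infinity"
    using filterlim_compose[OF _ filterlim_norm_at_top] by simp
  show "\<forall>\<^sub>F y in at_infinity. norm (\<phi> y) \<le> M * (norm y ^ k / exp (norm y))"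
    unfolding eventually_at_infinity
  proof (intro exI[of _ 2] allI impI)
    fix y :: "real^'c" assume y: "norm y \<ge> 2"
    \<comment> \<open>From radius 2 on, half the square of the norm exceeds the norm, so the
      Gaussian is below exp (- norm y).\<close>
    then have "norm y * 2 \<le> norm y * norm y" by (intro mult_left_mono) auto
    then have "exp (- (norm y)\<^sup>2 / 2) \<le> exp (- norm y)" by (simp add: power2_eq_square)
    then have "M * (norm y ^ k * exp (- (norm y)\<^sup>2 / 2)) \<le> M * (norm y ^ k * exp (- norm y))"
      using M_pos by (intro mult_left_mono) auto
    then show "norm (\<phi> y) \<le> M * (norm y ^ k / exp (norm y))"
      using phi_le[of y] unfolding real_norm_def divide_inverse exp_minus[symmetric] by linarith
  qed
qed

lemma phi_eq_gauss: "\<phi> y = sqrt (2 * pi) ^ CARD('c) * (std_gauss y * V y)"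
  unfolding \<phi>_def std_gauss_eq by (simp add: mult_ac)

lemma phi_integrable: "integrable lborel \<phi>"
  using graph_sum_eq_gauss_integral(1)[of k \<Lambda> 1] unfolding phi_eq_gauss[abs_def] by simp

lemma V_nonzero: "x \<in> X \<Longrightarrow> V x \<noteq> 0"
  using M_pos by (auto simp: X_def)

text \<open>Only |\<phi>| is known to be maximal; after division by the value at \<open>y\<close>
  the signed function has a genuine maximum there.\<close>

lemma G_zero: assumes "y \<in> Y" shows "G y = 0"
proof -
  have nz: "\<phi> y \<noteq> 0" using assms m_pos by (auto simp: Y_def)
  have d: "((\<lambda>x. \<phi> x / \<phi> y) has_derivative (\<lambda>h. (G y \<bullet> h) / \<phi> y)) (at y)"
    using has_derivative_mult_right[OF deriv_phi, of "1 / \<phi> y" y] by simp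
  have "\<phi> x / \<phi> y \<le> 1" for x
  proof -
    have "\<phi> x / \<phi> y \<le> \<bar>\<phi> x / \<phi> y\<bar>" by (rule abs_ge_self)
    also have "\<dots> \<le> 1" using assms phi_le_m[of x] m_pos by (simp add: Y_def abs_divide)
    finally show ?thesis .
  qed
  then have "(\<lambda>h. (G y \<bullet> h) / \<phi> y) = (\<lambda>v. 0)"
    by (intro differential_zero_maxmin[OF _ open_UNIV d]) (use nz in auto)
  then have "G y \<bullet> G y = 0" using nz by (metis divide_eq_0_iff)
  then show ?thesis by simp
qed

text \<open>The Lagrange equation for an extremum of \<open>V\<close> on the sphere. It is read off
  from the vanishing gradient of \<open>\<phi>\<close> at sqrt k x, where homogeneity produces the
  multiplier k V(x).\<close>

lemma dV_X: assumes "x \<in> X" shows "dV i x = k * x $ i * V x"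
proof -
  let ?y = "sqrt k *\<^sub>R x"
  have "G ?y = 0" using assms by (intro G_zero) (auto simp: Y_eq)
  then have "G ?y $ i = 0" by simp
  then have "sqrt k ^ (k - 1) * dV i x = sqrt k * x $ i * (sqrt k ^ k * V x)"
    by (simp add: G_def dform_scaleR real_form_scaleR)
  also have "\<dots> = sqrt k ^ (k - 1) * (k * x $ i * V x)"
    using k3 by (simp add: power_eq_if[of "sqrt (real k)" k])
  finally show ?thesis using k3 by simp
qed

end

section \<open>Determinant identities\<close>

lemma det_of_real: "det (\<chi> i j. complex_of_real (A $ i $ j)) = complex_of_real (det A)"
  for A :: "real^'n^'n"
  by (simp add: det_def)

text \<open>In an orthonormal basis containing x the matrix is diagonal, with the entry 1 - u at x
  and 1 elsewhere. The orthogonal matrix \<open>A\<close> carries the basis vector at an arbitrary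
  index \<open>e\<close> to x.\<close>

lemma det_rank_one:
  fixes x :: "real^'n"
  assumes "norm x = 1"
  shows "det (mat 1 - u *\<^sub>R (\<chi> i j. x $ i * x $ j)) = 1 - u"
proof -
  obtain e :: 'n where True by simp
  obtain A where A: "orthogonal_matrix A" "A *v axis e 1 = x"
    using orthogonal_matrix_exists_basis[OF assms] by blast
  define D :: "real^'n^'n" where "D = (\<chi> i j. if i = j then (if i = e then 1 - u else 1) else 0)"
  have D: "D *v w = w - (u * w $ e) *\<^sub>R axis e 1" for w
  proof -
    have "(D *v w) $ i = (if i = e then 1 - u else 1) * w $ i" for i
    proof -
      have "(D *v w) $ i = (\<Sum>j\<in>UNIV. if i = j then (if i = e then 1 - u else 1) * w $ j else 0)"
        unfolding matrix_vector_mult_def D_def vec_lambda_beta by (rule sum.cong) auto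
      then show ?thesis by simp
    qed
    then show ?thesis by (simp add: vec_eq_iff axis_def algebra_simps)
  qed
  have AAT: "A ** transpose A = mat 1" using A(1) by (simp add: orthogonal_matrix_def)
  have "mat 1 - u *\<^sub>R (\<chi> i j. x $ i * x $ j) = A ** D ** transpose A"
    unfolding matrix_eq
  proof
    fix v
    have "(transpose A *v v) $ e = (transpose A *v v) \<bullet> axis e 1" by (simp add: inner_axis)
    also have "\<dots> = v \<bullet> (A *v axis e 1)" by (metis dot_lmul_matrix transpose_matrix_vector)
    finally have e: "(transpose A *v v) $ e = v \<bullet> x" using A(2) by simp
    have "(A ** D ** transpose A) *v v = A *v (D *v (transpose A *v v))"
      by (simp only: matrix_vector_mul_assoc matrix_mul_assoc)
    also have "\<dots> = v - (u * (v \<bullet> x)) *\<^sub>R x"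
      unfolding D e unfolding matrix_vector_mult_diff_distrib matrix_vector_mult_scaleR A(2)
      unfolding matrix_vector_mul_assoc AAT by simp
    also have "\<dots> = (mat 1 - u *\<^sub>R (\<chi> i j. x $ i * x $ j)) *v v"
      by (simp add: vec_eq_iff matrix_vector_mult_diff_rdistrib scaleR_matrix_vector_assoc[symmetric])
         (simp add: matrix_vector_mult_def inner_vec_def sum_distrib_left sum_distrib_right mult_ac)
    finally show "(mat 1 - u *\<^sub>R (\<chi> i j. x $ i * x $ j)) *v v = (A ** D ** transpose A) *v v" by simp
  qed
  then have "det (mat 1 - u *\<^sub>R (\<chi> i j. x $ i * x $ j)) = det A * det D * det A"
    by (simp add: det_mul)
  also have "det D = 1 - u"
    by (subst det_diagonal) (auto simp: D_def prod.delta')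
  also have "det A * (1 - u) * det A = (1 - u) * (det A * det (transpose A))" by simp
  also have "det A * det (transpose A) = 1"
    using arg_cong[OF AAT, of det] unfolding det_mul by simp
  finally show ?thesis by simp
qed

lemma det_uminus: "det (- A) = (-1) ^ CARD('n) * det A" for A :: "real^'n^'n"
  unfolding det_def by (simp add: sum_distrib_left prod_uminus mult_ac)

context nonzero_form
begin

abbreviation g :: "complex^'c \<Rightarrow> complex" where "g \<equiv> action_poly k \<Lambda>"

text \<open>The Hessian of \<open>g\<close> at \<tau>x for every root \<open>\<tau>\<close> over x.
  It is real and common to all the roots because \<open>\<tau> ^ (k - 2)\<close> has been replaced
  by its value 1 / (k V(x)).\<close>

definition H :: "real^'c \<Rightarrow> real^'c^'c"
  where "H x = (\<chi> i j. - (if i = j then 1 else 0) + ddV i j x / (k * V x))"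

definition roots :: "real^'c \<Rightarrow> complex set"
  where "roots x = {\<tau>. \<tau> ^ (k - 2) = complex_of_real (1 / (k * V x))}"

text \<open>The radicand of the asymptotic formula, as a real number attached to x instead of to the
  critical point.\<close>

definition D :: "real^'c \<Rightarrow> real"
  where "D x = (-1) ^ (CARD('c) - 1) * det (H x)"

lemma card_roots: "x \<in> X \<Longrightarrow> card (roots x) = k - 2"
  unfolding roots_def using V_nonzero[of x] k3 by (intro card_nth_roots) auto

lemma roots_nonzero: "x \<in> X \<Longrightarrow> \<tau> \<in> roots x \<Longrightarrow> \<tau> \<noteq> 0"
  using V_nonzero[of x] k3 by (auto simp: roots_def power_0_left)

lemma norm_roots: "x \<in> X \<Longrightarrow> \<tau> \<in> roots x \<Longrightarrow> norm \<tau> ^ (k - 2) = 1 / (k * M)"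
  unfolding roots_def X_def by (auto simp: norm_power[symmetric] norm_divide norm_mult abs_mult)

lemma roots_mult: "x \<in> X \<Longrightarrow> \<tau> \<in> roots x \<Longrightarrow> \<tau> ^ (k - 2) * of_real (k * V x) = 1"
  using V_nonzero[of x] k3 by (simp add: roots_def)

text \<open>By Euler's identity and \<open>dV_X\<close>, the second derivatives contribute k - 1
  along x, and the identity matrix subtracts 1.\<close>

lemma H_mult_self: assumes "x \<in> X" shows "H x *v x = real (k - 2) *\<^sub>R x"
proof -
  have "(H x *v x) $ i = real (k - 2) * x $ i" for i
  proof -
    have "(H x *v x) $ i = (\<Sum>j\<in>UNIV. - (if i = j then x $ j else 0) + (x $ j * ddV j i x) / (k * V x))"
      unfolding H_def matrix_vector_mult_def
      by (auto simp: ddform_commute[of k \<Lambda> _ i] algebra_simps intro!: sum.cong)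
    also have "\<dots> = - x $ i + (\<Sum>j\<in>UNIV. x $ j * ddV j i x) / (k * V x)"
      by (simp add: sum_subtractf sum_divide_distrib)
    also have "\<dots> = - x $ i + real (k - 1) * x $ i"
      unfolding euler_dform dV_X[OF assms] using V_nonzero[OF assms] k3 by simp
    also have "\<dots> = real (k - 2) * x $ i"
      using k3 by (simp add: of_nat_diff algebra_simps)
    finally show ?thesis .
  qed
  then show ?thesis by (simp add: vec_eq_iff)
qed

text \<open>At y = sqrt k x the vanishing gradient gives dV = y V, which leaves only -y y^T V of the
  three rank-one terms of \<open>F\<close>. Homogeneity then replaces y by x, the factor k arising
  from y y^T = k x x^T and from the quotient of second derivatives by V.\<close>

lemma phi_Hessian:
  assumes x: "x \<in> X"
  defines "y \<equiv> sqrt k *\<^sub>R x"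
  shows "(- 1 / \<phi> y) *\<^sub>R F y = - H x + real k *\<^sub>R (\<chi> i j. x $ i * x $ j)"
proof -
  let ?p = "sqrt (real k) ^ (k - 2)" and ?e = "exp (- (y \<bullet> y) / 2)"
  have kk: "k = Suc (Suc (k - 2))" using k3 by simp
  have pk: "sqrt (real k) ^ k = ?p * k"
    by (subst kk, simp only: power_Suc) (simp add: mult_ac)
  have pk1: "sqrt (real k) ^ (k - 1) = ?p * sqrt (real k)"
    by (subst kk) simp
  have Vy: "V y = ?p * k * V x" by (simp add: y_def real_form_scaleR pk)
  have dVy: "dV i y = y $ i * V y" for i
    unfolding Vy unfolding y_def dform_scaleR pk1 dV_X[OF x] by simp
  have ddVy: "ddV i j y = ?p * ddV i j x" for i j by (simp add: y_def ddform_scaleR)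
  have Vx: "V x \<noteq> 0" by (rule V_nonzero[OF x])
  have p: "?p \<noteq> 0" using k3 by simp
  have "((- 1 / \<phi> y) *\<^sub>R F y) $ i $ j = (- H x + real k *\<^sub>R (\<chi> i j. x $ i * x $ j)) $ i $ j" for i j
  proof -
    have "F y $ i $ j = (ddV i j y - (if i = j then V y else 0) - y $ i * y $ j * V y) * ?e"
      by (simp add: F_def dVy algebra_simps)
    then have "((- 1 / \<phi> y) *\<^sub>R F y) $ i $ j =
        (- 1 / (V y * ?e)) * ((ddV i j y - (if i = j then V y else 0) - y $ i * y $ j * V y) * ?e)"
      by (simp add: \<phi>_def)
    also have "\<dots> = - (ddV i j y - (if i = j then V y else 0) - y $ i * y $ j * V y) / V y"
    proof -
      have "(- 1 / (b * ?e)) * (a * ?e) = - a / b" for a b by simp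
      then show ?thesis .
    qed
    also have "\<dots> = - (ddV i j y / V y) + (if i = j then 1 else 0) + y $ i * y $ j"
      using Vx p k3 by (simp add: Vy field_simps)
    also have "ddV i j y / V y = ddV i j x / (k * V x)"
      using p by (simp add: ddVy Vy)
    also have "y $ i * y $ j = k * (x $ i * x $ j)"
      by (simp add: y_def)
    finally show ?thesis by (simp add: H_def)
  qed
  then show ?thesis by (simp add: vec_eq_iff)
qed

text \<open>Because H x x^T = (k - 2) x x^T, the rank-one correction factors as -H (1 - u x x^T)
  with u = k / (k - 2). The second factor has the determinant -2 / (k - 2), and its sign lowers the
  exponent of -1 from c to c - 1.\<close>

lemma det_phi_Hessian:
  assumes x: "x \<in> X"
  shows "det ((- 1 / \<phi> (sqrt k *\<^sub>R x)) *\<^sub>R F (sqrt k *\<^sub>R x)) = 2 / (k - 2) * D x"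
proof -
  let ?R = "\<chi> i j. x $ i * x $ j"
  define u where "u = real k / (k - 2)"
  have k2: "real (k - 2) = real k - 2" "real k - 2 > 0" using k3 by (auto simp: of_nat_diff)
  have "H x ** ?R = real (k - 2) *\<^sub>R ?R"
  proof -
    have "(H x ** ?R) $ i $ j = (H x *v x) $ i * x $ j" for i j
      by (simp add: matrix_matrix_mult_def matrix_vector_mult_def sum_distrib_left mult_ac)
    then show ?thesis unfolding H_mult_self[OF x] by (simp add: vec_eq_iff)
  qed
  then have "- H x + real k *\<^sub>R ?R = (- H x) ** (mat 1 - u *\<^sub>R ?R)"
  proof -
    have "((- H x) ** (mat 1 - u *\<^sub>R ?R)) $ i $ j = - H x $ i $ j + u * (H x ** ?R) $ i $ j" for i j
    proof -
      have "((- H x) ** (mat 1 - u *\<^sub>R ?R)) $ i $ j =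
          (\<Sum>l\<in>UNIV. (if l = j then - H x $ i $ l else 0) + u * (H x $ i $ l * (x $ l * x $ j)))"
        unfolding matrix_matrix_mult_def mat_def by (auto simp: algebra_simps intro!: sum.cong)
      then show ?thesis by (simp add: sum.distrib matrix_matrix_mult_def sum_distrib_left)
    qed
    then show ?thesis unfolding \<open>H x ** ?R = _\<close> using k2 by (simp add: vec_eq_iff u_def)
  qed
  then have "det ((- 1 / \<phi> (sqrt k *\<^sub>R x)) *\<^sub>R F (sqrt k *\<^sub>R x)) = det (- H x) * det (mat 1 - u *\<^sub>R ?R)"
    unfolding phi_Hessian[OF x] by (simp add: det_mul)
  also have "\<dots> = (-1) ^ CARD('c) * det (H x) * (1 - u)"
    using x by (simp add: det_uminus det_rank_one X_def)
  also have "(-1) ^ CARD('c) = (-1) * (-1 :: real) ^ (CARD('c) - 1)"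
    by (subst power_Suc[symmetric]) simp
  also have "1 - u = - 2 / (k - 2)"
    using k2 by (simp add: u_def field_simps)
  finally show ?thesis by (simp add: D_def)
qed

lemma Hess_at_root:
  assumes "x \<in> X" "\<tau> \<in> roots x"
  shows "Hess g (cscale \<tau> x) = (\<chi> i j. complex_of_real (H x $ i $ j))"
  using assms(2) unfolding Hess_action_poly_cscale by (simp add: vec_eq_iff H_def roots_def)

text \<open>The homogeneous part of \<open>g\<close> has the value \<tau>^2 / k at the critical
  point, against \<tau>^2 / 2 from the quadratic part; the constant is 1 / 2 - 1 / k.\<close>

lemma neg_g_at_root:
  assumes "x \<in> X" "\<tau> \<in> roots x"
  shows "- g (cscale \<tau> x) = \<tau>\<^sup>2 * of_real ((real k - 2) / (2 * k))"
proof -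
  have "norm x = 1" using assms by (simp add: X_def)
  have "\<tau> ^ k = \<tau>\<^sup>2 * \<tau> ^ (k - 2)" 
  proof -
    have "2 + (k - 2) = k" using k3 by simp
    then show ?thesis using power_add[of \<tau> 2 "k - 2"] by simp
  qed
  moreover have "\<tau> ^ (k - 2) * of_real (V x) = 1 / of_nat k"
    using roots_mult[OF assms] k3 by (simp add: field_simps)
  ultimately have "\<tau> ^ k * of_real (V x) = \<tau>\<^sup>2 / of_nat k" by (simp add: mult.assoc)
  then show ?thesis
    unfolding action_poly_cscale[OF \<open>norm x = 1\<close>] using k3 by (simp add: field_simps)
qed

text \<open>The root disappears from the term: since 2 l = n (k - 2), the l-th power of \<tau>^2 is
  the n-th power of the real number \<open>\<tau> ^ (k - 2)\<close>. Positivity of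
  \<open>D x\<close> identifies the principal complex root with the real one.\<close>

lemma crit_term_at_root:
  assumes x: "x \<in> X" "\<tau> \<in> roots x" and l: "2 * l = n * (k - 2)" and "D x > 0"
  shows "crit_term g l (cscale \<tau> x) = of_real ((2 * k / (k - 2)) ^ l * (k * V x) ^ n / sqrt (D x))"
proof -
  have k2: "real (k - 2) = real k - 2" "real k - 2 > 0" using k3 by (auto simp: of_nat_diff)
  have "(\<tau>\<^sup>2) ^ l = (\<tau> ^ (k - 2)) ^ n"
    unfolding power_mult[symmetric] using l by (simp add: mult.commute)
  also have "\<dots> = of_real (1 / (k * V x) ^ n)" using x(2) by (simp add: roots_def power_one_over)
  finally have tau: "(\<tau>\<^sup>2) ^ l = of_real (1 / (k * V x) ^ n)" .
  have "(- g (cscale \<tau> x)) powi (- int l) = inverse ((- g (cscale \<tau> x)) ^ l)"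
    by (simp add: power_int_minus)
  also have "\<dots> = of_real (inverse (1 / (k * V x) ^ n * ((real k - 2) / (2 * k)) ^ l))"
    unfolding neg_g_at_root[OF x] power_mult_distrib tau by simp
  also have "inverse (1 / (k * V x) ^ n * ((real k - 2) / (2 * k)) ^ l) =
      (2 * k / (real k - 2)) ^ l * (k * V x) ^ n"
    by (simp add: inverse_eq_divide power_divide)
  finally have num: "(- g (cscale \<tau> x)) powi (- int l) =
      of_real ((2 * k / (real k - 2)) ^ l * (k * V x) ^ n)" .
  have "(-1) ^ (CARD('c) - 1) * det (Hess g (cscale \<tau> x)) = of_real (D x)"
    unfolding Hess_at_root[OF x] det_of_real by (simp add: D_def)
  then have "csqrt ((-1) ^ (CARD('c) - 1) * det (Hess g (cscale \<tau> x))) = of_real (sqrt (D x))"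
    using \<open>D x > 0\<close> by simp
  then show ?thesis unfolding crit_term_def num k2 by simp
qed

section \<open>Critical pairs and the description of \<Psi>\<close>

lemma crit_pairs_iff:
  "(\<tau>, x) \<in> crit_pairs g \<longleftrightarrow> \<tau> \<noteq> 0 \<and> norm x = 1 \<and> (\<forall>i. \<tau> ^ (k - 2) * of_real (dV i x) = of_real (x $ i))"
proof -
  have "partial i g (cscale \<tau> x) = 0 \<longleftrightarrow> \<tau> ^ (k - 2) * of_real (dV i x) = of_real (x $ i)" if "\<tau> \<noteq> 0" for i
  proof -
    have "k - 1 = Suc (k - 2)" using k3 by simp
    then have "\<tau> ^ (k - 1) = \<tau> * \<tau> ^ (k - 2)" by (simp only: power_Suc)
    then have "partial i g (cscale \<tau> x) = \<tau> * (\<tau> ^ (k - 2) * of_real (dV i x) - of_real (x $ i))"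
      unfolding partial_action_poly_cscale by (simp add: algebra_simps)
    then show ?thesis using that by simp
  qed
  then show ?thesis by (auto simp: crit_pairs_def)
qed

text \<open>The critical equations are contracted with the unit vector x, and Euler's identity
  collects the derivatives into k V(x).\<close>

lemma crit_pairs_euler:
  assumes "(\<tau>, x) \<in> crit_pairs g"
  shows "\<tau> ^ (k - 2) * of_real (k * V x) = 1"
proof -
  have x: "norm x = 1" and c: "\<And>i. \<tau> ^ (k - 2) * of_real (dV i x) = of_real (x $ i)"
    using assms by (auto simp: crit_pairs_iff)
  have "\<tau> ^ (k - 2) * of_real (k * V x) = (\<Sum>i\<in>UNIV. of_real (x $ i) * (\<tau> ^ (k - 2) * of_real (dV i x)))"
    unfolding euler_form[symmetric] by (simp add: sum_distrib_left mult_ac)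
  also have "\<dots> = of_real (\<Sum>i\<in>UNIV. x $ i * x $ i)" unfolding c by simp
  also have "(\<Sum>i\<in>UNIV. x $ i * x $ i) = x \<bullet> x" by (simp add: inner_vec_def)
  also have "\<dots> = 1" using x by (simp add: dot_square_norm)
  finally show ?thesis by simp
qed

lemma crit_pairs_of_root:
  assumes "x \<in> X" "\<tau> \<in> roots x"
  shows "(\<tau>, x) \<in> crit_pairs g"
proof -
  have "\<tau> ^ (k - 2) * of_real (dV i x) = of_real (x $ i)" for i
  proof -
    have "\<tau> ^ (k - 2) * of_real (dV i x) = of_real (x $ i) * (\<tau> ^ (k - 2) * of_real (k * V x))"
      unfolding dV_X[OF assms(1)] by simp
    then show ?thesis unfolding roots_mult[OF assms] by simp
  qed
  then show ?thesis using roots_nonzero[OF assms] assms(1) by (auto simp: crit_pairs_iff X_def)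
qed

lemma norm_crit_pairs:
  assumes "(\<tau>, x) \<in> crit_pairs g"
  shows "norm \<tau> ^ (k - 2) * (k * \<bar>V x\<bar>) = 1"
  using arg_cong[OF crit_pairs_euler[OF assms], of norm] by (simp add: norm_mult norm_power abs_mult)

text \<open>Each point of \<open>\<Psi>\<close> arises from exactly two pairs, since \<open>\<tau>x = (-\<tau>)(-x)\<close>.\<close>

definition root_pairs :: "((real^'c) \<times> complex) set" where "root_pairs = Sigma X roots"

text \<open>Every critical pair satisfies |\<tau>|^(k - 2) = 1 / (k |V(x)|), so minimizing |\<tau>|
  means maximizing |V(x)| on the sphere. Pairs over maximizers do occur, since \<open>dV_X\<close>
  solves the critical equations there.\<close>

lemma Psi_eq: "Psi g = (\<lambda>(x, \<tau>). cscale \<tau> x) ` root_pairs"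
proof -
  obtain x0 where x0: "x0 \<in> X" using X_nonempty by auto
  obtain \<tau>0 where \<tau>0: "\<tau>0 \<in> roots x0" 
  proof -
    have "card (roots x0) \<noteq> 0" using card_roots[OF x0] k3 by simp
    then show ?thesis using that by fastforce
  qed
  have minimal: "norm \<tau> \<le> norm \<tau>'" if "x \<in> X" "\<tau> \<in> roots x" "(\<tau>', x') \<in> crit_pairs g" for x \<tau> \<tau>' x'
  proof -
    have "norm x' = 1" using that(3) by (simp add: crit_pairs_iff)
    from V_le_M[OF this] have "k * \<bar>V x'\<bar> \<le> k * M" by (rule mult_left_mono) simp
    then have "norm \<tau>' ^ (k - 2) * (k * \<bar>V x'\<bar>) \<le> norm \<tau>' ^ (k - 2) * (k * M)"
      by (rule mult_left_mono) simp
    then have "1 \<le> norm \<tau>' ^ (k - 2) * (k * M)" unfolding norm_crit_pairs[OF that(3)] .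
    then have "norm \<tau> ^ (k - 2) \<le> norm \<tau>' ^ (k - 2)"
      unfolding norm_roots[OF that(1,2)] using M_pos k3 by (simp add: field_simps)
    then show ?thesis using k3 by (simp add: power_mono_iff)
  qed
  show ?thesis
  proof (intro equalityI subsetI)
    fix z assume "z \<in> Psi g"
    then obtain \<tau> x where z: "z = cscale \<tau> x" "(\<tau>, x) \<in> crit_pairs g"
      and all: "\<forall>(\<tau>', x')\<in>crit_pairs g. norm \<tau> \<le> norm \<tau>'" unfolding Psi_def by blast
    have min: "norm \<tau> \<le> norm \<tau>'" if "(\<tau>', x') \<in> crit_pairs g" for \<tau>' x'
      using bspec[OF all that] by simp
    have x1: "norm x = 1" using z(2) by (simp add: crit_pairs_iff)
    have "norm \<tau> \<le> norm \<tau>0" using min crit_pairs_of_root[OF x0 \<tau>0] by blast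
    then have "norm \<tau> ^ (k - 2) \<le> 1 / (k * M)" unfolding norm_roots[OF x0 \<tau>0, symmetric]
        by (intro power_mono) auto
    then have "norm \<tau> ^ (k - 2) * (k * \<bar>V x\<bar>) \<le> 1 / (k * M) * (k * \<bar>V x\<bar>)"
        by (intro mult_right_mono) auto
    then have "1 \<le> \<bar>V x\<bar> / M" unfolding norm_crit_pairs[OF z(2)] using k3 by simp
    then have "\<bar>V x\<bar> = M" using V_le_M[OF x1] M_pos by (simp add: field_simps)
    then have "x \<in> X" using x1 by (simp add: X_def)
    moreover have "\<tau> \<in> roots x"
      using crit_pairs_euler[OF z(2)] V_nonzero[OF \<open>x \<in> X\<close>] k3 by (simp add: roots_def field_simps)
    ultimately show "z \<in> (\<lambda>(x, \<tau>). cscale \<tau> x) ` root_pairs" using z(1) by (force simp: root_pairs_def)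
  next
    fix z assume "z \<in> (\<lambda>(x, \<tau>). cscale \<tau> x) ` root_pairs"
    then obtain x \<tau> where "x \<in> X" "\<tau> \<in> roots x" "z = cscale \<tau> x" by (auto simp: root_pairs_def)
    then show "z \<in> Psi g" using crit_pairs_of_root minimal unfolding Psi_def by blast
  qed
qed

text \<open>The second pair is admissible because V(-x) = (-1)^k V(x), and (-1)^k agrees with the
  sign that \<open>(- \<tau>) ^ (k - 2)\<close> picks up.\<close>

lemma root_pairs_fiber:
  assumes "(x, \<tau>) \<in> root_pairs"
  shows "{p \<in> root_pairs. (\<lambda>(x, \<tau>). cscale \<tau> x) p = cscale \<tau> x} = {(x, \<tau>), (- x, - \<tau>)}"
proof (intro equalityI subsetI)
  have x: "norm x = 1" "x \<in> X" "\<tau> \<in> roots x" using assms by (auto simp: root_pairs_def X_def)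
  have Vm: "V (- x) = (-1) ^ k * V x" using real_form_scaleR[of k \<Lambda> "-1" x] by simp
  have kpow: "(-1 :: real) ^ k = (-1) ^ (k - 2)" 
  proof -
    have "k = Suc (Suc (k - 2))" using k3 by simp
    then have "(-1 :: real) ^ k = (-1) ^ Suc (Suc (k - 2))" by (rule arg_cong)
    then show ?thesis by simp
  qed
  {
    fix p assume "p \<in> {(x, \<tau>), (- x, - \<tau>)}"
    moreover have "(- x, - \<tau>) \<in> root_pairs"
    proof -
      have "- x \<in> X" using x Vm by (simp add: X_def abs_mult)
      moreover have "- \<tau> \<in> roots (- x)"
      proof -
        have "(- \<tau>) ^ (k - 2) = (-1) ^ (k - 2) * \<tau> ^ (k - 2)" by (rule power_minus)
        also have "\<dots> = of_real ((-1) ^ (k - 2) * (1 / (k * V x)))" using x(3) by (simp add: roots_def)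
        also have "(-1) ^ (k - 2) * (1 / (k * V x)) = 1 / (k * V (- x))"
          unfolding Vm kpow by (simp add: minus_one_power_iff)
        finally show ?thesis by (simp add: roots_def)
      qed
      ultimately show ?thesis by (simp add: root_pairs_def)
    qed
    ultimately show "p \<in> {p \<in> root_pairs. (\<lambda>(x, \<tau>). cscale \<tau> x) p = cscale \<tau> x}"
      using assms by (auto simp: cscale_def)
  next
    fix p assume "p \<in> {p \<in> root_pairs. (\<lambda>(x, \<tau>). cscale \<tau> x) p = cscale \<tau> x}"
    then obtain x' \<tau>' where p: "p = (x', \<tau>')" "(x', \<tau>') \<in> root_pairs" "cscale \<tau>' x' = cscale \<tau> x"
        by (cases p) auto
    have x': "norm x' = 1" "\<tau>' \<noteq> 0"
      using p(2) roots_nonzero by (auto simp: root_pairs_def X_def)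
    have eq: "\<tau>' * of_real (x' $ i) = \<tau> * of_real (x $ i)" for i
      using arg_cong[OF p(3), of "\<lambda>z. z $ i"] by (simp add: cscale_def)
    have "x \<noteq> 0" using x(1) by auto
    then obtain i where i: "x $ i \<noteq> 0" by (auto simp: vec_eq_iff)
    \<comment> \<open>Two real directions with proportional complex multiples are proportional over
      the reals; \<open>s\<close> is their ratio, and the unit norms leave only the values 1 and
      -1.\<close>
    define s where "s = x' $ i / x $ i"
    have "\<tau> = \<tau>' * of_real s" using eq[of i] i by (simp add: s_def field_simps)
    then have "x' $ j = s * x $ j" for j
    proof -
      have "\<tau>' * of_real (x' $ j) = \<tau>' * of_real (s * x $ j)"
        using eq[of j] \<open>\<tau> = \<tau>' * of_real s\<close> by simp
      then show ?thesis using x'(2) by (simp only: mult_cancel_left of_real_eq_iff) simp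
    qed
    then have xs: "x' = s *\<^sub>R x" by (simp add: vec_eq_iff)
    then have "\<bar>s\<bar> = 1" using x'(1) x(1) by simp
    then have "s = 1 \<or> s = -1" by linarith
    then show "p \<in> {(x, \<tau>), (- x, - \<tau>)}" using p(1) xs \<open>\<tau> = \<tau>' * of_real s\<close> by auto
  }
qed

text \<open>Double counting of \<open>root_pairs\<close>: each x carries k - 2 roots, and each point
  of \<Psi> comes from two pairs.\<close>

lemma sum_Psi:
  fixes h :: "complex^'c \<Rightarrow> 'a::field_char_0"
  assumes "finite X" and hf: "\<And>x \<tau>. x \<in> X \<Longrightarrow> \<tau> \<in> roots x \<Longrightarrow> h (cscale \<tau> x) = f x"
  shows "(\<Sum>z\<in>Psi g. h z) = of_nat (k - 2) / 2 * (\<Sum>x\<in>X. f x)"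
proof -
  let ?c = "\<lambda>(x, \<tau>). cscale \<tau> x"
  have finr: "finite (roots x)" if "x \<in> X" for x using card_roots[OF that] k3
      by (intro card_ge_0_finite) simp
  have fin: "finite root_pairs" unfolding root_pairs_def using assms(1) finr by auto
  have "(\<Sum>p\<in>root_pairs. h (?c p)) = (\<Sum>z\<in>?c ` root_pairs. \<Sum>p\<in>{p \<in> root_pairs. ?c p = z}. h (?c p))"
    by (rule sum.image_gen[OF fin])
  also have "\<dots> = (\<Sum>z\<in>?c ` root_pairs. 2 * h z)"
  proof (rule sum.cong[OF refl])
    fix z assume "z \<in> ?c ` root_pairs"
    then obtain x \<tau> where p: "(x, \<tau>) \<in> root_pairs" "z = cscale \<tau> x" by auto
    have "x \<noteq> - x"
    proof
      assume "x = - x"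
      then have "x = 0" by (simp add: vec_eq_iff)
      then show False using p(1) by (simp add: root_pairs_def X_def)
    qed
    have "(\<Sum>p\<in>{p \<in> root_pairs. ?c p = z}. h (?c p)) = (\<Sum>p\<in>{p \<in> root_pairs. ?c p = z}. h z)"
      by (rule sum.cong) auto
    also have "\<dots> = 2 * h z"
      unfolding p(2) root_pairs_fiber[OF p(1)] using \<open>x \<noteq> - x\<close> by simp
    finally show "(\<Sum>p\<in>{p \<in> root_pairs. ?c p = z}. h (?c p)) = 2 * h z" .
  qed
  also have "\<dots> = 2 * (\<Sum>z\<in>Psi g. h z)" unfolding Psi_eq by (rule sum_distrib_left[symmetric])
  finally have 1: "(\<Sum>p\<in>root_pairs. h (?c p)) = 2 * (\<Sum>z\<in>Psi g. h z)" .
  have "(\<Sum>p\<in>root_pairs. h (?c p)) = (\<Sum>x\<in>X. \<Sum>\<tau>\<in>roots x. h (cscale \<tau> x))"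
    unfolding root_pairs_def using assms(1) finr by (subst sum.Sigma) (auto simp: case_prod_beta)
  also have "\<dots> = (\<Sum>x\<in>X. of_nat (k - 2) * f x)"
    using hf card_roots by (intro sum.cong refl) simp
  finally have "2 * (\<Sum>z\<in>Psi g. h z) = of_nat (k - 2) * (\<Sum>x\<in>X. f x)"
    unfolding 1 by (simp add: sum_distrib_left)
  then have "(\<Sum>z\<in>Psi g. h z) = of_nat (k - 2) * (\<Sum>x\<in>X. f x) / 2"
    by (metis nonzero_mult_div_cancel_left zero_neq_numeral)
  then show ?thesis by simp
qed

end

section \<open>Stirling's formula\<close>

text \<open>The square of 4^n divided by the central binomial coefficient appears here since this is
  what remains when the Stirling quotients at n and 2 n are compared.\<close>

lemma wallis_prod_eq:
  "(\<Prod>k=1..n. (4 * real k ^ 2) / (4 * real k ^ 2 - 1)) =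
      (4 ^ n * fact n ^ 2 / fact (2 * n)) ^ 2 / (2 * real n + 1)"
proof (induction n)
  case (Suc n)
  have f: "fact (2 * Suc n) = (2 * real n + 2) * (2 * real n + 1) * fact (2 * n)"
    by (simp add: algebra_simps)
  have nz: "(fact (2 * n) :: real) \<noteq> 0" "(4::real) * real (Suc n) ^ 2 - 1 =
      (2 * real n + 1) * (2 * real n + 3)"
    by (auto simp: power2_eq_square algebra_simps)
  have "(\<Prod>k=1..Suc n. (4 * real k ^ 2) / (4 * real k ^ 2 - 1)) =
     (4 ^ n * fact n ^ 2 / fact (2 * n)) ^ 2 / (2 * real n + 1) * (4 * real (Suc n) ^ 2 /
         ((2 * real n + 1) * (2 * real n + 3)))"
    using Suc.IH nz(2) by (simp add: mult.commute)
  also have "\<dots> = (4 ^ Suc n * fact (Suc n) ^ 2 / fact (2 * Suc n)) ^ 2 / (2 * real (Suc n) + 1)"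
  proof -
    have pos: "2 * real n + 1 \<noteq> 0" "2 * real n + 3 \<noteq> 0" "2 * real n + 2 \<noteq> 0" "real n + 1 \<noteq> 0"
      using of_nat_0_le_iff[of n, where 'a = real] by linarith+
    have "4 ^ Suc n * fact (Suc n) ^ 2 / fact (2 * Suc n) =
        4 * (real n + 1) ^ 2 / ((2 * real n + 2) * (2 * real n + 1)) * (4 ^ n * fact n ^ 2 / fact
            (2 * n))"
      unfolding f by (simp add: power_mult_distrib add.commute)
    also have "4 * (real n + 1) ^ 2 / ((2 * real n + 2) * (2 * real n + 1)) =
        2 * (real n + 1) / (2 * real n + 1)"
    proof -
      have "4 * x ^ 2 / (2 * x * y) = 2 * x / y" if "x \<noteq> 0" for x y :: real
        using that by (simp add: power2_eq_square)
      moreover have "2 * real n + 2 = 2 * (real n + 1)" by simp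
      ultimately show ?thesis using pos(4) by (simp only:)
    qed
    finally have q: "4 ^ Suc n * fact (Suc n) ^ 2 / fact (2 * Suc n) =
        2 * (real n + 1) / (2 * real n + 1) * (4 ^ n * fact n ^ 2 / fact (2 * n))" .
    have "T / b * (4 * x ^ 2 / (b * c)) = (2 * x / b) ^ 2 * T / c" for T b c x :: real
      by (simp add: power2_eq_square mult_ac)
    moreover have "real (Suc n) = real n + 1" "2 * (real n + 1) + 1 = 2 * real n + 3" by simp_all
    ultimately show ?thesis unfolding q power_mult_distrib[of _ "4 ^ n * fact n ^ 2 / fact (2 * n)"]
        by (simp only:)
  qed
  finally show ?case .
qed simp

text \<open>The logarithm of n! minus its Stirling approximation has summable increments, so the
  quotient \<open>s\<close> converges to some positive \<open>C\<close>. Comparing \<open>s\<close>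
  at n and 2 n identifies \<open>C\<close> through Wallis' product.\<close>

lemma stirling:
  "(\<lambda>n. sqrt (2 * pi * real n) * (real n / exp 1) ^ n / fact n) \<longlonglongrightarrow> 1"
proof -
  define a where "a n = ln (fact n) - (real n + 1 / 2) * ln (real n) + real n" for n
  define s where "s n = fact n / (sqrt (real n) * (real n / exp 1) ^ n)" for n
  have "summable (\<lambda>n. a (Suc n) - a n)"
  proof (rule summable_comparison_test_bigo)
    show "summable (\<lambda>n. norm (1 / real n ^ 2))"
      using inverse_power_summable[of 2, where 'a = real] by (simp add: field_simps)
    \<comment> \<open>The summand 1 / 2 in the exponent cancels the terms of order 1 / n, and what
      remains is summable.\<close>
    have "(\<lambda>n. 1 - (real n + 1 / 2) * (ln (real n + 1) - ln (real n))) \<in> O(\<lambda>n. 1 / real n ^ 2)"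
      by real_asymp
    moreover have "a (Suc n) - a n = 1 - (real n + 1 / 2) * (ln (real n + 1) - ln (real n))" for n
    proof -
      have "ln (fact (Suc n)) = ln (real (Suc n)) + ln (fact n)"
        unfolding fact_Suc by (subst ln_mult) auto
      then show ?thesis by (simp add: a_def algebra_simps del: fact_Suc)
    qed
    ultimately show "(\<lambda>n. a (Suc n) - a n) \<in> O(\<lambda>n. 1 / real n ^ 2)" by simp
  qed
  then have "convergent (\<lambda>n. \<Sum>i<n. a (Suc i) - a i)" by (simp add: summable_iff_convergent)
  then have "convergent (\<lambda>n. a n - a 0)" by (simp add: sum_lessThan_telescope)
  then have "convergent a" using convergent_add_const_right_iff[of a "- a 0"] by simp
  then obtain L where L: "a \<longlonglongrightarrow> L" by (auto simp: convergent_def)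
  define C where "C = exp L"
  have C: "C > 0" by (simp add: C_def)
  have "exp (a n) = s n" if "n > 0" for n
  proof -
    have "exp ((real n + 1 / 2) * ln (real n)) = real n powr (real n + 1 / 2)"
      using that by (simp add: powr_def)
    also have "\<dots> = real n ^ n * sqrt (real n)"
      using that by (simp add: powr_add powr_realpow powr_half_sqrt)
    finally have "exp (a n) = fact n / (real n ^ n * sqrt (real n)) * exp (real n)"
      by (simp add: a_def exp_add exp_diff)
    moreover have "exp (real n) = exp 1 ^ n" using exp_of_nat_mult[of n 1] by simp
    ultimately show ?thesis using that by (simp add: s_def power_divide)
  qed
  then have "\<forall>\<^sub>F n in sequentially. exp (a n) = s n"
    using eventually_gt_at_top[of 0] by (rule eventually_mono[rotated]) 
  moreover have "(\<lambda>n. exp (a n)) \<longlonglongrightarrow> C" unfolding C_def by (rule tendsto_exp[OF L])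
  ultimately have s: "s \<longlonglongrightarrow> C" by (rule Lim_transform_eventually[rotated])
  have s2: "(\<lambda>n. s (2 * n)) \<longlonglongrightarrow> C"
    using filterlim_compose[OF s, of "\<lambda>n. 2 * n"] by (simp add: mult_nat_left_at_top)
  \<comment> \<open>In this quotient the powers of n and e cancel, leaving a multiple of the square
    root of a Wallis product, while the unknown constant enters as \<open>C ^ 2 / C\<close>. The
    outer square removes the root.\<close>
  have "(\<lambda>n. (s n ^ 2 / s (2 * n)) ^ 2) \<longlonglongrightarrow> (C ^ 2 / C) ^ 2"
    using C by (intro tendsto_intros s s2) auto
  moreover have "(\<lambda>n. (s n ^ 2 / s (2 * n)) ^ 2) \<longlonglongrightarrow> 4 * (pi / 2)"
  proof (rule Lim_transform_eventually)
    show "(\<lambda>n. 2 * (2 * real n + 1) / real n * (\<Prod>k=1..n. (4 * real k ^ 2) / (4 * real k ^ 2 - 1))) \<longlonglongrightarrow>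
        4 * (pi / 2)"
    proof (intro tendsto_mult wallis)
      show "(\<lambda>n. 2 * (2 * real n + 1) / real n) \<longlonglongrightarrow> 4" by real_asymp
    qed
    show "\<forall>\<^sub>F n in sequentially. 2 * (2 * real n + 1) / real n *
        (\<Prod>k=1..n. (4 * real k ^ 2) / (4 * real k ^ 2 - 1)) =
        (s n ^ 2 / s (2 * n)) ^ 2"
      using eventually_gt_at_top[of 0]
    proof eventually_elim
      case (elim n)
      have p: "2 * real n + 1 > 0" by simp
      have pw: "(real (2 * n) / exp 1) ^ (2 * n) = 4 ^ n * ((real n / exp 1) ^ n) ^ 2"
        by (simp add: power_mult power_divide power_mult_distrib power2_eq_square)
      have ratio: "s n ^ 2 / s (2 * n) = sqrt (2 / real n) * (4 ^ n * fact n ^ 2 / fact (2 * n))"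
      proof -
        let ?p = "(real n / exp 1) ^ n"
        have pp: "?p > 0" using elim by simp
        have e1: "s n ^ 2 = fact n ^ 2 / (real n * ?p ^ 2)"
          by (simp add: s_def power_divide power_mult_distrib)
        have e2: "s (2 * n) = fact (2 * n) / (sqrt (2 * real n) * (4 ^ n * ?p ^ 2))"
          unfolding s_def pw by simp
        have "s n ^ 2 / s (2 * n) = sqrt (2 * real n) / real n * (4 ^ n * fact n ^ 2 / fact (2 * n))"
        proof -
          have "(f / (N * P)) / (F / (r * (Q * P))) = r / N * (Q * f / F)" if "P \<noteq> 0"
              for f N P F r Q :: real
            using that by simp
          then show ?thesis using pp unfolding e1 e2 by (metis less_irrefl zero_less_power)
        qed
        also have "sqrt (2 * real n) / real n = sqrt (2 / real n)"
          using elim by (simp add: real_sqrt_mult real_sqrt_divide real_div_sqrt field_simps)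
        finally show ?thesis .
      qed
      have r: "sqrt (2 / real n) ^ 2 = 2 / real n" by simp
      have sq: "(s n ^ 2 / s (2 * n)) ^ 2 = 2 / real n * (4 ^ n * fact n ^ 2 / fact (2 * n)) ^ 2"
        unfolding ratio power_mult_distrib[of _ "4 ^ n * fact n ^ 2 / fact (2 * n)"] r ..
      have "2 * b / N * (T / b) = 2 / N * T" if "b \<noteq> 0" for b N T :: real using that by simp
      then show ?case unfolding wallis_prod_eq sq using p by (metis less_irrefl)
    qed
  qed
  ultimately have "(C ^ 2 / C) ^ 2 = 4 * (pi / 2)" by (rule LIMSEQ_unique)
  then have "C ^ 2 = 2 * pi" using C by (simp add: power2_eq_square)
  then have Csq: "C = sqrt (2 * pi)" using C by (metis real_sqrt_unique less_imp_le)
  have "(\<lambda>n. C / s n) \<longlonglongrightarrow> C / C" using C by (intro tendsto_intros s) auto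
  moreover have "C / s n = sqrt (2 * pi * real n) * (real n / exp 1) ^ n / fact n" for n
    by (simp add: s_def Csq real_sqrt_mult)
  ultimately show ?thesis using C by simp
qed

section \<open>The asymptotic formula\<close>

locale nondegenerate_form = nonzero_form k \<Lambda> for k :: nat and \<Lambda> :: "('c::finite \<Rightarrow> nat) \<Rightarrow> real" +
  assumes nondegenerate: "\<forall>z\<in>Psi g. det (Hess g z) \<noteq> 0"
begin

lemma det_H: assumes "x \<in> X" shows "det (H x) \<noteq> 0"
proof -
  have "card (roots x) \<noteq> 0" using card_roots[OF assms] k3 by simp
  then obtain \<tau> where t: "\<tau> \<in> roots x" by fastforce
  then have "cscale \<tau> x \<in> Psi g" using assms by (force simp: Psi_eq root_pairs_def)
  then have "det (Hess g (cscale \<tau> x)) \<noteq> 0" using nondegenerate by blast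
  then show ?thesis unfolding Hess_at_root[OF assms t] det_of_real by simp
qed

text \<open>Nondegeneracy is assumed at the complex critical points; \<open>det_phi_Hessian\<close>
  carries it over to the real maxima of |\<phi>|, as Laplace's method requires.\<close>

lemma det_F: assumes "y \<in> Y" shows "det (F y) \<noteq> 0"
proof
  assume "det (F y) = 0"
  then have "\<not> inj ((*v) (F y))" using det_nz_iff_inj[of "(*v) (F y)"] by simp
  moreover have "((- 1 / \<phi> y) *\<^sub>R F y) *v x = (- 1 / \<phi> y) *\<^sub>R (F y *v x)" for x
    by (simp only: scaleR_matrix_vector_assoc)
  ultimately have "\<not> inj ((*v) ((- 1 / \<phi> y) *\<^sub>R F y))"
    unfolding inj_def by metis
  then have "det ((- 1 / \<phi> y) *\<^sub>R F y) = 0"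
    using det_nz_iff_inj[of "(*v) ((- 1 / \<phi> y) *\<^sub>R F y)"] by simp
  moreover obtain x where x: "x \<in> X" "y = sqrt k *\<^sub>R x" using assms by (auto simp: Y_eq)
  ultimately have "D x = 0" using det_phi_Hessian[OF x(1)] k3 by simp
  then show False using det_H[OF x(1)] by (simp add: D_def)
qed

lemmas laplace = laplace_method[OF deriv_phi deriv_G isCont_F sym_F phi_at_infinity phi_integrable m_pos
    phi_le_m Y_def det_F]

lemma inj_sqrt_scale: "inj_on (\<lambda>x :: real^'c. sqrt k *\<^sub>R x) X"
  using k3 by (auto simp: inj_on_def)

lemma finite_X: "finite X"
  using laplace(1) finite_imageD[OF _ inj_sqrt_scale] by (simp add: Y_eq)

lemma D_pos: assumes "x \<in> X" shows "D x > 0"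
proof -
  have "sqrt k *\<^sub>R x \<in> Y" using assms by (auto simp: Y_eq)
  then have "0 < 2 / real (k - 2) * D x" using laplace(2)[of "sqrt k *\<^sub>R x"]
      unfolding det_phi_Hessian[OF assms] by blast
  moreover have "2 / real (k - 2) > 0" using k3 by simp
  ultimately show ?thesis by (metis zero_less_mult_pos)
qed

text \<open>The main term of Laplace's method, with the determinants expressed by \<open>D\<close>.
  Up to the positive factor \<open>L n\<close> it is also the value of \<open>crit_sum\<close>,
  which is how the two sides of the theorem meet.\<close>

definition S :: "nat \<Rightarrow> real"
  where "S n = (\<Sum>x\<in>X. sgn (V x) ^ n * (sqrt (real (k - 2) / 2) / sqrt (D x)))"

lemma S_eq: "S n = (\<Sum>y\<in>Y. sgn (\<phi> y) ^ n / sqrt (det ((- 1 / \<phi> y) *\<^sub>R F y)))"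
proof -
  have "sgn (\<phi> (sqrt k *\<^sub>R x)) = sgn (V x)" for x
    using k3 by (simp add: \<phi>_def real_form_scaleR sgn_mult)
  moreover have "1 / sqrt (2 / real (k - 2) * D x) = sqrt (real (k - 2) / 2) / sqrt (D x)" for x
    by (simp add: real_sqrt_mult real_sqrt_divide)
  ultimately show ?thesis
    unfolding Y_eq sum.reindex[OF inj_sqrt_scale] S_def o_def
    by (intro sum.cong refl) (simp only: det_phi_Hessian, metis mult.right_neutral times_divide_eq_right)
qed

lemma S_0_pos: "S 0 > 0"
  unfolding S_def using finite_X X_nonempty k3 by (intro sum_pos) (auto simp: D_pos)

text \<open>In particular \<open>S\<close> is bounded away from \<open>0\<close> wherever it does not vanish.\<close>

lemma S_parity: "S n = (if even n then S 0 else S 1)"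
proof -
  have "sgn (V x) ^ n = (if even n then 1 else sgn (V x))" if "x \<in> X" for x
    using V_nonzero[OF that] by (cases "V x > 0") (auto simp: sgn_if)
  then show ?thesis by (auto simp: S_def intro!: sum.cong)
qed

text \<open>All signs are +1 for n = 0, so \<open>S 0\<close> is the sum of the absolute
  values.\<close>

lemma abs_S_le: "\<bar>S n\<bar> \<le> S 0"
proof -
  have "\<bar>sgn (V x) ^ n * (sqrt (real (k - 2) / 2) / sqrt (D x))\<bar> \<le> sqrt (real (k - 2) / 2) / sqrt (D x)"
      if "x \<in> X" for x
  proof -
    have "\<bar>sgn (V x)\<bar> = 1" using V_nonzero[OF that] by (simp add: abs_sgn_eq)
    then show ?thesis using k3 D_pos[OF that] by (simp add: abs_mult power_abs)
  qed
  then show ?thesis unfolding S_def by (intro order_trans[OF sum_abs] sum_mono) simp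
qed

definition U :: "nat \<Rightarrow> real"
  where "U n = sqrt n ^ CARD('c) * (\<integral>y. \<phi> y ^ n \<partial>lborel) / m ^ n / sqrt (2 * pi) ^ CARD('c)"

lemma U_minus_S: "(\<lambda>n. U n - S n) \<longlonglongrightarrow> 0"
proof -
  have "(\<lambda>n. (sqrt n ^ CARD('c) * (\<integral>y. \<phi> y ^ n \<partial>lborel) / m ^ n - sqrt (2 * pi) ^ CARD('c) *
      S n) / sqrt (2 * pi) ^ CARD('c))
      \<longlonglongrightarrow> 0 / sqrt (2 * pi) ^ CARD('c)"
    unfolding S_eq by (intro tendsto_divide laplace(3) tendsto_const) auto
  then show ?thesis by (simp add: U_def diff_divide_distrib)
qed

text \<open>Under x = sqrt n y, homogeneity of degree k n extracts the large power of sqrt n, while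
  the Jacobian and the Gaussian normalization are absorbed in \<open>U\<close>.\<close>

lemma graph_sum_eq_U:
  assumes "n > 0"
  shows "graph_sum k \<Lambda> n = sqrt n ^ (k * n) * m ^ n / fact n * U n"
proof -
  let ?p = "sqrt (2 * pi) ^ CARD('c)"
  have p: "?p \<noteq> 0" by simp
  have meas: "(\<lambda>x. std_gauss x * V x ^ n) \<in> borel_measurable borel"
    using borel_measurable_integrable[OF graph_sum_eq_gauss_integral(1)[of k \<Lambda> n]] by simp
  have pt: "std_gauss (sqrt n *\<^sub>R y) * V (sqrt n *\<^sub>R y) ^ n = sqrt n ^ (k * n) / ?p * \<phi> y ^ n"
      for y :: "real^'c"
  proof -
    have "std_gauss (sqrt n *\<^sub>R y) = exp (real n * (- (y \<bullet> y) / 2)) / ?p"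
      using std_gauss_eq[of "sqrt n *\<^sub>R y"] p by (simp add: field_simps)
    also have "exp (real n * (- (y \<bullet> y) / 2)) = exp (- (y \<bullet> y) / 2) ^ n" by (rule exp_of_nat_mult)
    finally show ?thesis by (simp add: real_form_scaleR \<phi>_def power_mult_distrib power_mult[symmetric])
  qed
  have "fact n * graph_sum k \<Lambda> n = (\<integral>x. std_gauss x * V x ^ n \<partial>lborel)"
    using k3 by (intro graph_sum_eq_gauss_integral(2)) simp
  also have "\<dots> = sqrt n ^ CARD('c) * (\<integral>y. std_gauss (0 + sqrt n *\<^sub>R y) *
      V (0 + sqrt n *\<^sub>R y) ^ n \<partial>lborel)"
    by (rule lborel_integral_affine_vec[OF meas]) (use assms in simp)
  also have "\<dots> = sqrt n ^ CARD('c) * (sqrt n ^ (k * n) / ?p * (\<integral>y. \<phi> y ^ n \<partial>lborel))"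
    by (simp add: pt)
  also have "\<dots> = sqrt n ^ (k * n) * m ^ n * U n"
    using m_pos by (simp add: U_def)
  finally show ?thesis by (simp add: field_simps)
qed

lemma ell_admissible:
  assumes "n \<in> admissible k"
  shows "n > 0" "2 * ell k n = n * (k - 2)" "ell k n > 0"
proof -
  show n: "n > 0" using assms by (simp add: admissible_def)
  obtain z :: int where z: "real n * (real k / 2 - 1) = of_int z"
    using assms by (auto simp: admissible_def elim: Ints_cases)
  have r: "real n * (real k / 2 - 1) = real (n * (k - 2)) / 2"
    using k3 by (simp add: of_nat_diff field_simps)
  then have "real_of_int z = real (n * (k - 2)) / 2" using z by simp
  then have "0 \<le> real_of_int z" by (simp only:)
  then have "real (ell k n) = real n * (real k / 2 - 1)" unfolding ell_def z by simp
  then have "real (2 * ell k n) = real (n * (k - 2))" using r by simp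
  then show "2 * ell k n = n * (k - 2)" by (simp only: of_nat_eq_iff)
  then show "ell k n > 0" using n k3 by (cases "ell k n = 0") auto
qed

lemma ell_at_top: "filterlim (ell k) at_top at_top"
proof (rule filterlim_at_top_mono)
  show "filterlim (\<lambda>n :: nat. n div 2) at_top at_top"
    by (rule filterlim_at_top_div_const_nat) simp
  show "\<forall>\<^sub>F n in at_top. n div 2 \<le> ell k n"
  proof (rule always_eventually, rule allI)
    fix n
    have "real n * (1 / 2) \<le> real n * (real k / 2 - 1)" using k3 by (intro mult_left_mono) auto
    moreover have "real (n div 2) \<le> real n * (1 / 2)" by linarith
    ultimately have "int (n div 2) \<le> \<lfloor>real n * (real k / 2 - 1)\<rfloor>" by (simp add: le_floor_iff)
    then show "n div 2 \<le> ell k n" by (simp add: ell_def)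
  qed
qed

text \<open>Everything that the critical terms have in common. Of the factor (k - 2) / 2 from
  \<open>sum_Psi\<close>, one square root is placed here and the other in \<open>S\<close>, where it
  matches the determinants of Laplace's method.\<close>

definition L :: "nat \<Rightarrow> real"
  where "L n = 1 / (2 * pi) * fact (ell k n - 1) * (2 * real k / real (k - 2)) ^ ell k n * (k * M) ^ n *
      sqrt (real (k - 2) / 2)"

lemma L_pos: "L n > 0"
  using k3 M_pos by (simp add: L_def)

lemma crit_sum_eq:
  assumes "n \<in> admissible k"
  shows "crit_sum k \<Lambda> n = of_real (L n * S n)" "crit_scale k \<Lambda> n = of_real (L n * S 0)"
proof -
  let ?l = "ell k n" and ?q = "(2 * real k / real (k - 2)) ^ ell k n"
  have k2: "real (k - 2) > 0" using k3 by simp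
  have half: "sqrt (real (k - 2) / 2) * sqrt (real (k - 2) / 2) = real (k - 2) / 2" by simp
  have regroup: "a * (q * p * t) = q * p * r * (r * t)" if "r * r = a" for a p q r t :: real
    unfolding that[symmetric] by (simp only: mult_ac)
  have ct: "crit_term g ?l (cscale \<tau> x) = of_real (?q * (k * V x) ^ n / sqrt (D x))"
      if "x \<in> X" "\<tau> \<in> roots x" for x \<tau>
    using crit_term_at_root[OF that ell_admissible(2)[OF assms] D_pos[OF that(1)]] by simp
  have Vx: "(k * V x) ^ n = (k * M) ^ n * sgn (V x) ^ n" if "x \<in> X" for x
  proof -
    have "\<bar>V x\<bar> = M" using that by (simp add: X_def)
    then have "V x = sgn (V x) * M" using sgn_mult_abs[of "V x"] by simp
    then have "k * V x = (k * M) * sgn (V x)" by (metis mult.assoc mult.commute)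
    then show ?thesis by (simp only: power_mult_distrib)
  qed
  have "(\<Sum>z\<in>Psi g. crit_term g ?l z) =
      of_nat (k - 2) / 2 * (\<Sum>x\<in>X. of_real (?q * (k * V x) ^ n / sqrt (D x)))"
    by (rule sum_Psi[OF finite_X]) (rule ct)
  also have "\<dots> = of_real (real (k - 2) / 2 * (\<Sum>x\<in>X. ?q * (k * V x) ^ n / sqrt (D x)))"
    by simp
  also have "(\<Sum>x\<in>X. ?q * (k * V x) ^ n / sqrt (D x)) =
      ?q * (k * M) ^ n * (\<Sum>x\<in>X. sgn (V x) ^ n / sqrt (D x))"
    unfolding sum_distrib_left by (intro sum.cong refl) (simp only: Vx times_divide_eq_right mult.assoc)
  also have "real (k - 2) / 2 * (?q * (k * M) ^ n * (\<Sum>x\<in>X. sgn (V x) ^ n / sqrt (D x))) =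
     ?q * (k * M) ^ n * sqrt (real (k - 2) / 2) * (sqrt (real (k - 2) / 2) * (\<Sum>x\<in>X. sgn (V x) ^ n / sqrt
         (D x)))"
    by (rule regroup[OF half])
  also have "sqrt (real (k - 2) / 2) * (\<Sum>x\<in>X. sgn (V x) ^ n / sqrt (D x)) = S n"
    unfolding S_def sum_distrib_left by (intro sum.cong refl) simp
  finally have sum: "(\<Sum>z\<in>Psi g. crit_term g ?l z) =
      of_real (?q * (k * M) ^ n * sqrt (real (k - 2) / 2) * S n)" .
  show "crit_sum k \<Lambda> n = of_real (L n * S n)"
    unfolding crit_sum_def sum L_def by simp
  have nct: "norm (crit_term g ?l (cscale \<tau> x)) = ?q * (k * M) ^ n / sqrt (D x)" if "x \<in> X" "\<tau> \<in> roots x"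
      for x \<tau>
  proof -
    have "\<bar>k * V x\<bar> = k * M" using that(1) by (simp add: X_def abs_mult)
    then have "\<bar>(k * V x) ^ n\<bar> = (k * M) ^ n" by (simp only: power_abs)
    then show ?thesis unfolding ct[OF that] norm_of_real using k2 D_pos[OF that(1)]
      by (simp add: abs_mult)
  qed
  have "(\<Sum>z\<in>Psi g. norm (crit_term g ?l z)) = of_nat (k - 2) / 2 * (\<Sum>x\<in>X. ?q * (k * M) ^ n / sqrt (D x))"
    by (rule sum_Psi[OF finite_X]) (rule nct)
  also have "(\<Sum>x\<in>X. ?q * (k * M) ^ n / sqrt (D x)) = ?q * (k * M) ^ n * (\<Sum>x\<in>X. 1 / sqrt (D x))"
    unfolding sum_distrib_left by simp
  also have "of_nat (k - 2) / 2 * (?q * (k * M) ^ n * (\<Sum>x\<in>X. 1 / sqrt (D x))) =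
     ?q * (k * M) ^ n * sqrt (real (k - 2) / 2) * (sqrt (real (k - 2) / 2) * (\<Sum>x\<in>X. 1 / sqrt (D x)))"
    by (rule regroup[OF half])
  also have "sqrt (real (k - 2) / 2) * (\<Sum>x\<in>X. 1 / sqrt (D x)) = S 0"
    unfolding S_def sum_distrib_left by (intro sum.cong refl) simp
  finally have nsum: "(\<Sum>z\<in>Psi g. norm (crit_term g ?l z)) =
      ?q * (k * M) ^ n * sqrt (real (k - 2) / 2) * S 0" .
  show "crit_scale k \<Lambda> n = of_real (L n * S 0)"
    unfolding crit_scale_def nsum L_def by simp
qed

section \<open>Comparison of the prefactors and the final estimates\<close>

definition stirling_ratio :: "nat \<Rightarrow> real"
  where "stirling_ratio n = sqrt (2 * pi * real n) * (real n / exp 1) ^ n / fact n"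

text \<open>An exact identity, based on k n = 2 (l + n) and 2 k / (k - 2) = n k / l. The square
  roots of the two Stirling quotients and of (k - 2) / 2 = l / n multiply to 2 pi l, which consumes
  the constant 1 / (2 pi) and completes (l - 1)! to l!.\<close>

lemma prefactor_eq:
  assumes "n \<in> admissible k"
  shows "sqrt n ^ (k * n) * m ^ n / fact n = L n * (stirling_ratio n * stirling_ratio (ell k n))"
proof -
  define l where "l = ell k n"
  have n: "n > 0" and l2: "2 * l = n * (k - 2)" and l: "l > 0"
    using ell_admissible[OF assms] by (auto simp: l_def)
  have kn: "k * n = 2 * (l + n)"
  proof -
    have "k - 2 + 2 = k" using k3 by simp
    then have "k * n = (k - 2 + 2) * n" by (simp only:)
    also have "\<dots> = (k - 2) * n + 2 * n" by (rule add_mult_distrib)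
    finally show ?thesis using l2 by (simp add: mult.commute)
  qed
  have lr: "real l = real n * real (k - 2) / 2"
    using arg_cong[OF l2, of real] by simp
  have l2r: "2 * real l = real n * (real k - 2)"
    using lr k3 by (simp add: of_nat_diff)
  have k2: "real (k - 2) > 0" using k3 by simp
  have sq: "sqrt (real a) ^ (k * n) = real a ^ (l + n)" for a :: nat
    unfolding kn power_mult by simp
  have mn: "m ^ n = M ^ n * (real k ^ (l + n) * (1 / (exp 1 ^ l * exp 1 ^ n)))"
  proof -
    have "exp (- real k / 2) ^ n = exp (real n * (- real k / 2))" by (rule exp_of_nat_mult[symmetric])
    also have "real n * (- real k / 2) = - (real l * 1 + real n * 1)" using l2r
        by (simp add: algebra_simps)
    also have "exp \<dots> = 1 / (exp 1 ^ l * exp 1 ^ n)"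
      by (simp only: exp_minus exp_add exp_of_nat_mult inverse_eq_divide)
    finally show ?thesis
      unfolding m_def power_mult_distrib power_mult[symmetric] sq by simp
  qed
  have frac: "2 * real k / real (k - 2) = real n * real k / real l" and half: "real (k - 2) / 2 =
      real l / real n"
    unfolding lr using n k2 by simp_all
  have fl: "fact l = real l * fact (l - 1)" using l by (simp add: fact_reduce)
  have sqrts: "sqrt (real l / real n) * (sqrt (2 * pi * real n) * sqrt (2 * pi * real l)) =
      2 * pi * real l"
  proof -
    have "sqrt (real l / real n) * (sqrt (2 * pi * real n) * sqrt (2 * pi * real l)) =
        sqrt ((real l / real n) * ((2 * pi * real n) * (2 * pi * real l)))" by
            (simp only: real_sqrt_mult)
    also have "(real l / real n) * ((2 * pi * real n) * (2 * pi * real l)) = (2 * pi * real l) ^ 2"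
      using n by (simp add: power2_eq_square)
    finally show ?thesis by simp
  qed
  have "L n * (stirling_ratio n * stirling_ratio l) =
     1 / (2 * pi) * fact (l - 1) * (real n * real k / real l) ^ l * (real k * M) ^ n *
     (sqrt (real l / real n) * (sqrt (2 * pi * real n) * sqrt (2 * pi * real l))) *
     ((real n / exp 1) ^ n * (real l / exp 1) ^ l) / (fact n * (real l * fact (l - 1)))"
    unfolding L_def stirling_ratio_def l_def[symmetric] frac half fl by (simp add: mult_ac)
  also have "\<dots> = real n ^ (l + n) * (M ^ n * (real k ^ (l + n) * (1 / (exp 1 ^ l * exp 1 ^ n)))) / fact
      n"
    unfolding sqrts power_divide power_mult_distrib power_add using n l by (simp add: mult_ac)
  finally show ?thesis unfolding sq mn l_def by simp
qed

lemma stirling_ratio_admissible: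
  "((\<lambda>n. stirling_ratio n * stirling_ratio (ell k n)) \<longlongrightarrow> 1) (admissible_at_top k)"
proof -
  have 1: "stirling_ratio \<longlonglongrightarrow> 1" unfolding stirling_ratio_def by (rule stirling)
  have "(\<lambda>n. stirling_ratio n * stirling_ratio (ell k n)) \<longlonglongrightarrow> 1 * 1"
    by (intro tendsto_mult 1 filterlim_compose[OF 1 ell_at_top])
  then show ?thesis unfolding admissible_at_top_def
      by (simp only: mult_1_right) (rule tendsto_mono[OF inf_le1])
qed

definition err :: "nat \<Rightarrow> real"
  where "err n = stirling_ratio n * stirling_ratio (ell k n) * U n - S n"

lemma graph_sum_eq_err: "n \<in> admissible k \<Longrightarrow> graph_sum k \<Lambda> n = L n * (S n + err n)"
  using graph_sum_eq_U[of n] ell_admissible(1)[of n] prefactor_eq[of n] by (simp add: err_def mult.assoc)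

text \<open>The error splits as r (U - S) + (r - 1) S with r the product of the two Stirling
  quotients; boundedness of \<open>S\<close> suffices for the second part.\<close>

lemma err_tendsto: "(err \<longlongrightarrow> 0) (admissible_at_top k)"
proof -
  let ?r = "\<lambda>n. stirling_ratio n * stirling_ratio (ell k n)"
  have US: "((\<lambda>n. U n - S n) \<longlongrightarrow> 0) (admissible_at_top k)"
    using U_minus_S unfolding admissible_at_top_def by (rule tendsto_mono[OF inf_le1])
  have "((\<lambda>n. (?r n - 1) * S n) \<longlongrightarrow> 0) (admissible_at_top k)"
  proof (rule Lim_null_comparison)
    have "((\<lambda>n. \<bar>?r n - 1\<bar> * S 0) \<longlongrightarrow> \<bar>1 - 1\<bar> * S 0) (admissible_at_top k)"
      by (intro tendsto_intros stirling_ratio_admissible)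
    then show "((\<lambda>n. \<bar>?r n - 1\<bar> * S 0) \<longlongrightarrow> 0) (admissible_at_top k)" by simp
    show "\<forall>\<^sub>F n in admissible_at_top k. norm ((?r n - 1) * S n) \<le> \<bar>?r n - 1\<bar> * S 0"
      by (rule always_eventually) (auto simp: abs_mult intro!: mult_left_mono abs_S_le)
  qed
  moreover have "((\<lambda>n. ?r n * (U n - S n)) \<longlongrightarrow> 1 * 0) (admissible_at_top k)"
    by (intro tendsto_mult stirling_ratio_admissible US)
  ultimately have "((\<lambda>n. ?r n * (U n - S n) + (?r n - 1) * S n) \<longlongrightarrow> 0 + 0) (admissible_at_top k)"
    by (intro tendsto_add) simp_all
  then show ?thesis by (simp add: err_def[abs_def] algebra_simps)
qed

text \<open>Relative to \<open>crit_scale\<close> the difference is err n / S 0, and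
  \<open>S 0\<close> is a positive constant whatever cancels in \<open>S n\<close>.\<close>

theorem difference_smallo:
  "(\<lambda>n. complex_of_real (graph_sum k \<Lambda> n) - crit_sum k \<Lambda> n) \<in> o[admissible_at_top k](crit_scale k \<Lambda>)"
proof (rule smalloI_tendsto)
  have ev: "\<forall>\<^sub>F n in admissible_at_top k. n \<in> admissible k"
    by (simp add: admissible_at_top_def eventually_inf_principal)
  show "\<forall>\<^sub>F n in admissible_at_top k. crit_scale k \<Lambda> n \<noteq> 0"
    using ev
  proof eventually_elim
    case (elim n)
    have "L n * S 0 \<noteq> 0" using L_pos[of n] S_0_pos by simp
    then show ?case unfolding crit_sum_eq(2)[OF elim] by (simp only: of_real_eq_0_iff) simp
  qed
  have "((\<lambda>n. complex_of_real (err n / S 0)) \<longlongrightarrow> of_real (0 / S 0)) (admissible_at_top k)"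
    using S_0_pos by (intro tendsto_intros err_tendsto) simp
  moreover have "\<forall>\<^sub>F n in admissible_at_top k. complex_of_real (err n / S 0) =
      (complex_of_real (graph_sum k \<Lambda> n) - crit_sum k \<Lambda> n) / crit_scale k \<Lambda> n"
    using ev
  proof eventually_elim
    case (elim n)
    have "err n / S 0 = (L n * (S n + err n) - L n * S n) / (L n * S 0)"
      using L_pos[of n] by (simp add: algebra_simps)
    then show ?case
      unfolding crit_sum_eq[OF elim] graph_sum_eq_err[OF elim] by simp
  qed
  ultimately show "((\<lambda>n. (complex_of_real (graph_sum k \<Lambda> n) - crit_sum k \<Lambda> n) / crit_scale k \<Lambda> n) \<longlongrightarrow> 0)
      (admissible_at_top k)"
    by (simp add: Lim_transform_eventually)
qed

theorem quotient_asymp_equiv: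
  "(\<lambda>n. complex_of_real (graph_sum k \<Lambda> n)) \<sim>[quotient_at_top k (crit_sum k \<Lambda>)] crit_sum k \<Lambda>"
proof (rule asymp_equivI')
  let ?Q = "quotient_at_top k (crit_sum k \<Lambda>)"
  have ev: "\<forall>\<^sub>F n in ?Q. n \<in> admissible k \<and> crit_sum k \<Lambda> n \<noteq> 0"
    by (simp add: quotient_at_top_def eventually_inf_principal)
  have "?Q \<le> admissible_at_top k"
    unfolding quotient_at_top_def admissible_at_top_def by (intro inf_mono) auto
  then have err: "(err \<longlongrightarrow> 0) ?Q" using err_tendsto by (rule tendsto_mono)
  \<comment> \<open>\<open>S\<close> takes only the values \<open>S 0\<close> and
    \<open>S 1\<close>. If \<open>S 1\<close> vanishes, the nonzero values are all equal to
    \<open>S 0\<close>, and otherwise the smaller modulus is a lower bound; so the relative error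
    err n / S n tends to 0.\<close>
  define d where "d = (if S 1 = 0 then S 0 else min (S 0) \<bar>S 1\<bar>)"
  have d: "d > 0" "\<And>n. S n \<noteq> 0 \<Longrightarrow> d \<le> \<bar>S n\<bar>"
  proof -
    show "d > 0" using S_0_pos by (simp add: d_def)
    fix n assume "S n \<noteq> 0"
    then show "d \<le> \<bar>S n\<bar>" using S_parity[of n] S_0_pos by (auto simp: d_def split: if_splits)
  qed
  have SQ: "\<forall>\<^sub>F n in ?Q. S n \<noteq> 0"
    using ev by eventually_elim (use crit_sum_eq in auto)
  have "((\<lambda>n. err n / S n) \<longlongrightarrow> 0) ?Q"
  proof (rule Lim_null_comparison)
    have "((\<lambda>n. \<bar>err n\<bar> / d) \<longlongrightarrow> \<bar>0\<bar> / d) ?Q" using d(1) by (intro tendsto_intros err) simp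
    then show "((\<lambda>n. \<bar>err n\<bar> / d) \<longlongrightarrow> 0) ?Q" by simp
    show "\<forall>\<^sub>F n in ?Q. norm (err n / S n) \<le> \<bar>err n\<bar> / d"
      using SQ
    proof eventually_elim
      case (elim n)
      show ?case using d(1) d(2)[OF elim] by (simp add: abs_divide frac_le)
    qed
  qed
  then have "((\<lambda>n. complex_of_real (1 + err n / S n)) \<longlongrightarrow> of_real (1 + 0)) ?Q" by (intro tendsto_intros)
  then have "((\<lambda>n. complex_of_real (1 + err n / S n)) \<longlongrightarrow> 1) ?Q" by (simp only: add_0_right of_real_1)
  moreover have "\<forall>\<^sub>F n in ?Q. complex_of_real (1 + err n / S n) =
      complex_of_real (graph_sum k \<Lambda> n) / crit_sum k \<Lambda> n"
    using ev SQ
  proof eventually_elim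
    case (elim n)
    have adm: "n \<in> admissible k" using elim by simp
    have "1 + err n / S n = L n * (S n + err n) / (L n * S n)"
      using L_pos[of n] elim by (simp add: add_divide_distrib)
    then show ?case unfolding crit_sum_eq[OF adm] graph_sum_eq_err[OF adm] by simp
  qed
  ultimately show "((\<lambda>n. complex_of_real (graph_sum k \<Lambda> n) / crit_sum k \<Lambda> n) \<longlongrightarrow> 1) ?Q"
    by (rule Lim_transform_eventually)
qed

end

theorem theorem1p1:
  fixes k :: nat and \<Lambda> :: "('c::finite \<Rightarrow> nat) \<Rightarrow> real"
  assumes "k \<ge> 3"
    and "\<exists>w\<in>multi_indices k. \<Lambda> w \<noteq> 0"
    and "\<forall>z\<in>Psi (action_poly k \<Lambda>). det (Hess (action_poly k \<Lambda>) z) \<noteq> 0"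
  shows "(\<lambda>n. complex_of_real (graph_sum k \<Lambda> n))
           \<sim>[quotient_at_top k (crit_sum k \<Lambda>)] crit_sum k \<Lambda> \<and>
         (\<lambda>n. complex_of_real (graph_sum k \<Lambda> n) - crit_sum k \<Lambda> n)
           \<in> o[admissible_at_top k](crit_scale k \<Lambda>)"
proof -
  interpret nondegenerate_form k \<Lambda> by standard (use assms in auto)
  show ?thesis using quotient_asymp_equiv difference_smallo by blast
qed

end
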